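(* Let $L\colon\mathbb R^n\times\mathbb R^n\to\mathbb R_+$ and $\varphi\colon\mathbb R^n\to\mathbb R_+\cup\{+\infty\}$ satisfy the standing assumptions listed in the context, let $V$ be the value function, and assume that $L$ is locally bounded. Then: (i) $V$ is lower semicontinuous on $\mathbb R_+\times\mathbb R^n$ and satisfies $$\forall (t,x)\in\mathrm{dom}(V),\ t>0,\ \exists u\in\mathbb R^n:\quad D_\uparrow V(t,x)(-1,u)\le -L(x,u), \tag{a}$$ $$\forall (t,x)\in\mathrm{dom}(V),\ \forall u\in\mathbb R^n:\quad D_\downarrow V(t,x)(1,-u)\le L^+(x,u). \tag{b}$$ (ii) Let $W\colon\mathbb R_+\times\mathbb R^n\to\mathbb R_+\cup\{+\infty\}$ be a lower semicontinuous function with $W(0,\cdot)=\varphi$. If for every $(t,x)\in\mathrm{dom}(W)$ with $t>0$ there exists $u\in\mathbb R^n$ such that $D_\uparrow W(t,x)(-1,u)\le -L(x,u)$, then $W\ge V$ on $\mathbb R_+\times\mathbb R^n$. If for every $(t,x)\in\mathrm{dom}(W)$ and every $u\in\mathbb R^n$ one has $D_\downarrow W(t,x)(1,-u)\le L^+(x,u)$, then $W\le V$ on $\mathbb R_+\times\mathbb R^n$. (iii) Therefore $V$ is the unique non-negative lower semicontinuous function (from $\mathbb R_+\times\mathbb R^n$ to $\mathbb R_+\cup\{+\infty\}$) which satisfies the initial condition $V(0,\cdot)=\varphi$ and conditions (a) and (b).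
   Context: Notation: $\mathbb R_+=[0,+\infty)$. Standing assumptions: $L\colon\mathbb R^n\times\mathbb R^n\to\mathbb R_+$ is lower semicontinuous and $L(x,\cdot)$ is convex for every $x$; there is a convex function $\Theta\colon\mathbb R^n\to\mathbb R_+$ with $\lim_{|u|\to\infty}\Theta(u)/|u|=+\infty$ and $L(x,u)\ge\Theta(u)$ for all $(x,u)$; $\varphi\colon\mathbb R^n\to\mathbb R_+\cup\{+\infty\}$ is lower semicontinuous and not identically $+\infty$. Value function: for $(t,x)\in\mathbb R_+\times\mathbb R^n$, $$V(t,x)=\inf\Big\{\int_0^t L(y(s),y'(s))\,ds+\varphi(y(t)) : y\in W^{1,1}(0,t;\mathbb R^n),\ y(0)=x\Big\},$$ so $V(0,x)=\varphi(x)$. The function $L^+$: for $(x,u)\in\mathbb R^n\times\mathbb R^n$, $$L^+(x,u)=\limsup_{h\to0+}\frac1h\inf\Big\{\int_{-h}^0L(y(s),y'(s))\,ds : y\in W^{1,1}(-h,0;\mathbb R^n),\ y(-h)=x-hu,\ y(0)=x\Big\}.$$ For an extended-real-valued function $W$ of $(t,x)$, $\mathrm{dom}(W)$ is the set where $W<+\infty$. For $(t,x)\in\mathrm{dom}(W)$ and $(\alpha,u)\in\mathbb R\times\mathbb R^n$, $$D_\uparrow W(t,x)(\alpha,u)=\liminf_{h\to0+,\,(\alpha',v)\to(\alpha,u)}\frac{W(t+h\alpha',x+hv)-W(t,x)}{h},$$ $$D_\downarrow W(t,x)(\alpha,u)=\limsup_{h\to0+,\,(\alpha',v)\to(\alpha,u)}\frac{W(t+h\alpha',x+hv)-W(t,x)}{h}.$$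 *)

theory Defs
  imports "HOL-Analysis.Analysis"
begin

definition lsc_on :: "'a::topological_space set \<Rightarrow> ('a \<Rightarrow> 'b::linorder) \<Rightarrow> bool" where
  "lsc_on S f \<longleftrightarrow> (\<forall>x\<in>S. \<forall>c. c < f x \<longrightarrow> (\<forall>\<^sub>F y in at x within S. c < f y))"

definition locally_bounded :: "('a::topological_space \<Rightarrow> 'b::metric_space) \<Rightarrow> bool" where
  "locally_bounded f \<longleftrightarrow> (\<forall>p. \<exists>U. open U \<and> p \<in> U \<and> bounded (f ` U))"

text \<open>Membership \<open>y \<in> W\<^sup>1\<^sup>,\<^sup>1(a,b)\<close> with weak derivative \<open>g\<close>, tested against \<open>C\<^sup>1\<close> functions
  of compact support in the open interval. The function \<open>y\<close> is the continuous
  representative on \<open>{a..b}\<close>, so that its values at the endpoints make sense; \<open>g\<close> is any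
  representative of \<open>y'\<close>, determined almost everywhere on \<open>(a,b)\<close>.\<close>

definition W11 :: "real \<Rightarrow> real \<Rightarrow> (real \<Rightarrow> 'a::euclidean_space) \<Rightarrow> (real \<Rightarrow> 'a) \<Rightarrow> bool" where
  "W11 a b y g \<longleftrightarrow>
     continuous_on {a..b} y \<and>
     set_integrable lebesgue {a<..<b} y \<and>
     set_integrable lebesgue {a<..<b} g \<and>
     (\<forall>\<psi>::real \<Rightarrow> real.
        \<psi> C1_differentiable_on UNIV \<and>
        compact (closure {s. \<psi> s \<noteq> 0}) \<and> closure {s. \<psi> s \<noteq> 0} \<subseteq> {a<..<b} \<longrightarrow>
        (LINT s:{a<..<b}|lebesgue. deriv \<psi> s *\<^sub>R y s) =
          - (LINT s:{a<..<b}|lebesgue. \<psi> s *\<^sub>R g s))"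

text \<open>The integral of \<open>L(y,y')\<close> over \<open>[a,b]\<close>, possibly infinite. The truncation in
  \<^const>\<open>ennreal\<close> has no effect for a non-negative \<open>L\<close>.\<close>

definition action ::
  "('a::euclidean_space \<Rightarrow> 'a \<Rightarrow> real) \<Rightarrow> real \<Rightarrow> real \<Rightarrow> (real \<Rightarrow> 'a) \<Rightarrow> (real \<Rightarrow> 'a) \<Rightarrow> ereal" where
  "action L a b y g = enn2ereal (\<integral>\<^sup>+s\<in>{a..b}. ennreal (L (y s) (g s)) \<partial>lebesgue)"

text \<open>Functions of \<open>(t,x)\<close> are total on \<open>real \<times> (real ^ 'n)\<close>; only their values for \<open>t \<ge> 0\<close> are
  meaningful.\<close>

definition value_fun ::
  "(real ^ 'n \<Rightarrow> real ^ 'n \<Rightarrow> real) \<Rightarrow> (real ^ 'n \<Rightarrow> ereal) \<Rightarrow> real \<times> (real ^ 'n) \<Rightarrow> ereal" where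
  "value_fun L \<phi> = (\<lambda>(t, x). Inf {action L 0 t y g + \<phi> (y t) | y g. W11 0 t y g \<and> y 0 = x})"

definition Lplus :: "(real ^ 'n \<Rightarrow> real ^ 'n \<Rightarrow> real) \<Rightarrow> real ^ 'n \<Rightarrow> real ^ 'n \<Rightarrow> ereal" where
  "Lplus L x u =
     Limsup (at_right 0) (\<lambda>h::real. ereal (1 / h) *
       Inf {action L (-h) 0 y g | y g. W11 (-h) 0 y g \<and> y (-h) = x - h *\<^sub>R u \<and> y 0 = x})"

text \<open>In the two directional derivatives the direction \<open>d'\<close> tends to \<open>d\<close> with \<open>d' = d\<close> allowed. They
  are used only at \<open>p\<close> with \<open>W p\<close> finite. At \<open>p = (t,x)\<close> they are taken in directions \<open>(-1,u)\<close> with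
  \<open>t > 0\<close> or \<open>(1,-u)\<close> with \<open>t \<ge> 0\<close>, so the points \<open>p + h *\<^sub>R d'\<close> eventually have a positive time
  component.\<close>

definition D_up :: "('a::real_normed_vector \<Rightarrow> ereal) \<Rightarrow> 'a \<Rightarrow> 'a \<Rightarrow> ereal" where
  "D_up W p d =
     Liminf (at_right (0::real) \<times>\<^sub>F nhds d) (\<lambda>(h, d'). (W (p + h *\<^sub>R d') - W p) / ereal h)"

definition D_down :: "('a::real_normed_vector \<Rightarrow> ereal) \<Rightarrow> 'a \<Rightarrow> 'a \<Rightarrow> ereal" where
  "D_down W p d =
     Limsup (at_right (0::real) \<times>\<^sub>F nhds d) (\<lambda>(h, d'). (W (p + h *\<^sub>R d') - W p) / ereal h)"

definition cond_a ::
  "(real ^ 'n \<Rightarrow> real ^ 'n \<Rightarrow> real) \<Rightarrow> (real \<times> (real ^ 'n) \<Rightarrow> ereal) \<Rightarrow> bool" where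
  "cond_a L W \<longleftrightarrow> (\<forall>t x. 0 < t \<and> W (t, x) < \<infinity> \<longrightarrow> (\<exists>u. D_up W (t, x) (-1, u) \<le> - ereal (L x u)))"

definition cond_b ::
  "(real ^ 'n \<Rightarrow> real ^ 'n \<Rightarrow> real) \<Rightarrow> (real \<times> (real ^ 'n) \<Rightarrow> ereal) \<Rightarrow> bool" where
  "cond_b L W \<longleftrightarrow> (\<forall>t x. 0 \<le> t \<and> W (t, x) < \<infinity> \<longrightarrow> (\<forall>u. D_down W (t, x) (1, -u) \<le> Lplus L x u))"

definition nonneg_lsc_with_initial ::
  "(real ^ 'n \<Rightarrow> ereal) \<Rightarrow> (real \<times> (real ^ 'n) \<Rightarrow> ereal) \<Rightarrow> bool" where
  "nonneg_lsc_with_initial \<phi> W \<longleftrightarrow>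
     (\<forall>t\<ge>0. \<forall>x. 0 \<le> W (t, x)) \<and> lsc_on ({0..} \<times> UNIV) W \<and> (\<forall>x. W (0, x) = \<phi> x)"

end

theory Submission
  imports Defs "HOL-Complex_Analysis.Great_Picard"
begin

text \<open>
  The growth of \<open>L\<close> enters only through the bounds \<open>norm u \<le> \<eta> * L x u + K\<close>, one for each \<open>\<eta> > 0\<close>:
  trajectories of bounded action are equicontinuous and their velocities are uniformly integrable.
  By strict convexity of \<open>norm (1, u)\<close> in \<open>u\<close>, suitable convex combinations of the velocities converge in
  \<open>L\<^sup>1\<close>, which replaces weak compactness. An affine minorant of \<open>L x\<close> is, up to a small error, a minorant
  of \<open>L \<xi>\<close> for \<open>\<xi>\<close> near \<open>x\<close>, so the action is lower semicontinuous along such sequences, and so is the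
  value function \<open>V\<close>.

  For (a), a near-minimiser leaves \<open>x\<close> with bounded speed: otherwise it would be cheaper to leave at
  speed 1 and to recover the lost time later, on a stretch where the average speed is moderate.
  Difference quotients of near-minimisers then accumulate at a suitable \<open>u\<close>. For (b), a path ending at
  \<open>x\<close> is joined at moderate speed from any nearby starting point.

  If \<open>W\<close> satisfies (a), the descent steps are concatenated, up to the final time, to trajectories for
  relaxed Lagrangians, and letting the relaxation parameter tend to 0 gives \<open>W \<ge> V\<close>. If \<open>W\<close> satisfies (b),
  its growth is estimated backwards along an arbitrary trajectory; the null set of bad times is covered by
  a small open set, on which the trajectory is slowed down, and lower semicontinuity of \<open>W\<close> makes up for
  the delay.
\<close>

subsection \<open>Absolutely continuous functions\<close>

text \<open>The obstacle that shapes the proof is that \<open>L\<close> need not be continuous in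
  \<open>x\<close> and has no upper growth bound in \<open>u\<close>: shifting or reparametrising a
  path may change its cost without control. Competitors are therefore glued from untouched pieces of
  given paths and from straight segments with bounded position and velocity, on which local
  boundedness gives a cost of at most \<open>M\<close> per unit of time. \<open>steer\<close>
  records just what such gluing needs: duration, end points and an upper bound on the cost. Both
  comparison arguments are inductions along a real interval: the parameters at which the estimate
  holds form a closed set, by lower semicontinuity of \<open>W\<close> and compactness, and each of
  them before the end can be increased. Steps of no uniform length are harmless then, and no
  differentiability of \<open>W\<close> is involved. Closedness is also the reason for estimates
  with non-strict inequalities and a small linear error term. The directional derivatives let the
  time component vary together with the space component. Descent directions are therefore normalised
  to unit time rate, and condition (b) for the value function demands competitors whose starting
  point and duration are both perturbed.\<close>

lemma has_real_derivative_max_0_square: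
  "((\<lambda>r::real. (max 0 r)\<^sup>2) has_real_derivative 2 * max 0 r) (at r)"
proof -
  have eq: "(max 0 r)\<^sup>2 = (r\<^sup>2 + r * \<bar>r\<bar>) / 2" for r :: real
    by (auto simp: max_def power2_eq_square abs_if)
  have "((\<lambda>r::real. r * \<bar>r\<bar>) has_real_derivative 2 * \<bar>r\<bar>) (at r)"
  proof (cases "r = 0")
    case True
    have "(\<lambda>h::real. \<bar>h\<bar>) \<midarrow>0\<rightarrow> 0"
      using tendsto_rabs[OF tendsto_ident_at, of "0::real" UNIV] by simp
    moreover have "\<forall>\<^sub>F h::real in at 0. \<bar>h\<bar> = (h * \<bar>h\<bar>) / h"
      by (auto simp: eventually_at_filter)
    ultimately have "(\<lambda>h::real. (h * \<bar>h\<bar>) / h) \<midarrow>0\<rightarrow> 0"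
      by (rule Lim_transform_eventually)
    then show ?thesis
      using True by (simp add: DERIV_def)
  next
    case False
    consider "0 < r" | "r < 0" using False by linarith
    then show ?thesis
    proof cases
      case 1
      show ?thesis
        by (rule has_field_derivative_transform_within_open[of "\<lambda>r. r\<^sup>2" _ _ "{0<..}"])
          (use 1 in \<open>auto intro!: derivative_eq_intros simp: power2_eq_square\<close>)
    next
      case 2
      show ?thesis
        by (rule has_field_derivative_transform_within_open[of "\<lambda>r. - r\<^sup>2" _ _ "{..<0}"])
          (use 2 in \<open>auto intro!: derivative_eq_intros simp: power2_eq_square\<close>)
    qed
  qed
  moreover have "((\<lambda>r::real. r\<^sup>2) has_real_derivative 2 * r) (at r)"
    by (auto intro!: derivative_eq_intros)
  ultimately have "((\<lambda>r::real. (r\<^sup>2 + r * \<bar>r\<bar>) / 2) has_real_derivative (2 * r + 2 * \<bar>r\<bar>) / 2) (at r)"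
    by (intro DERIV_cdivide DERIV_add)
  then show ?thesis
    unfolding eq by (rule DERIV_cong) (auto simp: max_def)
qed

text \<open>The tent on \<open>{0..1}\<close> with peak 2 at 1/2, hence of integral 1.\<close>

definition hat :: "real \<Rightarrow> real" where
  "hat r = 4 * max 0 r - 8 * max 0 (r - 1/2) + 4 * max 0 (r - 1)"

text \<open>The primitive of \<open>hat\<close>: a quadratic spline that rises from 0 to 1 on
  \<open>{0..1}\<close>. It is just smooth enough to build \<open>C1\<close> test functions
  from.\<close>

definition smooth_step :: "real \<Rightarrow> real" where
  "smooth_step r = 2 * (max 0 r)\<^sup>2 - 4 * (max 0 (r - 1/2))\<^sup>2 + 2 * (max 0 (r - 1))\<^sup>2"

lemma smooth_step_deriv: "(smooth_step has_real_derivative hat r) (at r)"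
proof -
  have *: "((\<lambda>r::real. (max 0 (r - c))\<^sup>2) has_real_derivative 2 * max 0 (r - c)) (at r)" for c
    by (rule DERIV_chain2[of "\<lambda>r. (max 0 r)\<^sup>2" _ "\<lambda>r. r - c" r 1, THEN DERIV_cong])
      (auto intro!: derivative_eq_intros has_real_derivative_max_0_square)
  show ?thesis
    unfolding smooth_step_def[abs_def] hat_def
    by (rule derivative_eq_intros has_real_derivative_max_0_square * refl)+ simp
qed

lemma hat_nonneg: "0 \<le> hat r"
  by (auto simp: hat_def max_def)

lemma hat_eq_0: "r \<notin> {0..1} \<Longrightarrow> hat r = 0"
  by (auto simp: hat_def max_def)

lemma continuous_on_hat: "continuous_on A hat"
  unfolding hat_def[abs_def] by (intro continuous_intros)

lemma smooth_step_0: "r \<le> 0 \<Longrightarrow> smooth_step r = 0"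
  by (auto simp: smooth_step_def max_def)

lemma smooth_step_1: "1 \<le> r \<Longrightarrow> smooth_step r = 1"
  by (auto simp: smooth_step_def max_def power2_eq_square algebra_simps)

lemma smooth_step_mono: "r \<le> r' \<Longrightarrow> smooth_step r \<le> smooth_step r'"
  by (rule DERIV_nonneg_imp_nondecreasing) (use smooth_step_deriv hat_nonneg in blast)+

lemma smooth_step_bounds: "0 \<le> smooth_step r" "smooth_step r \<le> 1"
  using smooth_step_mono[of "min r 0" r] smooth_step_mono[of r "max r 1"]
  by (auto simp: smooth_step_0 smooth_step_1)

lemma smooth_step_scaled_deriv:
  "((\<lambda>s. smooth_step (m * (s - p))) has_real_derivative m * hat (m * (s - p))) (at s)"
  by (rule DERIV_chain2[of smooth_step _ "\<lambda>s. m * (s - p)" s m, THEN DERIV_cong])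
    (auto intro!: derivative_eq_intros smooth_step_deriv)

lemma hat_scaled_has_integral:
  assumes "0 < m" "a < p" "p + 1 / m \<le> b"
  shows "((\<lambda>s. m * hat (m * (s - p))) has_integral 1) {a..b}"
proof -
  have "1 \<le> m * (b - p)" using assms by (simp add: field_simps)
  moreover have "m * (a - p) \<le> 0" using assms by (simp add: mult_nonneg_nonpos)
  moreover have "a \<le> b" using assms by (smt (verit) divide_nonneg_pos)
  ultimately show ?thesis
    using fundamental_theorem_of_calculus[of a b "\<lambda>s. smooth_step (m * (s - p))" "\<lambda>s. m * hat (m * (s - p))"]
      smooth_step_scaled_deriv[of m p] 
    by (auto simp: has_real_derivative_iff_has_vector_derivative smooth_step_0 smooth_step_1
        intro: has_vector_derivative_at_within)
qed

text \<open>The rescaled tents have mass 1 and live on \<open>{p..p + 1 / n}\<close>, so the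
  integral is an average of \<open>y\<close> over a shrinking interval to the right of
  \<open>p\<close>.\<close>

lemma hat_concentrates:
  fixes y :: "real \<Rightarrow> 'a::euclidean_space"
  assumes y: "continuous_on {a..b} y" and p: "a < p" "p < b"
  shows "(\<lambda>n. integral {a..b} (\<lambda>s. (real n * hat (real n * (s - p))) *\<^sub>R y s)) \<longlonglongrightarrow> y p"
proof (rule LIMSEQ_I)
  fix r :: real assume "0 < r"
  have "isCont y p"
    using y p by (simp add: continuous_on_interior)
  then obtain d where d: "d > 0" "\<And>s. \<bar>s - p\<bar> < d \<Longrightarrow> norm (y s - y p) < r / 2"
    using \<open>0 < r\<close> unfolding continuous_at_eps_delta by (metis half_gt_zero dist_norm real_norm_def)
  obtain N where N: "inverse (real (Suc N)) < min d (b - p)"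
    using reals_Archimedean[of "min d (b - p)"] d p by auto
  show "\<exists>no. \<forall>n\<ge>no. norm (integral {a..b} (\<lambda>s. (real n * hat (real n * (s - p))) *\<^sub>R y s) - y p) < r"
  proof (intro exI allI impI)
    fix n assume n: "Suc N \<le> n"
    then have "1 / real n \<le> inverse (real (Suc N))"
      by (simp add: field_simps)
    then have n1: "1 / real n < d" "p + 1 / real n \<le> b" and n0: "0 < real n"
      using N n by auto
    let ?k = "\<lambda>s. real n * hat (real n * (s - p))"
    have k1: "(?k has_integral 1) {a..b}"
      by (rule hat_scaled_has_integral) (use n1 n0 p in auto)
    have kc: "continuous_on {a..b} ?k"
      by (intro continuous_intros continuous_on_compose2[OF continuous_on_hat[of UNIV]]) auto
    have ky: "(\<lambda>s. ?k s *\<^sub>R y s) integrable_on {a..b}"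
      by (intro integrable_continuous_interval continuous_intros kc y)
    have kp: "((\<lambda>s. ?k s *\<^sub>R y p) has_integral y p) {a..b}"
      using has_integral_scaleR_left[OF k1, of "y p"] by simp
    have "norm (integral {a..b} (\<lambda>s. ?k s *\<^sub>R y s) - y p)
        = norm (integral {a..b} (\<lambda>s. ?k s *\<^sub>R (y s - y p)))"
      using ky kp by (simp add: scaleR_diff_right integral_diff has_integral_iff)
    also have "\<dots> \<le> integral {a..b} (\<lambda>s. ?k s * (r / 2))"
    proof (rule integral_norm_bound_integral)
      show "(\<lambda>s. ?k s *\<^sub>R (y s - y p)) integrable_on {a..b}"
        by (intro integrable_continuous_interval continuous_intros kc y)
      show "(\<lambda>s. ?k s * (r / 2)) integrable_on {a..b}"
        by (intro integrable_continuous_interval continuous_intros kc)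
      fix s assume "s \<in> {a..b}"
      show "norm (?k s *\<^sub>R (y s - y p)) \<le> ?k s * (r / 2)"
      proof (cases "real n * (s - p) \<in> {0..1}")
        case True
        then have "\<bar>s - p\<bar> \<le> 1 / real n"
          using n0 by (simp add: field_simps zero_le_mult_iff)
        then have "norm (y s - y p) \<le> r / 2"
          using d(2)[of s] n1 by auto
        then show ?thesis
          using n0 hat_nonneg by (simp add: abs_mult mult_left_mono)
      qed (simp add: hat_eq_0)
    qed
    also have "\<dots> = r / 2"
      using has_integral_mult_left[OF k1, of "r / 2"] by (simp add: has_integral_iff)
    also have "\<dots> < r" using \<open>0 < r\<close> by simp
    finally show "norm (integral {a..b} (\<lambda>s. ?k s *\<^sub>R y s) - y p) < r" .
  qed
qed


text \<open>Telescoping over a fine uniform subdivision bounds the total increment of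
  \<open>E\<close> by \<open>e * (N b - N a)\<close>, and \<open>e\<close> is arbitrary. This
  replaces differentiation almost everywhere when a product rule for absolutely continuous functions
  is needed.\<close>

lemma eq_if_increments_small:
  fixes E :: "real \<Rightarrow> 'a::real_normed_vector" and N :: "real \<Rightarrow> real"
  assumes "a \<le> b"
    and incr: "\<And>e. 0 < e \<Longrightarrow> \<exists>d>0. \<forall>s s'. a \<le> s \<longrightarrow> s \<le> s' \<longrightarrow> s' \<le> b \<longrightarrow> s' - s < d \<longrightarrow>
      norm (E s' - E s) \<le> e * (N s' - N s)"
  shows "E b = E a"
proof -
  have le: "norm (E b - E a) \<le> e * (N b - N a)" if "0 < e" for e
  proof -
    obtain d where "d > 0" and d: "\<And>s s'. a \<le> s \<Longrightarrow> s \<le> s' \<Longrightarrow> s' \<le> b \<Longrightarrow> s' - s < d \<Longrightarrow>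
      norm (E s' - E s) \<le> e * (N s' - N s)"
      using incr[OF \<open>0 < e\<close>] by blast
    obtain n where "inverse (real (Suc n)) < d / (b - a + 1)"
      using reals_Archimedean[of "d / (b - a + 1)"] \<open>d > 0\<close> \<open>a \<le> b\<close> by auto
    then have n: "(b - a) / real (Suc n) < d"
      using \<open>a \<le> b\<close> \<open>d > 0\<close> by (simp add: field_simps)
    define p where "p i = a + real i * ((b - a) / real (Suc n))" for i :: nat
    have p_Suc: "p (Suc i) - p i = (b - a) / real (Suc n)" for i
      by (simp add: p_def distrib_right add_divide_distrib)
    have "p i \<le> b" if "i \<le> Suc n" for i
    proof -
      have "real i / real (Suc n) * (b - a) \<le> 1 * (b - a)"
        using that \<open>a \<le> b\<close> by (intro mult_right_mono) auto
      then show ?thesis by (simp add: p_def)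
    qed
    moreover have "a \<le> p i" for i
      using \<open>a \<le> b\<close> by (simp add: p_def)
    moreover have "p i \<le> p (Suc i)" for i
      using \<open>a \<le> b\<close> by (simp add: p_def mult_right_mono divide_right_mono)
    ultimately have step: "norm (E (p (Suc i)) - E (p i)) \<le> e * (N (p (Suc i)) - N (p i))"
      if "i \<le> n" for i
      using d p_Suc n that by simp
    have "norm (E (p i) - E a) \<le> e * (N (p i) - N a)" if "i \<le> Suc n" for i
      using that
    proof (induction i)
      case 0
      then show ?case by (simp add: p_def)
    next
      case (Suc i)
      have "norm (E (p (Suc i)) - E a) \<le> norm (E (p (Suc i)) - E (p i)) + norm (E (p i) - E a)"
        by (metis diff_add_cancel add_diff_eq norm_triangle_ineq)
      with Suc step[of i] show ?case by (simp add: algebra_simps)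
    qed
    from this[of "Suc n"] show ?thesis by (simp add: p_def)
  qed
  have "norm (E b - E a) \<le> 0 + e" if "0 < e" for e :: real
  proof -
    define c where "c = e / (\<bar>N b - N a\<bar> + 1)"
    have "0 < c" using that by (simp add: c_def add_nonneg_pos)
    from le[OF this] have "norm (E b - E a) \<le> c * \<bar>N b - N a\<bar>"
      using \<open>0 < c\<close> by (smt (verit) mult_left_mono)
    also have "\<dots> \<le> c * (\<bar>N b - N a\<bar> + 1)" using \<open>0 < c\<close> by (simp add: algebra_simps)
    also have "\<dots> = e" by (simp add: c_def add_nonneg_eq_0_iff)
    finally show ?thesis by simp
  qed
  then have "norm (E b - E a) \<le> 0" by (rule field_le_epsilon)
  then show ?thesis by simp
qed

text \<open>The integral form of \<open>W11\<close>. Absolute integrability is demanded separately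
  because \<open>has_integral\<close> is the gauge integral, which may converge only
  conditionally.\<close>

definition AC_on :: "real \<Rightarrow> real \<Rightarrow> (real \<Rightarrow> 'a::euclidean_space) \<Rightarrow> (real \<Rightarrow> 'a) \<Rightarrow> bool" where
  "AC_on a b y g \<longleftrightarrow> g absolutely_integrable_on {a..b} \<and>
     (\<forall>s\<in>{a..b}. (g has_integral (y s - y a)) {a..s})"

lemma AC_on_increment:
  assumes "AC_on a b y g" "a \<le> s" "s \<le> s'" "s' \<le> b"
  shows "(g has_integral (y s' - y s)) {s..s'}"
proof -
  have "(g has_integral (y s - y a)) {a..s}" "(g has_integral (y s' - y a)) {a..s'}"
    using assms by (auto simp: AC_on_def)
  moreover have "g integrable_on {s..s'}"
    by (rule integrable_subinterval_real[OF has_integral_integrable[OF \<open>(g has_integral (y s' - y a)) {a..s'}\<close>]]) (use assms in auto)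
  moreover have "g integrable_on {a..s'}"
    using \<open>(g has_integral (y s' - y a)) {a..s'}\<close> by (rule has_integral_integrable)
  ultimately have "(y s - y a) + integral {s..s'} g = y s' - y a"
    using Henstock_Kurzweil_Integration.integral_combine[of a s s' g] assms(2,3) by (simp add: has_integral_iff)
  then have "integral {s..s'} g = y s' - y s" by (simp add: algebra_simps)
  then show ?thesis using \<open>g integrable_on {s..s'}\<close> by (simp add: has_integral_iff)
qed

lemma AC_on_norm_integrable:
  "AC_on a b y g \<Longrightarrow> a \<le> s \<Longrightarrow> s' \<le> b \<Longrightarrow> (\<lambda>r. norm (g r)) integrable_on {s..s'}"
  unfolding AC_on_def absolutely_integrable_on_def
  by (rule integrable_subinterval_real[of _ a b]) auto

lemma AC_on_increment_le:
  assumes "AC_on a b y g" "a \<le> s" "s \<le> s'" "s' \<le> b"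
  shows "norm (y s' - y s) \<le> integral {s..s'} (\<lambda>r. norm (g r))"
  using AC_on_increment[OF assms] AC_on_norm_integrable[OF assms(1,2,4)]
  by (auto simp: has_integral_iff dest!: integral_norm_bound_integral[where f = g and g = "\<lambda>r. norm (g r)"])

lemma AC_on_continuous:
  assumes "AC_on a b y g"
  shows "continuous_on {a..b} y"
proof -
  have "continuous_on {a..b} (\<lambda>s. y a + integral {a..s} g)"
    using assms unfolding AC_on_def absolutely_integrable_on_def
    by (intro continuous_intros indefinite_integral_continuous_1) auto
  then show ?thesis
    by (rule continuous_on_eq) (use assms in \<open>auto simp: AC_on_def has_integral_iff\<close>)
qed

lemma absolutely_integrable_scaleR_continuous:
  fixes g :: "real \<Rightarrow> 'a::euclidean_space"
  assumes "continuous_on {a..b} f" "g absolutely_integrable_on {a..b}"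
  shows "(\<lambda>s. f s *\<^sub>R g s) absolutely_integrable_on {a..b}"
  using absolutely_integrable_bounded_measurable_product[of scaleR f "{a..b}" g] assms
    compact_continuous_image[OF assms(1)] compact_imp_bounded
  by (auto simp: bilinear_def linear_iff algebra_simps continuous_imp_measurable_on_sets_lebesgue)

lemma set_lebesgue_integral_open_interval:
  fixes f :: "real \<Rightarrow> 'a::euclidean_space"
  assumes "f absolutely_integrable_on {a..b}"
  shows "(LINT s:{a<..<b}|lebesgue. f s) = integral {a..b} f"
proof -
  have "f absolutely_integrable_on {a<..<b}"
    using assms by (rule set_integrable_subset) auto
  then show ?thesis
    by (simp add: set_lebesgue_integral_eq_integral integral_open_interval_real)
qed

text \<open>A difference of two steep smooth steps is an admissible test function that approximates
  the indicator of the interval from \<open>p\<close> to \<open>q\<close>, while its derivative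
  concentrates at \<open>p\<close> and, with opposite sign, at \<open>q\<close>.\<close>

lemma W11_imp_increment:
  fixes y :: "real \<Rightarrow> 'a::euclidean_space"
  assumes W: "W11 a b y g" and pq: "a < p" "p < q" "q < b"
  shows "integral {p..q} g = y q - y p"
proof -
  from W have y: "continuous_on {a..b} y" and g: "g absolutely_integrable_on {a..b}"
    and weak: "\<And>\<psi>::real \<Rightarrow> real. \<lbrakk>\<psi> C1_differentiable_on UNIV; compact (closure {s. \<psi> s \<noteq> 0});
        closure {s. \<psi> s \<noteq> 0} \<subseteq> {a<..<b}\<rbrakk> \<Longrightarrow>
        (LINT s:{a<..<b}|lebesgue. deriv \<psi> s *\<^sub>R y s) = - (LINT s:{a<..<b}|lebesgue. \<psi> s *\<^sub>R g s)"
    by (auto simp: W11_def absolutely_integrable_on_Icc_iff_Ioo)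
  define \<psi> where "\<psi> n s = smooth_step (real n * (s - p)) - smooth_step (real n * (s - q))" for n :: nat and s
  define \<psi>' where "\<psi>' n s = real n * hat (real n * (s - p)) - real n * hat (real n * (s - q))" for n :: nat and s
  have der: "(\<psi> n has_real_derivative \<psi>' n s) (at s)" for n s
    unfolding \<psi>_def[abs_def] \<psi>'_def by (intro DERIV_diff smooth_step_scaled_deriv)
  have c': "continuous_on A (\<psi>' n)" for n A
    unfolding \<psi>'_def by (intro continuous_intros continuous_on_compose2[OF continuous_on_hat[of UNIV]]) auto
  have c: "continuous_on A (\<psi> n)" for n A
    by (meson DERIV_isCont continuous_at_imp_continuous_on der)
  have eq: "\<forall>\<^sub>F n in sequentially. integral {a..b} (\<lambda>s. \<psi>' n s *\<^sub>R y s) = - integral {a..b} (\<lambda>s. \<psi> n s *\<^sub>R g s)"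
  proof -
    \<comment> \<open>The support reaches \<open>1 / n\<close> beyond \<open>q\<close> and has to
      stay inside the open interval.\<close>
    obtain N where N: "inverse (real (Suc N)) < b - q"
      using reals_Archimedean[of "b - q"] pq by auto
    show ?thesis unfolding eventually_sequentially
    proof (intro exI allI impI)
      fix n assume n: "Suc N \<le> n"
      then have n0: "0 < real n" and "1 / real n \<le> inverse (real (Suc N))"
        by (auto simp: field_simps)
      then have n1: "q + 1 / real n < b" using N by linarith
      have "s \<in> {p..q + 1 / real n}" if "\<psi> n s \<noteq> 0" for s
      proof (rule ccontr)
        assume "s \<notin> {p..q + 1 / real n}"
        then consider "s < p" | "s > q + 1 / real n" by force
        then show False
        proof cases
          case 1
          then show ?thesis using that pq
            by (simp add: \<psi>_def smooth_step_0 mult_nonneg_nonpos)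
        next
          case 2
          then have "1 \<le> real n * (s - q)" using n0 by (simp add: field_simps)
          moreover have "real n * (s - q) \<le> real n * (s - p)" using pq by (intro mult_left_mono) auto
          ultimately show ?thesis using that by (simp add: \<psi>_def smooth_step_1)
        qed
      qed
      then have cl: "closure {s. \<psi> n s \<noteq> 0} \<subseteq> {p..q + 1 / real n}"
        by (intro closure_minimal) auto
      have "compact (closure {s. \<psi> n s \<noteq> 0})"
        using cl by (meson bounded_closed_interval bounded_subset closed_closure compact_eq_bounded_closed)
      moreover have "closure {s. \<psi> n s \<noteq> 0} \<subseteq> {a<..<b}"
        using cl pq n1 by force
      moreover have "\<psi> n C1_differentiable_on UNIV"
        unfolding C1_differentiable_on_def
        using der c' by (intro exI[of _ "\<psi>' n"]) (auto simp: has_real_derivative_iff_has_vector_derivative)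
      ultimately have "(LINT s:{a<..<b}|lebesgue. deriv (\<psi> n) s *\<^sub>R y s) = - (LINT s:{a<..<b}|lebesgue. \<psi> n s *\<^sub>R g s)"
        by (intro weak)
      moreover have "deriv (\<psi> n) = \<psi>' n"
        using der by (auto intro!: DERIV_imp_deriv)
      moreover have "(LINT s:{a<..<b}|lebesgue. \<psi>' n s *\<^sub>R y s) = integral {a..b} (\<lambda>s. \<psi>' n s *\<^sub>R y s)"
        by (intro set_lebesgue_integral_open_interval absolutely_integrable_continuous_real continuous_intros c' y)
      moreover have "(LINT s:{a<..<b}|lebesgue. \<psi> n s *\<^sub>R g s) = integral {a..b} (\<lambda>s. \<psi> n s *\<^sub>R g s)"
        by (intro set_lebesgue_integral_open_interval absolutely_integrable_scaleR_continuous c g)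
      ultimately show "integral {a..b} (\<lambda>s. \<psi>' n s *\<^sub>R y s) = - integral {a..b} (\<lambda>s. \<psi> n s *\<^sub>R g s)"
        by simp
    qed
  qed
  have hat_int: "(\<lambda>s. (real n * hat (real n * (s - r))) *\<^sub>R y s) integrable_on {a..b}" for n r
    by (intro integrable_continuous_interval continuous_intros y
        continuous_on_compose2[OF continuous_on_hat[of UNIV]]) auto
  have "(\<lambda>n. integral {a..b} (\<lambda>s. (real n * hat (real n * (s - p))) *\<^sub>R y s)
           - integral {a..b} (\<lambda>s. (real n * hat (real n * (s - q))) *\<^sub>R y s)) \<longlonglongrightarrow> y p - y q"
    using pq by (intro tendsto_diff hat_concentrates y) auto
  then have lim1: "(\<lambda>n. integral {a..b} (\<lambda>s. \<psi>' n s *\<^sub>R y s)) \<longlonglongrightarrow> y p - y q"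
    by (simp add: \<psi>'_def scaleR_diff_left integral_diff[OF hat_int hat_int])
  \<comment> \<open>The pointwise limit is the indicator of a half-open interval since
    \<open>smooth_step 0 = 0\<close>: the value is 0 at \<open>p\<close>, but 1 at
    \<open>q\<close>.\<close>
  have "(\<lambda>n. integral {a..b} (\<lambda>s. \<psi> n s *\<^sub>R g s)) \<longlonglongrightarrow> integral {a..b} (\<lambda>s. if s \<in> {p<..q} then g s else 0)"
  proof (rule dominated_convergence(2))
    show "(\<lambda>s. \<psi> n s *\<^sub>R g s) integrable_on {a..b}" for n
      using absolutely_integrable_scaleR_continuous[OF c g] by (simp add: absolutely_integrable_on_def)
    show "(\<lambda>s. norm (g s)) integrable_on {a..b}"
      using g by (simp add: absolutely_integrable_on_def)
    show "norm (\<psi> n s *\<^sub>R g s) \<le> norm (g s)" for n s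
    proof -
      have "\<bar>\<psi> n s\<bar> \<le> 1"
        unfolding \<psi>_def using smooth_step_bounds[of "real n * (s - p)"] smooth_step_bounds[of "real n * (s - q)"] by linarith
      then show ?thesis by (simp add: mult_left_le_one_le)
    qed
    have ev1: "\<forall>\<^sub>F n in sequentially. smooth_step (real n * c) = 1" if "c > 0" for c
    proof -
      have "\<forall>\<^sub>F n in sequentially. 1 / c \<le> real n"
        using filterlim_real_sequentially by (auto simp: filterlim_at_top)
      then show ?thesis
        by eventually_elim (use that in \<open>simp add: smooth_step_1 field_simps\<close>)
    qed
    have ev0: "smooth_step (real n * c) = 0" if "c \<le> 0" for c n
      using that by (simp add: smooth_step_0 mult_nonneg_nonpos)
    fix s assume "s \<in> {a..b}"
    have "\<forall>\<^sub>F n in sequentially. \<psi> n s = (if s \<in> {p<..q} then 1 else 0)"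
    proof -
      consider "s \<le> p" | "s \<in> {p<..q}" | "q < s" by force
      then show ?thesis
      proof cases
        case 1
        then show ?thesis using pq by (simp add: \<psi>_def ev0)
      next
        case 2
        then have "\<forall>\<^sub>F n in sequentially. smooth_step (real n * (s - p)) = 1" by (intro ev1) auto
        then show ?thesis by eventually_elim (use 2 in \<open>simp add: \<psi>_def ev0\<close>)
      next
        case 3
        then have "\<forall>\<^sub>F n in sequentially. smooth_step (real n * (s - p)) = 1"
          "\<forall>\<^sub>F n in sequentially. smooth_step (real n * (s - q)) = 1" using pq by (auto intro!: ev1)
        then show ?thesis by eventually_elim (use 3 in \<open>simp add: \<psi>_def\<close>)
      qed
    qed
    then have "\<forall>\<^sub>F n in sequentially. \<psi> n s *\<^sub>R g s = (if s \<in> {p<..q} then g s else 0)"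
      by eventually_elim auto
    then show "(\<lambda>n. \<psi> n s *\<^sub>R g s) \<longlonglongrightarrow> (if s \<in> {p<..q} then g s else 0)"
      by (rule tendsto_eventually)
  qed
  moreover have "integral {a..b} (\<lambda>s. if s \<in> {p<..q} then g s else 0) = integral {p..q} g"
  proof -
    have "integral {a..b} (\<lambda>s. if s \<in> {p<..q} then g s else 0) = integral {p<..q} g"
      using pq by (subst integral_restrict_Int) (auto intro!: arg_cong[where f = "\<lambda>S. integral S g"])
    also have "\<dots> = integral {p..q} g"
      by (rule integral_subset_negligible) (auto intro: negligible_subset[of "{p}"])
    finally show ?thesis .
  qed
  ultimately have "(\<lambda>n. - integral {a..b} (\<lambda>s. \<psi> n s *\<^sub>R g s)) \<longlonglongrightarrow> - integral {p..q} g"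
    by (auto intro: tendsto_minus)
  then have "(\<lambda>n. integral {a..b} (\<lambda>s. \<psi>' n s *\<^sub>R y s)) \<longlonglongrightarrow> - integral {p..q} g"
    by (rule Lim_transform_eventually) (use eq in \<open>auto elim: eventually_mono\<close>)
  with lim1 have "- integral {p..q} g = y p - y q"
    by (metis LIMSEQ_unique)
  then show ?thesis by (metis minus_diff_eq minus_minus)
qed

text \<open>The difference of \<open>y\<close> and the indefinite integral of \<open>g\<close> is
  constant on the open interval, because increments agree there, and on the closed one by
  continuity.\<close>

lemma W11_imp_AC_on:
  fixes y :: "real \<Rightarrow> 'a::euclidean_space"
  assumes W: "W11 a b y g" and "a \<le> b"
  shows "AC_on a b y g"
proof -
  from W have y: "continuous_on {a..b} y" and g: "g absolutely_integrable_on {a..b}"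
    by (auto simp: W11_def absolutely_integrable_on_Icc_iff_Ioo)
  define G where "G s = y s - integral {a..s} g" for s
  have gi: "g integrable_on {a..b}" using g by (simp add: absolutely_integrable_on_def)
  have G: "continuous_on {a..b} G"
    unfolding G_def by (intro continuous_intros y indefinite_integral_continuous_1 gi)
  have const: "G s = G a" if s: "s \<in> {a..b}" for s
  proof (cases "a < b")
    case False
    with s have "s = a" by auto
    then show ?thesis by simp
  next
    case True
    have eq: "G p = G q" if "a < p" "p < q" "q < b" for p q
    proof -
      have "y q = y p + integral {p..q} g"
        using W11_imp_increment[OF W that] by simp
      moreover have "integral {a..q} g = integral {a..p} g + integral {p..q} g"
        using Henstock_Kurzweil_Integration.integral_combine[of a p q g] that
          integrable_subinterval_real[OF gi, of a q] by simp
      ultimately show ?thesis by (simp add: G_def)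
    qed
    define m where "m = (a + b) / 2"
    have m: "a < m" "m < b" using True by (auto simp: m_def)
    have const: "G r = G m" if "r \<in> {a<..<b}" for r
    proof (cases r m rule: linorder_cases)
      case less
      then show ?thesis using that m by (intro eq) auto
    next
      case greater
      then show ?thesis using that m by (intro eq[symmetric]) auto
    qed simp
    have "G r = G m" if "r \<in> {a..b}" for r
      by (rule continuous_constant_on_closure[of "{a<..<b}" G, OF _ const]) (use G True that in auto)
    then have "G s = G m" "G a = G m"
      by (meson s True atLeastAtMost_iff less_imp_le order_refl)+
    then show ?thesis by (metis)
  qed
  have "integral {a..s} g = y s - y a" if "s \<in> {a..b}" for s
    using const[OF that] by (simp add: G_def algebra_simps)
  moreover have "g integrable_on {a..s}" if "s \<in> {a..b}" for s
    by (rule integrable_subinterval_real[OF gi]) (use that in auto)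
  ultimately show ?thesis
    unfolding AC_on_def using g by (simp add: has_integral_iff)
qed

text \<open>This is integration by parts. \<open>E\<close> measures the failure of the product rule
  on \<open>{a..s}\<close> and is shown to be constant by comparing its increments with those of
  \<open>N\<close>.\<close>

lemma AC_on_imp_W11:
  fixes y :: "real \<Rightarrow> 'a::euclidean_space"
  assumes A: "AC_on a b y g" and "a \<le> b"
  shows "W11 a b y g"
proof -
  have y: "continuous_on {a..b} y" and g: "g absolutely_integrable_on {a..b}"
    using A AC_on_continuous by (auto simp: AC_on_def)
  have "(LINT s:{a<..<b}|lebesgue. deriv \<psi> s *\<^sub>R y s) = - (LINT s:{a<..<b}|lebesgue. \<psi> s *\<^sub>R g s)"
    if C1: "\<psi> C1_differentiable_on UNIV" and sup: "closure {s. \<psi> s \<noteq> 0} \<subseteq> {a<..<b}"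
    for \<psi> :: "real \<Rightarrow> real"
  proof -
    obtain \<psi>' where der: "\<And>s. (\<psi> has_vector_derivative \<psi>' s) (at s)" and c': "continuous_on UNIV \<psi>'"
      using C1 by (auto simp: C1_differentiable_on_def)
    have c: "continuous_on A \<psi>" for A
      using der by (intro continuous_at_imp_continuous_on ballI) (rule has_vector_derivative_continuous)
    note c' = continuous_on_subset[OF c' subset_UNIV]
    have "deriv \<psi> = \<psi>'"
      using der by (auto intro!: DERIV_imp_deriv simp: has_real_derivative_iff_has_vector_derivative)
    have ends: "\<psi> a = 0" "\<psi> b = 0"
      using sup closure_subset[of "{s. \<psi> s \<noteq> 0}"] by auto
    have i1: "(\<lambda>s. \<psi>' s *\<^sub>R y s) absolutely_integrable_on {a..b}"
      by (intro absolutely_integrable_continuous_real continuous_intros c' y)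
    have i2: "(\<lambda>s. \<psi> s *\<^sub>R g s) absolutely_integrable_on {a..b}"
      by (intro absolutely_integrable_scaleR_continuous c g)
    have i3: "(\<lambda>s. \<psi>' s *\<^sub>R y s + \<psi> s *\<^sub>R g s) integrable_on {a..b}"
      using set_integral_add(1)[OF i1 i2] by (simp add: absolutely_integrable_on_def)
    \<comment> \<open>The summand 1 absorbs the error from freezing \<open>y\<close>, the summand
      \<open>norm (g r)\<close> the error from freezing \<open>\<psi>\<close>.\<close>
    define N where "N s = integral {a..s} (\<lambda>r. 1 + norm (g r))" for s
    define E where "E s = \<psi> s *\<^sub>R y s - integral {a..s} (\<lambda>s. \<psi>' s *\<^sub>R y s + \<psi> s *\<^sub>R g s)" for s
    have Ni: "(\<lambda>r. 1 + norm (g r)) integrable_on {a..b}"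
      using g by (intro Henstock_Kurzweil_Integration.integrable_add) (auto simp: absolutely_integrable_on_def)
    have "E b = E a"
    proof (rule eq_if_increments_small[OF \<open>a \<le> b\<close>, where N = N])
      fix e :: real assume "0 < e"
      obtain B where "B > 0" and B: "\<And>s. s \<in> {a..b} \<Longrightarrow> \<bar>\<psi>' s\<bar> \<le> B"
        using compact_imp_bounded[OF compact_continuous_image[OF c', of "{a..b}"]]
        unfolding bounded_pos by fastforce
      have u: "uniformly_continuous_on {a..b} y" "uniformly_continuous_on {a..b} \<psi>"
        using y c by (simp_all add: compact_uniformly_continuous)
      have "0 < e / B" using \<open>0 < e\<close> \<open>B > 0\<close> by simp
      with u(1) obtain d1 where "d1 > 0"
        and d1: "\<And>s s'. s \<in> {a..b} \<Longrightarrow> s' \<in> {a..b} \<Longrightarrow> \<bar>s' - s\<bar> < d1 \<Longrightarrow> norm (y s' - y s) < e / B"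
        unfolding uniformly_continuous_on_def dist_norm real_norm_def by blast
      from u(2) \<open>0 < e\<close> obtain d2 where "d2 > 0"
        and d2: "\<And>s s'. s \<in> {a..b} \<Longrightarrow> s' \<in> {a..b} \<Longrightarrow> \<bar>s' - s\<bar> < d2 \<Longrightarrow> \<bar>\<psi> s' - \<psi> s\<bar> < e"
        unfolding uniformly_continuous_on_def dist_norm real_norm_def by blast
      show "\<exists>d>0. \<forall>s s'. a \<le> s \<longrightarrow> s \<le> s' \<longrightarrow> s' \<le> b \<longrightarrow> s' - s < d \<longrightarrow> norm (E s' - E s) \<le> e * (N s' - N s)"
      proof (intro exI[of _ "min d1 d2"] conjI allI impI)
        fix s s' assume s: "a \<le> s" "s \<le> s'" "s' \<le> b" and lt: "s' - s < min d1 d2"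
        have sub: "f integrable_on {s..s'}" if "f integrable_on {a..b}" for f :: "real \<Rightarrow> 'x::banach"
          by (rule integrable_subinterval_real[OF that]) (use s in auto)
        have sub': "f integrable_on {a..s'}" if "f integrable_on {a..b}" for f :: "real \<Rightarrow> 'x::banach"
          by (rule integrable_subinterval_real[OF that]) (use s in auto)
        have N: "N s' - N s = integral {s..s'} (\<lambda>r. 1 + norm (g r))"
          using Henstock_Kurzweil_Integration.integral_combine[OF s(1,2) sub'[OF Ni]] by (simp add: N_def algebra_simps)
        have I: "integral {a..s'} (\<lambda>s. \<psi>' s *\<^sub>R y s + \<psi> s *\<^sub>R g s) - integral {a..s} (\<lambda>s. \<psi>' s *\<^sub>R y s + \<psi> s *\<^sub>R g s)
           = integral {s..s'} (\<lambda>s. \<psi>' s *\<^sub>R y s + \<psi> s *\<^sub>R g s)"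
          using Henstock_Kurzweil_Integration.integral_combine[OF s(1,2) sub'[OF i3]] by (simp add: algebra_simps)
        have J1: "(\<psi>' has_integral (\<psi> s' - \<psi> s)) {s..s'}"
          using s der by (intro fundamental_theorem_of_calculus) (auto intro: has_vector_derivative_at_within)
        have J2: "(g has_integral (y s' - y s)) {s..s'}"
          by (rule AC_on_increment[OF A s])
        \<comment> \<open>With \<open>y\<close> frozen at the right end and \<open>\<psi>\<close> at
          the left end the integrand integrates exactly to the increment of the product. The error
          left is small by uniform continuity.\<close>
        have "((\<lambda>r. \<psi>' r *\<^sub>R y s' + \<psi> s *\<^sub>R g r) has_integral ((\<psi> s' - \<psi> s) *\<^sub>R y s' + \<psi> s *\<^sub>R (y s' - y s))) {s..s'}"
          by (intro has_integral_add has_integral_scaleR_left[OF J1] has_integral_cmul[OF J2])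
        moreover have "(\<psi> s' - \<psi> s) *\<^sub>R y s' + \<psi> s *\<^sub>R (y s' - y s) = \<psi> s' *\<^sub>R y s' - \<psi> s *\<^sub>R y s"
          by (simp add: algebra_simps)
        moreover have "((\<lambda>r. \<psi>' r *\<^sub>R y r + \<psi> r *\<^sub>R g r) has_integral
            (integral {s..s'} (\<lambda>s. \<psi>' s *\<^sub>R y s + \<psi> s *\<^sub>R g s))) {s..s'}"
          by (intro integrable_integral sub i3)
        moreover have "E s' - E s = (\<psi> s' *\<^sub>R y s' - \<psi> s *\<^sub>R y s) - integral {s..s'} (\<lambda>s. \<psi>' s *\<^sub>R y s + \<psi> s *\<^sub>R g s)"
          by (simp add: E_def I[symmetric])
        ultimately have diff: "((\<lambda>r. (\<psi>' r *\<^sub>R y s' + \<psi> s *\<^sub>R g r) - (\<psi>' r *\<^sub>R y r + \<psi> r *\<^sub>R g r)) has_integral (E s' - E s)) {s..s'}"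
          by (simp only: has_integral_diff)
        have "norm (integral {s..s'} (\<lambda>r. (\<psi>' r *\<^sub>R y s' + \<psi> s *\<^sub>R g r) - (\<psi>' r *\<^sub>R y r + \<psi> r *\<^sub>R g r)))
          \<le> integral {s..s'} (\<lambda>r. e * (1 + norm (g r)))"
        proof (rule integral_norm_bound_integral)
          show "(\<lambda>r. (\<psi>' r *\<^sub>R y s' + \<psi> s *\<^sub>R g r) - (\<psi>' r *\<^sub>R y r + \<psi> r *\<^sub>R g r)) integrable_on {s..s'}"
            using diff by (rule has_integral_integrable)
          show "(\<lambda>r. e * (1 + norm (g r))) integrable_on {s..s'}"
            using sub[OF Ni] by (rule integrable_on_mult_right)
          fix r assume r: "r \<in> {s..s'}"
          have "norm ((\<psi>' r *\<^sub>R y s' + \<psi> s *\<^sub>R g r) - (\<psi>' r *\<^sub>R y r + \<psi> r *\<^sub>R g r))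
            = norm (\<psi>' r *\<^sub>R (y s' - y r) + (\<psi> s - \<psi> r) *\<^sub>R g r)"
            by (simp add: algebra_simps)
          also have "\<dots> \<le> \<bar>\<psi>' r\<bar> * norm (y s' - y r) + \<bar>\<psi> s - \<psi> r\<bar> * norm (g r)"
            by (rule order_trans[OF norm_triangle_ineq]) simp
          also have "\<dots> \<le> B * (e / B) + e * norm (g r)"
            using r s lt d1[of r s'] d2[of r s] B[of r] \<open>0 < e\<close> \<open>B > 0\<close>
            by (intro add_mono mult_mono) auto
          also have "\<dots> = e * (1 + norm (g r))"
            using \<open>B > 0\<close> by (simp add: algebra_simps)
          finally show "norm ((\<psi>' r *\<^sub>R y s' + \<psi> s *\<^sub>R g r) - (\<psi>' r *\<^sub>R y r + \<psi> r *\<^sub>R g r)) \<le> e * (1 + norm (g r))" .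
        qed
        then show "norm (E s' - E s) \<le> e * (N s' - N s)"
          unfolding N integral_unique[OF diff] by simp
      qed (use \<open>d1 > 0\<close> \<open>d2 > 0\<close> in auto)
    qed
    then have "integral {a..b} (\<lambda>s. \<psi>' s *\<^sub>R y s + \<psi> s *\<^sub>R g s) = 0"
      by (simp add: E_def ends)
    moreover have "integral {a..b} (\<lambda>s. \<psi>' s *\<^sub>R y s + \<psi> s *\<^sub>R g s)
        = integral {a..b} (\<lambda>s. \<psi>' s *\<^sub>R y s) + integral {a..b} (\<lambda>s. \<psi> s *\<^sub>R g s)"
      using i1 i2 by (intro Henstock_Kurzweil_Integration.integral_add) (auto simp: absolutely_integrable_on_def)
    ultimately show ?thesis
      unfolding \<open>deriv \<psi> = \<psi>'\<close> set_lebesgue_integral_open_interval[OF i1]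
        set_lebesgue_integral_open_interval[OF i2] by (simp add: eq_neg_iff_add_eq_0)
  qed
  then show ?thesis
    using y g absolutely_integrable_continuous_real[OF y] unfolding W11_def
    by (simp add: absolutely_integrable_on_Icc_iff_Ioo)
qed

lemma W11_iff_AC_on: "a \<le> b \<Longrightarrow> W11 a b y g \<longleftrightarrow> AC_on a b y g"
  using W11_imp_AC_on AC_on_imp_W11 by blast

subsection \<open>Convex combinations of velocities\<close>

text \<open>The square root of \<open>1 + (norm u)\<^sup>2\<close>: strictly convex, and yet of
  linear growth, so that it is integrable along every integrable velocity.\<close>

definition norm1 :: "'a::euclidean_space \<Rightarrow> real" where
  "norm1 u = norm (1::real, u)"

definition gap :: "'a::euclidean_space \<Rightarrow> 'a \<Rightarrow> real" where
  "gap u v = (norm1 u + norm1 v) / 2 - norm1 ((u + v) /\<^sub>R 2)"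

lemma norm1_bounds: "0 \<le> norm1 u" "norm1 u \<le> 1 + norm u"
  using norm_Pair_le[of "1::real" u] by (auto simp: norm1_def)

lemma norm1_midpoint: "norm1 ((u + v) /\<^sub>R 2) = norm ((1/2) *\<^sub>R (1::real, u) + (1/2) *\<^sub>R (1::real, v))"
  by (simp add: norm1_def scaleR_add_right)

lemma gap_nonneg: "0 \<le> gap u v"
  using norm_triangle_ineq[of "(1/2) *\<^sub>R (1::real, u)" "(1/2) *\<^sub>R (1::real, v)"]
  unfolding gap_def norm1_midpoint by (simp add: norm1_def del: scaleR_Pair)

text \<open>Equality in the triangle inequality makes \<open>(1, u)\<close> and
  \<open>(1, v)\<close> positively proportional, and their common first coordinate forces the factor
  1.\<close>

lemma gap_pos:
  assumes "u \<noteq> v" shows "0 < gap u v"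
proof (rule ccontr)
  let ?x = "(1/2) *\<^sub>R (1::real, u)" and ?y = "(1/2) *\<^sub>R (1::real, v)"
  assume "\<not> 0 < gap u v"
  then have "norm (?x + ?y) = norm ?x + norm ?y"
    using gap_nonneg[of u v] unfolding gap_def norm1_midpoint by (simp add: norm1_def del: scaleR_Pair)
  then have "norm ?x *\<^sub>R ?y = norm ?y *\<^sub>R ?x"
    by (simp only: norm_triangle_eq)
  then have "norm (1::real, u) = norm (1::real, v)" "norm (1::real, u) *\<^sub>R v = norm (1::real, v) *\<^sub>R u"
    by (auto simp del: scaleR_Pair simp: prod_eq_iff)
  moreover have "norm (1::real, v) \<noteq> 0" by (simp add: zero_prod_def)
  ultimately show False using assms by (metis scaleR_left_imp_eq)
qed

lemma continuous_on_norm1: "continuous_on A norm1"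
  unfolding norm1_def[abs_def] by (intro continuous_intros)

text \<open>Quantitative strict convexity: on the compact set of pairs bounded by
  \<open>2 * K\<close> and at distance at least \<open>\<eta>\<close> the gap has a positive minimum
  \<open>m\<close>. Pairs outside are either close or contain a vector beyond \<open>2 * K\<close>,
  whose excess over \<open>K\<close> then dominates both norms.\<close>

lemma gap_controls_distance:
  assumes "0 < \<eta>" "0 \<le> K"
  obtains C where "0 \<le> C"
    "\<And>u v :: 'a::euclidean_space. norm (u - v) \<le> \<eta> + C * gap u v + 4 * (max 0 (norm u - K) + max 0 (norm v - K))"
proof -
  define S :: "('a \<times> 'a) set" where "S = (cball 0 (2 * K) \<times> cball 0 (2 * K)) \<inter> {p. \<eta> \<le> norm (fst p - snd p)}"
  have "compact S"
    unfolding S_def by (intro compact_Int_closed compact_Times compact_cball closed_Collect_le continuous_intros)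
  have cont: "continuous_on S (\<lambda>p. gap (fst p) (snd p))"
    unfolding gap_def
    by (intro continuous_intros continuous_on_compose2[OF continuous_on_norm1[of UNIV]]) auto
  obtain m where "0 < m" and m: "\<And>p. p \<in> S \<Longrightarrow> m \<le> gap (fst p) (snd p)"
  proof (cases "S = {}")
    case True
    then show ?thesis using that[of 1] by simp
  next
    case False
    then obtain p where "p \<in> S" and p: "\<And>q. q \<in> S \<Longrightarrow> gap (fst p) (snd p) \<le> gap (fst q) (snd q)"
      using continuous_attains_inf[OF \<open>compact S\<close> _ cont] by blast
    have "fst p \<noteq> snd p" using \<open>p \<in> S\<close> \<open>0 < \<eta>\<close> by (auto simp: S_def)
    then show ?thesis using that[of "gap (fst p) (snd p)"] p gap_pos by blast
  qed
  show thesis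
  proof (rule that[of "4 * K / m"])
    show "0 \<le> 4 * K / m" using \<open>0 < m\<close> \<open>0 \<le> K\<close> by simp
    fix u v :: 'a
    have g: "0 \<le> 4 * K / m * gap u v" using \<open>0 \<le> 4 * K / m\<close> gap_nonneg by (intro mult_nonneg_nonneg)
    have tri: "norm (u - v) \<le> norm u + norm v" by (rule norm_triangle_ineq4)
    consider "norm (u - v) < \<eta>" | "norm u > 2 * K \<or> norm v > 2 * K" | "(u, v) \<in> S"
      by (force simp: S_def)
    then show "norm (u - v) \<le> \<eta> + 4 * K / m * gap u v + 4 * (max 0 (norm u - K) + max 0 (norm v - K))"
    proof cases
      case 1
      then show ?thesis using g by (smt (verit))
    next
      case 2
      then have "norm u + norm v \<le> 4 * (max 0 (norm u - K) + max 0 (norm v - K))"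
        using \<open>0 \<le> K\<close> by (auto simp: max_def)
      then show ?thesis using g tri \<open>0 < \<eta>\<close> by linarith
    next
      case 3
      have "norm (u - v) \<le> 4 * K" using tri 3 by (simp add: S_def)
      also have "\<dots> = 4 * K / m * m" using \<open>0 < m\<close> by simp
      also have "\<dots> \<le> 4 * K / m * gap u v"
        using m[OF 3] \<open>0 \<le> 4 * K / m\<close> by (intro mult_left_mono) auto
      finally show ?thesis using \<open>0 < \<eta>\<close> by (smt (verit))
    qed
  qed
qed

section \<open>Finite convex combinations of the terms from index k on\<close>

definition tail_weights :: "nat \<Rightarrow> nat \<Rightarrow> (nat \<Rightarrow> real) \<Rightarrow> bool" where
  "tail_weights k n c \<longleftrightarrow> (\<forall>j. 0 \<le> c j) \<and> (\<forall>j. c j \<noteq> 0 \<longrightarrow> k \<le> j \<and> j < n) \<and> sum c {..<n} = 1"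

lemma sum_extend_weights:
  fixes F :: "nat \<Rightarrow> 'a::real_vector"
  assumes "tail_weights k n c" "n \<le> m"
  shows "(\<Sum>j<m. c j *\<^sub>R F j) = (\<Sum>j<n. c j *\<^sub>R F j)"
  by (rule sum.mono_neutral_right) (use assms in \<open>auto simp: tail_weights_def\<close>)

lemma tail_weights_extend: "tail_weights k n c \<Longrightarrow> n \<le> m \<Longrightarrow> tail_weights k m c"
  using sum_extend_weights[of k n c m "\<lambda>_. 1::real"] by (fastforce simp: tail_weights_def)

lemma tail_weights_mono: "tail_weights k n c \<Longrightarrow> l \<le> k \<Longrightarrow> tail_weights l n c"
  by (fastforce simp: tail_weights_def)

lemma tail_weights_single: "tail_weights k (Suc k) (\<lambda>j. if j = k then 1 else 0)"
  by (auto simp: tail_weights_def)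

lemma tail_weights_midpoint:
  assumes "tail_weights k n c" "tail_weights k m d"
  shows "tail_weights k (max n m) (\<lambda>j. (c j + d j) / 2)"
proof -
  have "tail_weights k (max n m) c" "tail_weights k (max n m) d"
    using assms by (auto intro: tail_weights_extend)
  then have "sum c {..<max n m} = 1" "sum d {..<max n m} = 1"
    and "\<And>j. 0 \<le> c j" "\<And>j. 0 \<le> d j"
    and "\<And>j. c j \<noteq> 0 \<Longrightarrow> k \<le> j \<and> j < max n m" "\<And>j. d j \<noteq> 0 \<Longrightarrow> k \<le> j \<and> j < max n m"
    by (simp_all add: tail_weights_def)
  moreover from this have "(\<Sum>j<max n m. (c j + d j) / 2) = 1"
    by (simp add: sum_divide_distrib[symmetric] sum.distrib)
  ultimately show ?thesis
    unfolding tail_weights_def by (metis add.right_neutral add_nonneg_nonneg div_0 divide_nonneg_pos zero_less_numeral)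
qed

lemma midpoint_combination:
  fixes F :: "nat \<Rightarrow> 'a::real_vector"
  assumes "tail_weights k n c" "tail_weights l m d"
  shows "(\<Sum>j<max n m. ((c j + d j) / 2) *\<^sub>R F j) = ((\<Sum>j<n. c j *\<^sub>R F j) + (\<Sum>j<m. d j *\<^sub>R F j)) /\<^sub>R 2"
proof -
  have "(\<Sum>j<n. c j *\<^sub>R F j) = (\<Sum>j<max n m. c j *\<^sub>R F j)"
    "(\<Sum>j<m. d j *\<^sub>R F j) = (\<Sum>j<max n m. d j *\<^sub>R F j)"
    using assms by (auto intro!: sum_extend_weights[symmetric])
  then have "((\<Sum>j<n. c j *\<^sub>R F j) + (\<Sum>j<m. d j *\<^sub>R F j)) /\<^sub>R 2
      = (\<Sum>j<max n m. (1/2) *\<^sub>R (c j *\<^sub>R F j + d j *\<^sub>R F j))"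
    by (simp add: sum.distrib[symmetric] scaleR_sum_right)
  also have "\<dots> = (\<Sum>j<max n m. ((c j + d j) / 2) *\<^sub>R F j)"
    by (intro sum.cong refl) (simp add: scaleR_add_left[symmetric])
  finally show ?thesis by simp
qed

lemma weighted_sum_le:
  assumes "tail_weights k n c" "\<And>j. k \<le> j \<Longrightarrow> f j \<le> (B::real)"
  shows "(\<Sum>j<n. c j * f j) \<le> B"
proof -
  have "(\<Sum>j<n. c j * f j) \<le> (\<Sum>j<n. c j * B)"
  proof (rule sum_mono)
    fix j assume "j \<in> {..<n}"
    show "c j * f j \<le> c j * B"
      using assms by (cases "c j = 0") (auto simp: tail_weights_def intro!: mult_left_mono)
  qed
  also have "\<dots> = B" using assms(1) by (simp add: tail_weights_def sum_distrib_right[symmetric])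
  finally show ?thesis .
qed

lemma weighted_sum_ge:
  assumes "tail_weights k n c" "\<And>j. k \<le> j \<Longrightarrow> (B::real) \<le> f j"
  shows "B \<le> (\<Sum>j<n. c j * f j)"
  using weighted_sum_le[OF assms(1), of "\<lambda>j. - f j" "- B"] assms(2) by (simp add: sum_negf)

text \<open>The excess over \<open>K\<close> is a convex function, so combinations inherit uniform
  integrability from the sequence.\<close>

lemma excess_norm_combination:
  fixes F :: "nat \<Rightarrow> 'a::euclidean_space"
  assumes "tail_weights k n c"
  shows "max 0 (norm (\<Sum>j<n. c j *\<^sub>R F j) - K) \<le> (\<Sum>j<n. c j * max 0 (norm (F j) - K))"
proof -
  have c: "0 \<le> c j" for j using assms by (simp add: tail_weights_def)
  have "norm (\<Sum>j<n. c j *\<^sub>R F j) \<le> (\<Sum>j<n. c j * norm (F j))"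
    by (rule order_trans[OF norm_sum]) (use c in simp)
  moreover have "(\<Sum>j<n. c j * norm (F j)) - K = (\<Sum>j<n. c j * (norm (F j) - K))"
    using assms by (simp add: right_diff_distrib sum_subtractf sum_distrib_right[symmetric] tail_weights_def)
  moreover have "(\<Sum>j<n. c j * (norm (F j) - K)) \<le> (\<Sum>j<n. c j * max 0 (norm (F j) - K))"
    using c by (intro sum_mono mult_left_mono) auto
  moreover have "0 \<le> (\<Sum>j<n. c j * max 0 (norm (F j) - K))"
    using c by (intro sum_nonneg) auto
  ultimately show ?thesis by auto
qed


text \<open>For each \<open>k\<close> a combination of the terms from \<open>k\<close> on is chosen
  that nearly minimises the integral of \<open>norm1\<close>. The midpoint of two such choices is
  again a tail combination and cannot do much better, so the integrated gap is small. Uniform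
  integrability converts this into the Cauchy property in \<open>L\<^sup>1\<close>.\<close>

theorem tail_combinations_L1_convergent:
  fixes F :: "nat \<Rightarrow> 'x \<Rightarrow> 'a::euclidean_space"
  assumes "finite_measure M" and F: "\<And>j. integrable M (F j)"
    and UI: "\<And>e. 0 < e \<Longrightarrow> \<exists>K. \<forall>j. (\<integral>x. max 0 (norm (F j x) - K) \<partial>M) \<le> e"
  obtains c n g where "\<And>k. tail_weights k (n k) (c k)" "integrable M g"
    "(\<lambda>k. \<integral>x. norm ((\<Sum>j<n k. c k j *\<^sub>R F j x) - g x) \<partial>M) \<longlonglongrightarrow> 0"
    "AE x in M. (\<lambda>k. \<Sum>j<n k. c k j *\<^sub>R F j x) \<longlonglongrightarrow> g x"
proof -
  interpret finite_measure M by fact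
  note [measurable] = borel_measurable_integrable[OF F]
  let ?comb = "\<lambda>c n x. \<Sum>j<n. c j *\<^sub>R F j x"
  let ?exc = "\<lambda>K f x. max 0 (norm (f x) - K)"
  have excI: "integrable M (?exc K f)" if "integrable M f" for K and f :: "'x \<Rightarrow> 'a"
    by (rule Bochner_Integration.integrable_bound[OF Bochner_Integration.integrable_add[OF integrable_norm[OF that] integrable_const[of "\<bar>K\<bar>"]]])
      (use that in auto)
  have combI: "integrable M (?comb c n)" for c n
    by (intro Bochner_Integration.integrable_sum integrable_scaleR_right F)
  have norm1I: "integrable M (\<lambda>x. norm1 (f x))" if "integrable M f" for f :: "'x \<Rightarrow> 'a"
  proof (rule Bochner_Integration.integrable_bound[OF Bochner_Integration.integrable_add[OF integrable_const[of 1] integrable_norm[OF that]]])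
    show "(\<lambda>x. norm1 (f x)) \<in> borel_measurable M"
      using borel_measurable_continuous_onI[OF continuous_on_norm1] borel_measurable_integrable[OF that]
      by (rule measurable_compose_rev)
    show "AE x in M. norm (norm1 (f x)) \<le> norm (1 + norm (f x))"
      using norm1_bounds[of "f _"] by (intro AE_I2) (simp add: abs_of_nonneg)
  qed
  define \<Phi> where "\<Phi> c n = (\<integral>x. norm1 (?comb c n x) \<partial>M)" for c n
  have \<Phi>_nonneg: "0 \<le> \<Phi> c n" for c n
    unfolding \<Phi>_def by (intro integral_nonneg_AE AE_I2 norm1_bounds)
  define V where "V k = {\<Phi> c n | c n. tail_weights k n c}" for k
  define I where "I k = Inf (V k)" for k
  have bdd: "bdd_below (V k)" for k
    using \<Phi>_nonneg by (auto simp: V_def intro!: bdd_belowI[of _ 0])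
  have ne: "V k \<noteq> {}" for k
    using tail_weights_single by (auto simp: V_def)
  \<comment> \<open>Later tails offer fewer combinations, so the infima increase; being bounded,
    they converge, and \<open>I l - I k\<close> becomes small.\<close>
  have "incseq I"
    unfolding I_def by (intro monoI cInf_superset_mono ne bdd) (auto simp: V_def intro: tail_weights_mono)
  obtain K1 where K1: "\<And>j. (\<integral>x. ?exc K1 (F j) x \<partial>M) \<le> 1"
    using UI[of 1] by auto
  have I_le: "I k \<le> (\<integral>x. (1 + K1) \<partial>M) + 1" for k
  proof -
    have "I k \<le> \<Phi> (\<lambda>j. if j = k then 1 else 0) (Suc k)"
      unfolding I_def using tail_weights_single by (intro cInf_lower bdd) (auto simp: V_def)
    also have "\<dots> = (\<integral>x. norm1 (F k x) \<partial>M)"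
      by (simp add: \<Phi>_def if_distrib[of "\<lambda>r. r *\<^sub>R _"] cong: if_cong)
    also have "\<dots> \<le> (\<integral>x. (1 + K1) + ?exc K1 (F k) x \<partial>M)"
    proof (intro integral_mono norm1I F Bochner_Integration.integrable_add integrable_const excI)
      fix x show "norm1 (F k x) \<le> 1 + K1 + ?exc K1 (F k) x"
        using norm1_bounds(2)[of "F k x"] by linarith
    qed
    also have "\<dots> = (\<integral>x. (1 + K1) \<partial>M) + (\<integral>x. ?exc K1 (F k) x \<partial>M)"
      by (intro Bochner_Integration.integral_add integrable_const excI F)
    also have "\<dots> \<le> (\<integral>x. (1 + K1) \<partial>M) + 1" using K1 by simp
    finally show ?thesis .
  qed
  obtain L where L: "I \<longlonglongrightarrow> L"
    using incseq_convergent[OF \<open>incseq I\<close>] I_le by metis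
  have "\<exists>c n. tail_weights k n c \<and> \<Phi> c n < I k + 1 / Suc k" for k
    using cInf_lessD[OF ne[of k], of "I k + 1 / Suc k"] by (auto simp: V_def I_def)
  then obtain c n where w: "\<And>k. tail_weights k (n k) (c k)" and \<Phi>_lt: "\<And>k. \<Phi> (c k) (n k) < I k + 1 / Suc k"
    by metis
  define f where "f k = ?comb (c k) (n k)" for k
  have fI: "integrable M (f k)" for k unfolding f_def by (rule combI)
  have norm1_lt: "(\<integral>x. norm1 (f k x) \<partial>M) < I k + 1 / Suc k" for k
    using \<Phi>_lt[of k] by (simp add: \<Phi>_def f_def)
  have gapI: "integrable M (\<lambda>x. gap (f k x) (f l x))" for k l
    unfolding gap_def
    by (intro Bochner_Integration.integrable_diff Bochner_Integration.integrable_add integrable_divide_zero norm1I fI integrable_scaleR_right)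
  have gap_le: "(\<integral>x. gap (f k x) (f l x) \<partial>M) \<le> (I l - I k) / 2 + 1 / Suc k" if "k \<le> l" for k l
  proof -
    have w2: "tail_weights k (max (n k) (n l)) (\<lambda>j. (c k j + c l j) / 2)"
      using w that by (intro tail_weights_midpoint) (auto intro: tail_weights_mono)
    then have "I k \<le> \<Phi> (\<lambda>j. (c k j + c l j) / 2) (max (n k) (n l))"
      unfolding I_def by (intro cInf_lower bdd) (auto simp: V_def)
    also have "\<dots> = (\<integral>x. norm1 ((f k x + f l x) /\<^sub>R 2) \<partial>M)"
      unfolding \<Phi>_def f_def midpoint_combination[OF w w] ..
    finally have 1: "I k \<le> (\<integral>x. norm1 ((f k x + f l x) /\<^sub>R 2) \<partial>M)" .
    have aux: "(a + b) / 2 - m \<le> (A + B) / 2 - i" if "i \<le> m" "a < A" "b < B" for a b A B m i :: real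
      using that by (simp add: field_simps)
    have "(\<integral>x. gap (f k x) (f l x) \<partial>M)
      = ((\<integral>x. norm1 (f k x) \<partial>M) + (\<integral>x. norm1 (f l x) \<partial>M)) / 2 - (\<integral>x. norm1 ((f k x + f l x) /\<^sub>R 2) \<partial>M)"
      unfolding gap_def
      by (subst Bochner_Integration.integral_diff)
        (auto intro!: Bochner_Integration.integrable_add integrable_divide_zero norm1I fI integrable_scaleR_right
          simp: Bochner_Integration.integral_add norm1I fI add_divide_distrib)
    also have "\<dots> \<le> ((I k + 1 / Suc k) + (I l + 1 / Suc l)) / 2 - I k"
      by (rule aux[OF 1 norm1_lt norm1_lt])
    also have "\<dots> \<le> ((I k + 1 / Suc k) + (I l + 1 / Suc k)) / 2 - I k"
      using that by (intro diff_right_mono divide_right_mono add_left_mono divide_left_mono) auto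
    also have "\<dots> = (I l - I k) / 2 + 1 / Suc k"
      by (simp add: add_divide_distrib diff_divide_distrib) (simp add: field_simps)
    finally show ?thesis .
  qed
  have Cauchy: "\<exists>N. \<forall>k\<ge>N. \<forall>l\<ge>N. (\<integral>x. norm (f k x - f l x) \<partial>M) < e" if "0 < e" for e
  proof -
    define \<mu> where "\<mu> = measure M (space M)"
    have "0 \<le> \<mu>" by (simp add: \<mu>_def)
    \<comment> \<open>Of the total \<open>e\<close>, one quarter goes to the constant term of the
      distance bound, one quarter is 4 times two excesses of \<open>e / 32\<close>, and one half is
      left for the gap.\<close>
    obtain K0 where K0: "\<And>j. (\<integral>x. ?exc K0 (F j) x \<partial>M) \<le> e / 32"
      using UI[of "e / 32"] \<open>0 < e\<close> by auto
    define K where "K = max 0 K0"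
    have exc_F: "(\<integral>x. ?exc K (F j) x \<partial>M) \<le> e / 32" for j
      by (rule order_trans[OF _ K0[of j]]) (intro integral_mono excI F, auto simp: K_def)
    have exc_f: "(\<integral>x. ?exc K (f k) x \<partial>M) \<le> e / 32" for k
    proof -
      have "(\<integral>x. ?exc K (f k) x \<partial>M) \<le> (\<integral>x. (\<Sum>j<n k. c k j * ?exc K (F j) x) \<partial>M)"
        unfolding f_def
        by (intro integral_mono excI combI Bochner_Integration.integrable_sum integrable_mult_right F
            excess_norm_combination[OF w])
      also have "\<dots> = (\<Sum>j<n k. c k j * (\<integral>x. ?exc K (F j) x \<partial>M))"
        by (subst Bochner_Integration.integral_sum) (auto intro!: integrable_mult_right excI F)
      also have "\<dots> \<le> e / 32" by (rule weighted_sum_le[OF w exc_F])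
      finally show ?thesis .
    qed
    have "0 < e / (4 * (\<mu> + 1))" using \<open>0 < e\<close> \<open>0 \<le> \<mu>\<close> by simp
    then obtain C where "0 \<le> C" and C: "\<And>u v :: 'a. norm (u - v) \<le> e / (4 * (\<mu> + 1)) + C * gap u v
        + 4 * (max 0 (norm u - K) + max 0 (norm v - K))"
      using gap_controls_distance[of "e / (4 * (\<mu> + 1))" K] by (auto simp: K_def)
    have bound: "(\<integral>x. norm (f k x - f l x) \<partial>M) \<le> e / 2 + C * ((I l - I k) / 2 + 1 / Suc k)" if "k \<le> l" for k l
    proof -
      have "(\<integral>x. norm (f k x - f l x) \<partial>M) \<le> (\<integral>x. e / (4 * (\<mu> + 1)) + C * gap (f k x) (f l x)
          + 4 * (?exc K (f k) x + ?exc K (f l) x) \<partial>M)"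
        by (intro integral_mono integrable_norm Bochner_Integration.integrable_diff Bochner_Integration.integrable_add
            integrable_const integrable_mult_right excI fI gapI C)
      also have "\<dots> = e / (4 * (\<mu> + 1)) * \<mu> + C * (\<integral>x. gap (f k x) (f l x) \<partial>M)
          + 4 * ((\<integral>x. ?exc K (f k) x \<partial>M) + (\<integral>x. ?exc K (f l) x \<partial>M))"
        by (simp add: Bochner_Integration.integral_add Bochner_Integration.integrable_add
            integrable_mult_right excI fI gapI \<mu>_def del: mult_eq_0_iff)
      also have "\<dots> \<le> e / 4 + C * ((I l - I k) / 2 + 1 / Suc k) + 4 * (e / 32 + e / 32)"
      proof (intro add_mono mult_left_mono gap_le exc_f \<open>0 \<le> C\<close> that)
        have "e * \<mu> \<le> e * (\<mu> + 1)" using \<open>0 < e\<close> by simp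
        then show "e / (4 * (\<mu> + 1)) * \<mu> \<le> e / 4" using \<open>0 \<le> \<mu>\<close> by (simp add: field_simps)
      qed simp
      finally show ?thesis by simp
    qed
    have "(\<lambda>k. C * ((L - I k) / 2 + 1 / Suc k)) \<longlonglongrightarrow> C * ((L - L) / 2 + 0)"
      by (intro tendsto_intros L LIMSEQ_Suc[OF lim_1_over_n]) simp
    then have "\<forall>\<^sub>F k in sequentially. C * ((L - I k) / 2 + 1 / Suc k) < e / 2"
      using \<open>0 < e\<close> by (intro order_tendstoD(2)) auto
    then obtain N where N: "\<And>k. k \<ge> N \<Longrightarrow> C * ((L - I k) / 2 + 1 / Suc k) < e / 2"
      by (auto simp: eventually_sequentially)
    have lt: "(\<integral>x. norm (f k x - f l x) \<partial>M) < e" if "N \<le> k" "k \<le> l" for k l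
    proof -
      have "I l \<le> L" using incseq_le[OF \<open>incseq I\<close> L] .
      then have "C * ((I l - I k) / 2 + 1 / Suc k) \<le> C * ((L - I k) / 2 + 1 / Suc k)"
        using \<open>0 \<le> C\<close> by (intro mult_left_mono) auto
      with bound[OF \<open>k \<le> l\<close>] N[OF \<open>N \<le> k\<close>] show ?thesis by linarith
    qed
    show ?thesis
    proof (intro exI[of _ N] allI impI)
      fix k l assume "N \<le> k" "N \<le> l"
      then show "(\<integral>x. norm (f k x - f l x) \<partial>M) < e"
        using lt[of k l] lt[of l k] by (cases "k \<le> l") (auto simp: norm_minus_commute)
    qed
  qed
  obtain r where r: "strict_mono r" "AE x in M. Cauchy (\<lambda>i. f (r i) x)"
    using cauchy_L1_AE_cauchy_subseq[of M f, OF fI Cauchy] by blast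
  define g where "g x = lim (\<lambda>i. f (r i) x)" for x
  have AE: "AE x in M. (\<lambda>i. f (r i) x) \<longlonglongrightarrow> g x"
    using r(2) by eventually_elim (simp add: g_def Cauchy_convergent convergent_LIMSEQ_iff[symmetric])
  have f_meas[measurable]: "f k \<in> borel_measurable M" for k using fI by auto
  have g_meas[measurable]: "g \<in> borel_measurable M"
    unfolding g_def by (rule borel_measurable_lim_metric) simp
  \<comment> \<open>Fatou's lemma turns the Cauchy estimate into one for the distance to the
    pointwise limit, before \<open>g\<close> is known to be integrable.\<close>
  have nn: "(\<integral>\<^sup>+x. norm (f (r i) x - g x) \<partial>M) \<le> ennreal e"
    if "0 < e" and N: "\<And>k l. N \<le> k \<Longrightarrow> N \<le> l \<Longrightarrow> (\<integral>x. norm (f k x - f l x) \<partial>M) < e" and "N \<le> i" for e N i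
  proof -
    have "(\<integral>\<^sup>+x. norm (f (r i) x - g x) \<partial>M) = (\<integral>\<^sup>+x. liminf (\<lambda>l. ennreal (norm (f (r i) x - f (r l) x))) \<partial>M)"
    proof (rule nn_integral_cong_AE)
      show "AE x in M. ennreal (norm (f (r i) x - g x)) = liminf (\<lambda>l. ennreal (norm (f (r i) x - f (r l) x)))"
        using AE
      proof eventually_elim
        case (elim x)
        then have "(\<lambda>l. ennreal (norm (f (r i) x - f (r l) x))) \<longlonglongrightarrow> ennreal (norm (f (r i) x - g x))"
          by (intro tendsto_ennrealI tendsto_intros)
        from lim_imp_Liminf[OF trivial_limit_sequentially this] show ?case by (rule sym)
      qed
    qed
    also have "\<dots> \<le> liminf (\<lambda>l. \<integral>\<^sup>+x. ennreal (norm (f (r i) x - f (r l) x)) \<partial>M)"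
      by (rule nn_integral_liminf) simp
    also have "\<dots> \<le> ennreal e"
    proof (rule Liminf_le)
      show "\<forall>\<^sub>F l in sequentially. (\<integral>\<^sup>+x. ennreal (norm (f (r i) x - f (r l) x)) \<partial>M) \<le> ennreal e"
        unfolding eventually_sequentially
      proof (intro exI[of _ N] allI impI)
        fix l assume "N \<le> l"
        then have "N \<le> r l" "N \<le> r i"
          using seq_suble[OF r(1)] \<open>N \<le> i\<close> by (meson order_trans)+
        then show "(\<integral>\<^sup>+x. ennreal (norm (f (r i) x - f (r l) x)) \<partial>M) \<le> ennreal e"
          using N[of "r i" "r l"] by (subst nn_integral_eq_integral) (auto intro!: ennreal_leI fI)
      qed
    qed simp
    finally show ?thesis .
  qed
  have gI: "integrable M g"
  proof -
    obtain N where "\<And>k l. N \<le> k \<Longrightarrow> N \<le> l \<Longrightarrow> (\<integral>x. norm (f k x - f l x) \<partial>M) < 1"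
      using Cauchy[of 1] by auto
    from le_less_trans[OF nn[OF zero_less_one this order_refl] ennreal_less_top]
    have "(\<integral>\<^sup>+x. norm (f (r N) x - g x) \<partial>M) < \<infinity>"
      by (simp only: infinity_ennreal_def)
    then have "integrable M (\<lambda>x. f (r N) x - g x)"
      by (intro integrableI_bounded) auto
    from Bochner_Integration.integrable_diff[OF fI[of "r N"] this] show ?thesis by simp
  qed
  have "(\<lambda>i. \<integral>x. norm (f (r i) x - g x) \<partial>M) \<longlonglongrightarrow> 0"
  proof (rule LIMSEQ_I)
    fix e :: real assume "0 < e"
    then obtain N where N: "\<And>k l. N \<le> k \<Longrightarrow> N \<le> l \<Longrightarrow> (\<integral>x. norm (f k x - f l x) \<partial>M) < e / 2"
      using Cauchy[of "e / 2"] by auto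
    show "\<exists>no. \<forall>n\<ge>no. norm ((\<integral>x. norm (f (r n) x - g x) \<partial>M) - 0) < e"
    proof (intro exI[of _ N] allI impI)
      fix i assume "N \<le> i"
      have "ennreal (\<integral>x. norm (f (r i) x - g x) \<partial>M) \<le> ennreal (e / 2)"
        using nn[OF _ N \<open>N \<le> i\<close>] \<open>0 < e\<close>
        by (subst nn_integral_eq_integral[symmetric]) (auto intro!: fI gI)
      then show "norm ((\<integral>x. norm (f (r i) x - g x) \<partial>M) - 0) < e"
        using \<open>0 < e\<close> by simp
    qed
  qed
  \<comment> \<open>Passing to a subsequence keeps the tail property because
    \<open>k \<le> r k\<close>.\<close>
  moreover have "tail_weights k (n (r k)) (c (r k))" for k
    using w seq_suble[OF r(1)] by (rule tail_weights_mono)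
  ultimately show thesis
    using that[of "\<lambda>k. n (r k)" "\<lambda>k. c (r k)" g] gI AE by (simp add: f_def)
qed

subsection \<open>Lagrangians and their relaxations\<close>

lemma superlinear_growth_bound:
  fixes \<Theta> :: "'a::real_normed_vector \<Rightarrow> real"
  assumes "\<And>u. 0 \<le> \<Theta> u" "filterlim (\<lambda>u. \<Theta> u / norm u) at_top at_infinity"
    and "\<And>x u. \<Theta> u \<le> L x u" "0 < \<eta>"
  shows "\<exists>K. \<forall>x u. norm u \<le> \<eta> * L x u + K"
proof -
  have "\<forall>\<^sub>F u in at_infinity. 1 / \<eta> \<le> \<Theta> u / norm u"
    using assms(2) by (simp add: filterlim_at_top)
  then obtain K where K: "\<And>u. K \<le> norm u \<Longrightarrow> 1 / \<eta> \<le> \<Theta> u / norm u"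
    by (auto simp: eventually_at_infinity)
  have "norm u \<le> \<eta> * L x u + \<bar>K\<bar>" for x u
  proof (cases "K \<le> norm u \<and> u \<noteq> 0")
    case True
    then have "norm u \<le> \<eta> * \<Theta> u" using K[of u] \<open>0 < \<eta>\<close> by (simp add: field_simps)
    also have "\<dots> \<le> \<eta> * L x u" using assms(3,4) by (intro mult_left_mono) auto
    finally show ?thesis by simp
  next
    case False
    have "0 \<le> \<eta> * L x u" using order_trans[OF assms(1,3)] \<open>0 < \<eta>\<close> by simp
    then show ?thesis using False by (cases "u = 0") auto
  qed
  then show ?thesis by blast
qed

section \<open>Semicontinuity and affine minorants\<close>

lemma lsc_on_sequentially:
  assumes "lsc_on S f" "x \<in> S" "\<And>k. X k \<in> S" "X \<longlonglongrightarrow> x" "c < f x"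
  shows "\<forall>\<^sub>F k in sequentially. c < f (X k)"
proof -
  have "\<forall>\<^sub>F y in at x within S. c < f y"
    using assms by (auto simp: lsc_on_def)
  then obtain U where "open U" "x \<in> U" and U: "\<And>y. y \<in> U \<Longrightarrow> y \<noteq> x \<Longrightarrow> y \<in> S \<Longrightarrow> c < f y"
    by (auto simp: eventually_at_topological)
  have "\<forall>\<^sub>F k in sequentially. X k \<in> U"
    using assms(4) \<open>open U\<close> \<open>x \<in> U\<close> by (simp add: tendsto_def)
  then show ?thesis
    by eventually_elim (use U assms in metis)
qed

text \<open>The point \<open>(u, c)\<close> is separated from the epigraph, which is closed since a
  finite convex function is continuous. The hyperplane is not vertical because
  \<open>(u, f u)\<close> lies in the epigraph straight above the point.\<close>

lemma convex_on_affine_minorant: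
  fixes f :: "'a::euclidean_space \<Rightarrow> real"
  assumes f: "convex_on UNIV f" and "c < f u"
  obtains a p where "\<And>w. a + p \<bullet> w \<le> f w" "c < a + p \<bullet> u"
proof -
  have cont: "continuous_on UNIV f" using f by (intro convex_on_continuous) auto
  have "epigraph UNIV f = {q. f (fst q) \<le> snd q}" by (auto simp: epigraph_def)
  moreover have "closed {q. f (fst q) \<le> snd q}"
  proof (rule closed_Collect_le)
    show "continuous_on UNIV (\<lambda>q :: 'a \<times> real. f (fst q))"
      by (rule continuous_on_compose2[OF cont continuous_on_fst[OF continuous_on_id]]) simp
  qed (intro continuous_on_snd continuous_on_id)
  ultimately have cl: "closed (epigraph UNIV f)" by simp
  have "convex (epigraph UNIV f)" using f by (rule convex_epigraphI)
  have "(u, c) \<notin> epigraph UNIV f" using \<open>c < f u\<close> by (simp add: epigraph_def)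
  obtain q b where qb: "q \<bullet> (u, c) < b" "\<And>z. z \<in> epigraph UNIV f \<Longrightarrow> b < q \<bullet> z"
    using separating_hyperplane_closed_point[OF \<open>convex (epigraph UNIV f)\<close> cl \<open>(u, c) \<notin> epigraph UNIV f\<close>] by blast
  obtain q1 \<beta> where q: "q = (q1, \<beta>)" by force
  have lt: "q1 \<bullet> u + \<beta> * c < b" using qb(1) by (simp add: q)
  have gt: "b < q1 \<bullet> w + \<beta> * r" if "f w \<le> r" for w r
    using qb(2)[of "(w, r)"] that by (simp add: q epigraph_def)
  have "\<beta> * c < \<beta> * f u" using lt gt[of u "f u"] by simp
  then have "0 < \<beta>" using \<open>c < f u\<close> by (simp add: mult_less_cancel_left)
  have eq: "b / \<beta> + - (q1 /\<^sub>R \<beta>) \<bullet> w = (b - q1 \<bullet> w) / \<beta>" for w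
    by (simp add: divide_inverse algebra_simps)
  show thesis
  proof (rule that[of "b / \<beta>" "- (q1 /\<^sub>R \<beta>)"])
    show "b / \<beta> + - (q1 /\<^sub>R \<beta>) \<bullet> w \<le> f w" for w
      unfolding eq pos_divide_le_eq[OF \<open>0 < \<beta>\<close>] using gt[of w "f w"] by (simp add: mult.commute)
    show "c < b / \<beta> + - (q1 /\<^sub>R \<beta>) \<bullet> u"
      unfolding eq pos_less_divide_eq[OF \<open>0 < \<beta>\<close>] using lt by (simp add: mult.commute)
  qed
qed

text \<open>The minorant is uniform over a whole ball of base points, so it survives a small
  displacement of the path.\<close>

definition affine_minorant :: "('a::euclidean_space \<Rightarrow> 'a \<Rightarrow> real) \<Rightarrow> real \<Rightarrow> 'a \<Rightarrow> real \<Rightarrow> 'a \<Rightarrow> bool" where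
  "affine_minorant L \<epsilon> x a p \<longleftrightarrow> (\<forall>\<xi>\<in>cball x \<epsilon>. \<forall>w. a + p \<bullet> w \<le> L \<xi> w)"

text \<open>A descent step from \<open>z\<close> bounds \<open>L z v\<close> only, and \<open>L\<close> may be larger at the other points of the
  segment; there the relaxation is still bounded by \<open>L z v\<close>. Being a supremum of affine functions of
  the velocity, it admits passage to the limit along trajectories.\<close>

definition relaxation :: "('a::euclidean_space \<Rightarrow> 'a \<Rightarrow> real) \<Rightarrow> real \<Rightarrow> 'a \<Rightarrow> 'a \<Rightarrow> real" where
  "relaxation L \<epsilon> x u = Sup {a + p \<bullet> u | a p. affine_minorant L \<epsilon> x a p}"

locale lagrangian =
  fixes L :: "'a::euclidean_space \<Rightarrow> 'a \<Rightarrow> real"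
  assumes nonneg: "0 \<le> L x u"
    and lsc: "lsc_on UNIV (\<lambda>(x, u). L x u)"
    and convex: "convex_on UNIV (L x)"
    and growth: "0 < \<eta> \<Longrightarrow> \<exists>K. \<forall>x u. norm u \<le> \<eta> * L x u + K"
begin

lemma growth_bound:
  assumes "0 < \<eta>"
  obtains K where "0 \<le> K" "\<And>x u. norm u \<le> \<eta> * L x u + K"
proof -
  obtain K where K: "\<And>x u. norm u \<le> \<eta> * L x u + K" using growth[OF assms] by blast
  show thesis
  proof (rule that[of "max 0 K"])
    show "norm u \<le> \<eta> * L x u + max 0 K" for x u using K[of u x] by linarith
  qed simp
qed

lemma relaxation_bdd: "0 \<le> \<epsilon> \<Longrightarrow> bdd_above {a + p \<bullet> u | a p. affine_minorant L \<epsilon> x a p}"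
  by (rule bdd_aboveI[of _ "L x u"]) (auto simp: affine_minorant_def)

lemma relaxation_ge:
  "0 \<le> \<epsilon> \<Longrightarrow> affine_minorant L \<epsilon> x a p \<Longrightarrow> a + p \<bullet> u \<le> relaxation L \<epsilon> x u"
  unfolding relaxation_def by (rule cSup_upper[OF _ relaxation_bdd]) auto

lemma affine_minorant_0: "affine_minorant L \<epsilon> x 0 0"
  by (simp add: affine_minorant_def nonneg)

lemma relaxation_nonneg: "0 \<le> \<epsilon> \<Longrightarrow> 0 \<le> relaxation L \<epsilon> x u"
  using relaxation_ge[OF _ affine_minorant_0[of \<epsilon> x], of u] by simp

lemma relaxation_le: "\<xi> \<in> cball x \<epsilon> \<Longrightarrow> relaxation L \<epsilon> x u \<le> L \<xi> u"
  unfolding relaxation_def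
  by (rule cSup_least) (use affine_minorant_0[of \<epsilon> x] in blast, auto simp: affine_minorant_def)

lemma less_relaxationE:
  assumes "0 \<le> \<epsilon>" "c < relaxation L \<epsilon> x u"
  obtains a p where "affine_minorant L \<epsilon> x a p" "c < a + p \<bullet> u"
proof -
  have "{a + p \<bullet> u | a p. affine_minorant L \<epsilon> x a p} \<noteq> {}" using affine_minorant_0 by blast
  from less_cSupD[OF this assms(2)[unfolded relaxation_def]] show thesis using that by blast
qed

text \<open>A convex function is the supremum of its affine minorants. Statements about relaxations
  therefore contain those about \<open>L\<close> as the case of radius 0.\<close>

lemma relaxation_0: "relaxation L 0 = L"
proof (intro ext antisym)
  fix x u
  show "relaxation L 0 x u \<le> L x u" by (rule relaxation_le) simp
  show "L x u \<le> relaxation L 0 x u"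
  proof (rule dense_le)
    fix c assume "c < L x u"
    then obtain a p where "\<And>w. a + p \<bullet> w \<le> L x w" "c < a + p \<bullet> u"
      using convex_on_affine_minorant[OF convex] by blast
    then show "c \<le> relaxation L 0 x u"
      using relaxation_ge[of 0 x a p u] by (simp add: affine_minorant_def)
  qed
qed

text \<open>For the fixed direction \<open>sgn u\<close>, the growth bound itself says that
  \<open>w \<mapsto> (sgn u \<bullet> w - K) / \<eta>\<close> is an affine minorant at every base
  point. Relaxations of all radii thus share the constants of \<open>L\<close>.\<close>

lemma relaxation_growth:
  assumes "0 \<le> \<epsilon>" "0 < \<eta>" and K: "\<And>x u. norm u \<le> \<eta> * L x u + K"
  shows "norm u \<le> \<eta> * relaxation L \<epsilon> x u + K"
proof -
  define p where "p = (sgn u) /\<^sub>R \<eta>"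
  have "affine_minorant L \<epsilon> x (- K / \<eta>) p"
    unfolding affine_minorant_def
  proof (intro ballI allI)
    fix \<xi> w
    have "sgn u \<bullet> w \<le> norm (sgn u) * norm w" by (rule norm_cauchy_schwarz)
    also have "\<dots> \<le> norm w" by (simp add: norm_sgn)
    also have "\<dots> \<le> \<eta> * L \<xi> w + K" by (rule K)
    finally show "- K / \<eta> + p \<bullet> w \<le> L \<xi> w"
      using \<open>0 < \<eta>\<close> by (simp add: p_def field_simps)
  qed
  from relaxation_ge[OF \<open>0 \<le> \<epsilon>\<close> this, of u] have "- K / \<eta> + p \<bullet> u \<le> relaxation L \<epsilon> x u" .
  moreover have "p \<bullet> u = norm u / \<eta>"
    by (cases "u = 0") (simp_all add: p_def sgn_div_norm dot_square_norm power2_eq_square divide_inverse)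
  ultimately show ?thesis using \<open>0 < \<eta>\<close> by (simp add: field_simps)
qed

text \<open>Otherwise the bound fails at base points approaching the ball, with velocities that stay
  bounded by growth; at an accumulation point of these pairs lower semicontinuity of
  \<open>L\<close> is contradicted. The loss \<open>\<eta>\<close> provides the strict
  inequality.\<close>

lemma affine_minorant_enlarge:
  assumes m: "affine_minorant L \<epsilon> x a p" and "0 < \<eta>" "0 \<le> \<epsilon>"
  obtains \<delta> where "0 < \<delta>" "affine_minorant L (\<epsilon> + \<delta>) x (a - \<eta>) p"
proof -
  have "\<exists>k. affine_minorant L (\<epsilon> + 1 / Suc k) x (a - \<eta>) p"
  proof (rule ccontr)
    assume "\<not> ?thesis"
    then have "\<exists>\<xi> w. \<xi> \<in> cball x (\<epsilon> + 1 / Suc k) \<and> L \<xi> w < a - \<eta> + p \<bullet> w" for k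
      by (force simp: affine_minorant_def not_le)
    then obtain \<xi> w where \<xi>: "\<And>k. \<xi> k \<in> cball x (\<epsilon> + 1 / Suc k)" and lt: "\<And>k. L (\<xi> k) (w k) < a - \<eta> + p \<bullet> w k"
      by metis
    \<comment> \<open>With this \<open>\<rho>\<close> the cost grows at least with slope
      \<open>norm p + 1\<close>, one more than the affine function, so a velocity that violates the
      bound is bounded.\<close>
    define \<rho> where "\<rho> = 1 / (norm p + 1)"
    have "0 < \<rho>" by (simp add: \<rho>_def add_nonneg_pos)
    then obtain K where "0 \<le> K" and K: "\<And>x u. norm u \<le> \<rho> * L x u + K" using growth_bound by blast
    have wb: "norm (w k) \<le> \<bar>a\<bar> + (norm p + 1) * K" for k
    proof -
      have "(norm p + 1) * norm (w k) \<le> (norm p + 1) * (\<rho> * L (\<xi> k) (w k) + K)"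
        by (intro mult_left_mono K) simp
      also have "\<dots> = L (\<xi> k) (w k) + (norm p + 1) * K"
        unfolding \<rho>_def by (simp add: distrib_left add_nonneg_eq_0_iff)
      also have "L (\<xi> k) (w k) \<le> \<bar>a\<bar> + norm p * norm (w k)"
        using lt[of k] norm_cauchy_schwarz[of p "w k"] \<open>0 < \<eta>\<close> by linarith
      finally show ?thesis by (simp add: algebra_simps)
    qed
    have \<xi>d: "dist x (\<xi> k) \<le> \<epsilon> + 1" for k
      using \<xi>[of k] by (rule order_trans[OF mem_cball[THEN iffD1]]) simp
    have "compact (cball x (\<epsilon> + 1) \<times> cball (0::'a) (\<bar>a\<bar> + (norm p + 1) * K))"
      by (intro compact_Times compact_cball)
    moreover have "(\<xi> k, w k) \<in> cball x (\<epsilon> + 1) \<times> cball 0 (\<bar>a\<bar> + (norm p + 1) * K)" for k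
      using \<xi>d wb by simp
    ultimately obtain l r where r: "strict_mono r" "((\<lambda>k. (\<xi> k, w k)) \<circ> r) \<longlonglongrightarrow> l"
      using seq_compactE[of _ "\<lambda>k. (\<xi> k, w k)"] by (metis (no_types, lifting) compact_imp_seq_compact)
    obtain \<xi>' w' where l: "l = (\<xi>', w')" by force
    have lim: "(\<lambda>k. (\<xi> (r k), w (r k))) \<longlonglongrightarrow> (\<xi>', w')" using r(2) by (simp add: l o_def)
    then have \<xi>': "(\<lambda>k. \<xi> (r k)) \<longlonglongrightarrow> \<xi>'" and w': "(\<lambda>k. w (r k)) \<longlonglongrightarrow> w'"
      using tendsto_fst tendsto_snd by fastforce+
    have "(\<lambda>k. \<epsilon> + 1 / Suc (r k)) \<longlonglongrightarrow> \<epsilon> + 0"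
      using LIMSEQ_subseq_LIMSEQ[OF LIMSEQ_Suc[OF lim_1_over_n] r(1)]
      by (intro tendsto_intros) (simp add: o_def)
    moreover have "(\<lambda>k. dist x (\<xi> (r k))) \<longlonglongrightarrow> dist x \<xi>'" by (intro tendsto_intros \<xi>')
    ultimately have "dist x \<xi>' \<le> \<epsilon> + 0"
      using \<xi> by (intro LIMSEQ_le[where X = "\<lambda>k. dist x (\<xi> (r k))"]) auto
    then have "a + p \<bullet> w' \<le> L \<xi>' w'" using m by (auto simp: affine_minorant_def)
    then have "a - \<eta> / 2 + p \<bullet> w' < L \<xi>' w'" using \<open>0 < \<eta>\<close> by simp
    then have "\<forall>\<^sub>F k in sequentially. a - \<eta> / 2 + p \<bullet> w' < L (\<xi> (r k)) (w (r k))"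
      using lsc_on_sequentially[OF lsc _ _ lim] by simp
    moreover have "(\<lambda>k. a - \<eta> + p \<bullet> w (r k)) \<longlonglongrightarrow> a - \<eta> + p \<bullet> w'" by (intro tendsto_intros w')
    then have "\<forall>\<^sub>F k in sequentially. a - \<eta> + p \<bullet> w (r k) < a - \<eta> / 2 + p \<bullet> w'"
      using \<open>0 < \<eta>\<close> by (intro order_tendstoD(2)) auto
    ultimately have "\<forall>\<^sub>F k in sequentially. False"
      by eventually_elim (use lt in \<open>smt (verit)\<close>)
    then show False by simp
  qed
  then show thesis using that by (metis of_nat_0_less_iff zero_less_Suc zero_less_divide_1_iff)
qed

text \<open>A minorant on the ball of radius \<open>\<epsilon> + \<delta>\<close> remains a minorant
  on every ball of radius \<open>\<epsilon>\<close> with centre moved by less than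
  \<open>\<delta>\<close>. Open superlevel sets also give measurability of the running cost.\<close>

lemma relaxation_lsc:
  assumes "0 \<le> \<epsilon>"
  shows "open {q. c < relaxation L \<epsilon> (fst q) (snd q)}"
proof (subst open_subopen, intro ballI)
  fix q assume "q \<in> {q. c < relaxation L \<epsilon> (fst q) (snd q)}"
  then obtain a p where m: "affine_minorant L \<epsilon> (fst q) a p" and gt: "c < a + p \<bullet> snd q"
    using less_relaxationE[OF assms] by blast
  define \<eta> where "\<eta> = (a + p \<bullet> snd q - c) / 2"
  have "0 < \<eta>" using gt by (simp add: \<eta>_def)
  obtain \<delta> where "0 < \<delta>" and \<delta>: "affine_minorant L (\<epsilon> + \<delta>) (fst q) (a - \<eta>) p"
    using affine_minorant_enlarge[OF m \<open>0 < \<eta>\<close> assms] .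
  let ?U = "ball (fst q) \<delta> \<times> {u. c < a - \<eta> + p \<bullet> u}"
  have "open ?U"
    by (intro open_Times open_ball open_Collect_less continuous_intros)
  moreover have "q \<in> ?U"
    using \<open>0 < \<delta>\<close> gt by (cases q) (simp add: \<eta>_def field_simps)
  moreover have "?U \<subseteq> {q. c < relaxation L \<epsilon> (fst q) (snd q)}"
  proof clarsimp
    fix x u assume x: "dist (fst q) x < \<delta>" and u: "c < a - \<eta> + p \<bullet> u"
    have "affine_minorant L \<epsilon> x (a - \<eta>) p"
      unfolding affine_minorant_def
    proof
      fix \<xi> assume "\<xi> \<in> cball x \<epsilon>"
      then have "\<xi> \<in> cball (fst q) (\<epsilon> + \<delta>)"
        using x dist_triangle[of "fst q" \<xi> x] by simp
      then show "\<forall>w. a - \<eta> + p \<bullet> w \<le> L \<xi> w" using \<delta> by (simp add: affine_minorant_def)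
    qed
    from relaxation_ge[OF assms this, of u] u show "c < relaxation L \<epsilon> x u" by simp
  qed
  ultimately show "\<exists>T. open T \<and> q \<in> T \<and> T \<subseteq> {q. c < relaxation L \<epsilon> (fst q) (snd q)}" by blast
qed

lemma relaxation_measurable:
  assumes "0 \<le> \<epsilon>" "y \<in> borel_measurable M" "g \<in> borel_measurable M"
  shows "(\<lambda>s. relaxation L \<epsilon> (y s) (g s)) \<in> borel_measurable M"
proof -
  have "(\<lambda>q. relaxation L \<epsilon> (fst q) (snd q)) \<in> borel_measurable borel"
    by (rule borel_measurableI_greater) (use relaxation_lsc[OF assms(1)] in simp)
  from measurable_compose[OF borel_measurable_Pair[OF assms(2,3)] this] show ?thesis by simp
qed

end

subsection \<open>Compactness of trajectories\<close>

text \<open>The action enters as a real number, so a path of infinite action is no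
  \<open>traj\<close>.\<close>

definition traj :: "('a::euclidean_space \<Rightarrow> 'a \<Rightarrow> real) \<Rightarrow> real \<Rightarrow> real \<Rightarrow> (real \<Rightarrow> 'a) \<Rightarrow> (real \<Rightarrow> 'a) \<Rightarrow> real \<Rightarrow> bool" where
  "traj \<Lambda> a b y g C \<longleftrightarrow> AC_on a b y g \<and> ((\<lambda>s. \<Lambda> (y s) (g s)) has_integral C) {a..b}"

lemma tail_weights_tendsto:
  fixes X :: "nat \<Rightarrow> 'a::real_normed_vector"
  assumes w: "\<And>k. tail_weights k (n k) (c k)" and X: "X \<longlonglongrightarrow> x"
  shows "(\<lambda>k. \<Sum>j<n k. c k j *\<^sub>R X j) \<longlonglongrightarrow> x"
proof (rule LIMSEQ_I)
  fix e :: real assume "0 < e"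
  then obtain N where N: "\<And>j. j \<ge> N \<Longrightarrow> norm (X j - x) < e / 2"
    using LIMSEQ_D[OF X, of "e / 2"] by auto
  show "\<exists>no. \<forall>k\<ge>no. norm ((\<Sum>j<n k. c k j *\<^sub>R X j) - x) < e"
  proof (intro exI[of _ N] allI impI)
    fix k assume "N \<le> k"
    have c: "0 \<le> c k j" "sum (c k) {..<n k} = 1" for j using w[of k] by (auto simp: tail_weights_def)
    have "(\<Sum>j<n k. c k j *\<^sub>R X j) - x = (\<Sum>j<n k. c k j *\<^sub>R (X j - x))"
      by (simp add: scaleR_diff_right sum_subtractf scaleR_sum_left[symmetric] c)
    also have "norm \<dots> \<le> (\<Sum>j<n k. c k j * norm (X j - x))"
      by (rule order_trans[OF norm_sum]) (simp add: c)
    also have "\<dots> \<le> e / 2"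
      by (rule weighted_sum_le[OF w[of k]]) (use N \<open>N \<le> k\<close> in \<open>auto intro: less_imp_le\<close>)
    finally show "norm ((\<Sum>j<n k. c k j *\<^sub>R X j) - x) < e" using \<open>0 < e\<close> by simp
  qed
qed

text \<open>Resting at the end point brings trajectories of different durations to a common
  interval.\<close>

lemma AC_on_extend_constant:
  assumes A: "AC_on 0 T y g" and "0 \<le> T" "T \<le> B"
  shows "AC_on 0 B (\<lambda>s. y (min s T)) (\<lambda>s. if s \<in> {0..T} then g s else 0)"
  unfolding AC_on_def
proof (intro conjI ballI)
  have "{0..T} \<subseteq> {0..B}" using \<open>T \<le> B\<close> by auto
  then have restrict: "(\<lambda>s. if s \<in> {0..T} then f s else 0) integrable_on {0..B}" if "f integrable_on {0..T}"
    for f :: "real \<Rightarrow> 'z::banach"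
    using that has_integral_restrict[of "{0..T}" "{0..B}" f] unfolding integrable_on_def by blast
  have "(\<lambda>s. norm (if s \<in> {0..T} then g s else 0)) = (\<lambda>s. if s \<in> {0..T} then norm (g s) else 0)"
    by auto
  then show "(\<lambda>s. if s \<in> {0..T} then g s else 0) absolutely_integrable_on {0..B}"
    using A restrict[of g] restrict[of "\<lambda>s. norm (g s)"] by (simp add: AC_on_def absolutely_integrable_on_def)
  fix s assume "s \<in> {0..B}"
  have "{0..T} \<inter> {0..s} = {0..min s T}" by auto
  moreover have "(g has_integral (y (min s T) - y 0)) {0..min s T}"
    using A \<open>s \<in> {0..B}\<close> \<open>0 \<le> T\<close> by (auto simp: AC_on_def)
  ultimately show "((\<lambda>s. if s \<in> {0..T} then g s else 0) has_integral y (min s T) - y (min 0 T)) {0..s}"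
    using \<open>0 \<le> T\<close> by (simp only: has_integral_restrict_Int min_absorb1)
qed

context lagrangian
begin

text \<open>One affine minorant at the limit point, lowered by \<open>\<eta>\<close>, serves for all
  late indices, as their balls lie in a slightly larger ball. Being affine, it commutes with convex
  combinations. Only indices from \<open>J0\<close> on matter, since the weights move into the
  tail.\<close>

lemma relaxation_liminf:
  assumes w: "\<And>k. tail_weights k (n k) (c k)"
    and \<xi>: "\<xi> \<longlonglongrightarrow> x" and \<epsilon>: "\<epsilon> \<longlonglongrightarrow> \<epsilon>0" "\<And>j. 0 \<le> \<epsilon> j" and F: "(\<lambda>k. \<Sum>j<n k. c k j *\<^sub>R F j) \<longlonglongrightarrow> u"
    and lt: "d < relaxation L \<epsilon>0 x u"
    and H: "\<And>j. j \<ge> J0 \<Longrightarrow> H j = relaxation L (\<epsilon> j) (\<xi> j) (F j)"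
  shows "\<forall>\<^sub>F k in sequentially. d < (\<Sum>j<n k. c k j * H j)"
proof -
  have "0 \<le> \<epsilon>0" using \<epsilon> by (intro LIMSEQ_le_const) auto
  obtain a p where m: "affine_minorant L \<epsilon>0 x a p" and ap: "d < a + p \<bullet> u"
    using less_relaxationE[OF \<open>0 \<le> \<epsilon>0\<close> lt] .
  define \<eta> where "\<eta> = (a + p \<bullet> u - d) / 2"
  have "0 < \<eta>" using ap by (simp add: \<eta>_def)
  obtain \<delta> where "0 < \<delta>" and \<delta>: "affine_minorant L (\<epsilon>0 + \<delta>) x (a - \<eta>) p"
    using affine_minorant_enlarge[OF m \<open>0 < \<eta>\<close> \<open>0 \<le> \<epsilon>0\<close>] .
  have "\<forall>\<^sub>F j in sequentially. dist (\<xi> j) x < \<delta> / 2" "\<forall>\<^sub>F j in sequentially. dist (\<epsilon> j) \<epsilon>0 < \<delta> / 2"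
    using tendstoD[OF \<xi>, of "\<delta> / 2"] tendstoD[OF \<epsilon>(1), of "\<delta> / 2"] \<open>0 < \<delta>\<close> by simp_all
  then have "\<forall>\<^sub>F j in sequentially. cball (\<xi> j) (\<epsilon> j) \<subseteq> cball x (\<epsilon>0 + \<delta>)"
  proof eventually_elim
    case (elim j)
    show ?case
    proof
      fix z assume "z \<in> cball (\<xi> j) (\<epsilon> j)"
      then show "z \<in> cball x (\<epsilon>0 + \<delta>)"
        using elim(1) elim(2)[unfolded dist_real_def abs_diff_less_iff] dist_triangle[of x z "\<xi> j"] dist_commute[of x "\<xi> j"]
        unfolding mem_cball by linarith
    qed
  qed
  then obtain J where J: "\<And>j. j \<ge> J \<Longrightarrow> cball (\<xi> j) (\<epsilon> j) \<subseteq> cball x (\<epsilon>0 + \<delta>)"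
    by (auto simp: eventually_sequentially)
  have ge: "a - \<eta> + p \<bullet> F j \<le> H j" if "j \<ge> max J J0" for j
  proof -
    have "affine_minorant L (\<epsilon> j) (\<xi> j) (a - \<eta>) p"
      using \<delta> J[of j] that by (auto simp: affine_minorant_def)
    from relaxation_ge[OF \<epsilon>(2) this] show ?thesis using H that by simp
  qed
  have "(\<lambda>k. a - \<eta> + p \<bullet> (\<Sum>j<n k. c k j *\<^sub>R F j)) \<longlonglongrightarrow> a - \<eta> + p \<bullet> u"
    by (intro tendsto_intros F)
  moreover have "d < a - \<eta> + p \<bullet> u" using ap by (simp add: \<eta>_def field_simps)
  ultimately have "\<forall>\<^sub>F k in sequentially. d < a - \<eta> + p \<bullet> (\<Sum>j<n k. c k j *\<^sub>R F j)"
    by (rule order_tendstoD(1))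
  moreover have "\<forall>\<^sub>F k in sequentially. k \<ge> max J J0" by (rule eventually_ge_at_top)
  ultimately show ?thesis
  proof eventually_elim
    case (elim k)
    have c: "sum (c k) {..<n k} = 1" using w[of k] by (simp add: tail_weights_def)
    have "0 \<le> (\<Sum>j<n k. c k j * (H j - (a - \<eta> + p \<bullet> F j)))"
      by (rule weighted_sum_ge[OF w[of k]]) (use ge elim(2) in auto)
    also have "\<dots> = (\<Sum>j<n k. c k j * H j) - (\<Sum>j<n k. c k j * (a - \<eta>) + c k j * (p \<bullet> F j))"
      by (simp add: sum_subtractf[symmetric] algebra_simps)
    also have "(\<Sum>j<n k. c k j * (a - \<eta>) + c k j * (p \<bullet> F j)) = a - \<eta> + p \<bullet> (\<Sum>j<n k. c k j *\<^sub>R F j)"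
      by (simp add: sum.distrib sum_distrib_right[symmetric] c inner_sum_right)
    finally show ?case using elim(1) by simp
  qed
qed

text \<open>Arzela-Ascoli gives uniform convergence of the paths, convex combinations give strong
  convergence of the velocities. Costs are averaged with the same weights, but each is evaluated
  along its own path, so convexity in the velocity alone suffices. Durations and radii may vary with
  \<open>k\<close>, as the applications require.\<close>

theorem traj_closure:
  fixes T C \<epsilon> :: "nat \<Rightarrow> real"
  assumes tr: "\<And>k. traj (relaxation L (\<epsilon> k)) 0 (T k) (y k) (g k) (C k)"
    and T: "\<And>k. 0 \<le> T k" "T \<longlonglongrightarrow> t" and \<epsilon>: "\<And>k. 0 \<le> \<epsilon> k" "\<epsilon> \<longlonglongrightarrow> \<epsilon>0"
    and start: "(\<lambda>k. y k 0) \<longlonglongrightarrow> x" and C: "C \<longlonglongrightarrow> C0"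
  obtains r y' g' C' where "strict_mono r" "traj (relaxation L \<epsilon>0) 0 t y' g' C'" "C' \<le> C0" "y' 0 = x"
    "(\<lambda>k. y (r k) (T (r k))) \<longlonglongrightarrow> y' t"
proof -
  obtain B where T_le: "\<And>k. T k \<le> B"
    using convergent_imp_bounded[OF T(2)] by (auto simp: bounded_iff) (meson abs_le_D1 order_trans)
  have "0 \<le> t" using T by (intro LIMSEQ_le_const) auto
  have "0 \<le> B" using T(1)[of 0] T_le[of 0] by simp
  have "t \<le> B" using T(2) T_le by (intro LIMSEQ_le_const2) auto
  obtain D where C_le: "\<And>k. C k \<le> D" and "0 \<le> D"
    using convergent_imp_bounded[OF C] by (auto simp: bounded_iff) (metis abs_ge_zero abs_le_D1 order_trans)
  obtain X where X: "\<And>k. norm (y k 0) \<le> X"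
    using convergent_imp_bounded[OF start] by (auto simp: bounded_iff)
  have \<epsilon>0: "0 \<le> \<epsilon>0" using \<epsilon> by (intro LIMSEQ_le_const) auto
  \<comment> \<open>Past \<open>T k\<close> both cost and velocity are set to 0, so the growth bound
    holds on all of \<open>{0..B}\<close>.\<close>
  define F where "F k s = (if s \<in> {0..T k} then relaxation L (\<epsilon> k) (y k s) (g k s) else 0)" for k s
  define G where "G k s = (if s \<in> {0..T k} then g k s else 0)" for k s
  define Y where "Y k s = y k (min s (T k))" for k s
  have F_nonneg: "0 \<le> F k s" for k s by (simp add: F_def relaxation_nonneg \<epsilon>)
  have F_int: "(F k has_integral C k) {0..B}" for k
    unfolding F_def using tr[of k] T_le[of k] by (subst has_integral_restrict) (auto simp: traj_def)
  have F_abs: "F k absolutely_integrable_on {0..B}" for k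
    using F_int F_nonneg by (intro nonnegative_absolutely_integrable_1) auto
  have Y_AC: "AC_on 0 B (Y k) (G k)" for k
    unfolding Y_def G_def using tr[of k] T(1) T_le by (intro AC_on_extend_constant) (auto simp: traj_def)
  have G_abs: "G k absolutely_integrable_on {0..B}" for k using Y_AC by (simp add: AC_on_def)
  have bound: "\<exists>K\<ge>0. \<forall>k s. norm (G k s) \<le> \<eta> * F k s + K" if "0 < \<eta>" for \<eta>
  proof -
    obtain K where "0 \<le> K" and K: "\<And>x u. norm u \<le> \<eta> * L x u + K" using growth_bound[OF \<open>0 < \<eta>\<close>] by blast
    have "norm (G k s) \<le> \<eta> * F k s + K" for k s
      using relaxation_growth[OF \<epsilon>(1) \<open>0 < \<eta>\<close> K] \<open>0 \<le> K\<close> by (simp add: G_def F_def)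
    with \<open>0 \<le> K\<close> show ?thesis by blast
  qed
  \<comment> \<open>A displacement is paid for partly by the cost, at the small rate
    \<open>\<eta>\<close>, and partly by elapsed time. The resulting modulus of continuity does not
    depend on \<open>k\<close>.\<close>
  have Y_incr: "\<exists>K\<ge>0. \<forall>k s s'. 0 \<le> s \<longrightarrow> s \<le> s' \<longrightarrow> s' \<le> B \<longrightarrow> norm (Y k s' - Y k s) \<le> \<eta> * D + K * (s' - s)"
    if "0 < \<eta>" for \<eta>
  proof -
    obtain K where "0 \<le> K" and K: "\<And>k s. norm (G k s) \<le> \<eta> * F k s + K" using bound[OF \<open>0 < \<eta>\<close>] by blast
    have "norm (Y k s' - Y k s) \<le> \<eta> * D + K * (s' - s)" if s: "0 \<le> s" "s \<le> s'" "s' \<le> B" for k s s'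
    proof -
      have Fi: "F k integrable_on {s..s'}"
        by (rule integrable_subinterval_real[OF has_integral_integrable[OF F_int]]) (use s in auto)
      have "norm (Y k s' - Y k s) \<le> integral {s..s'} (\<lambda>r. norm (G k r))"
        by (rule AC_on_increment_le[OF Y_AC s])
      also have "\<dots> \<le> integral {s..s'} (\<lambda>r. \<eta> * F k r + K)"
        by (intro integral_le AC_on_norm_integrable[OF Y_AC] Henstock_Kurzweil_Integration.integrable_add
            integrable_on_mult_right integrable_const_ivl Fi K s)
      also have "\<dots> = \<eta> * integral {s..s'} (F k) + K * (s' - s)"
        using s by (subst Henstock_Kurzweil_Integration.integral_add) (auto intro!: integrable_on_mult_right Fi)
      also have "integral {s..s'} (F k) \<le> integral {0..B} (F k)"
        using s F_nonneg has_integral_integrable[OF F_int] by (intro integral_subset_le Fi) auto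
      also have "\<dots> \<le> D" using C_le[of k] integral_unique[OF F_int[of k]] by simp
      finally show ?thesis using \<open>0 < \<eta>\<close> by (simp add: mult_left_mono)
    qed
    with \<open>0 \<le> K\<close> show ?thesis by blast
  qed
  obtain K1 where "0 \<le> K1" and K1: "\<And>k s s'. 0 \<le> s \<Longrightarrow> s \<le> s' \<Longrightarrow> s' \<le> B \<Longrightarrow> norm (Y k s' - Y k s) \<le> 1 * D + K1 * (s' - s)"
    using Y_incr[of 1] by auto
  obtain Yl r1 where Yl: "continuous_on {0..B} Yl" and r1: "strict_mono (r1 :: nat \<Rightarrow> nat)"
    and unif: "\<And>e. 0 < e \<Longrightarrow> \<exists>N. \<forall>n s. n \<ge> N \<and> s \<in> {0..B} \<longrightarrow> norm (Y (r1 n) s - Yl s) < e"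
  proof (rule Arzela_Ascoli[of "{0..B}" Y "X + D + K1 * B"])
    show "compact {0..B}" by simp
    show "norm (Y k s) \<le> X + D + K1 * B" if "s \<in> {0..B}" for k s
    proof -
      have "norm (Y k s) \<le> norm (Y k 0) + norm (Y k s - Y k 0)" by (rule norm_triangle_sub)
      moreover have "Y k 0 = y k 0" using T(1)[of k] by (simp add: Y_def)
      moreover have "K1 * s \<le> K1 * B" using that \<open>0 \<le> K1\<close> by (intro mult_left_mono) auto
      ultimately show ?thesis using K1[of 0 s k] X[of k] that by simp
    qed
    fix s e :: real assume s: "s \<in> {0..B}" and "0 < e"
    define \<eta> where "\<eta> = e / (2 * (D + 1))"
    have "0 < \<eta>" using \<open>0 < e\<close> \<open>0 \<le> D\<close> by (simp add: \<eta>_def)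
    have "\<eta> * D \<le> \<eta> * (D + 1)" using \<open>0 < \<eta>\<close> by simp
    also have "\<dots> = e / 2" using \<open>0 \<le> D\<close> by (simp add: \<eta>_def field_simps)
    finally have \<eta>D: "\<eta> * D \<le> e / 2" .
    obtain K where "0 \<le> K" and K: "\<And>k s s'. 0 \<le> s \<Longrightarrow> s \<le> s' \<Longrightarrow> s' \<le> B \<Longrightarrow> norm (Y k s' - Y k s) \<le> \<eta> * D + K * (s' - s)"
      using Y_incr[OF \<open>0 < \<eta>\<close>] by blast
    show "\<exists>d>0. \<forall>n s'. s' \<in> {0..B} \<and> norm (s - s') < d \<longrightarrow> norm (Y n s - Y n s') < e"
    proof (intro exI[of _ "e / (2 * (K + 1))"] conjI allI impI)
      show "0 < e / (2 * (K + 1))" using \<open>0 < e\<close> \<open>0 \<le> K\<close> by simp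
      fix n s' assume s': "s' \<in> {0..B} \<and> norm (s - s') < e / (2 * (K + 1))"
      have "norm (Y n s - Y n s') \<le> \<eta> * D + K * \<bar>s - s'\<bar>"
        using K[of s s' n] K[of s' s n] s s' by (cases "s \<le> s'") (auto simp: norm_minus_commute)
      also have "K * \<bar>s - s'\<bar> \<le> (K + 1) * \<bar>s - s'\<bar>" by (simp add: mult_right_mono)
      also have "\<dots> < e / 2"
        using s' \<open>0 \<le> K\<close> by (simp add: pos_less_divide_eq algebra_simps)
      finally show "norm (Y n s - Y n s') < e" using \<eta>D by simp
    qed
  qed blast
  define M where "M = lebesgue_on {0..B}"
  have fin: "finite_measure M" unfolding M_def by (rule finite_measure_lebesgue_on) simp
  have intM: "integrable M f" if "f absolutely_integrable_on {0..B}" for f :: "real \<Rightarrow> 'z::euclidean_space"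
    unfolding M_def using that by (rule absolutely_integrable_imp_integrable) simp
  have eqM: "(\<integral>x. f x \<partial>M) = integral {0..B} f" if "integrable M f" for f :: "real \<Rightarrow> 'z::euclidean_space"
    using that unfolding M_def by (rule lebesgue_integral_eq_integral) simp
  have absM: "f absolutely_integrable_on {0..B}" if "integrable M f" for f :: "real \<Rightarrow> 'z::euclidean_space"
    using that unfolding M_def by (simp add: integrable_restrict_space set_integrable_def)
  have UI: "\<exists>K. \<forall>j. (\<integral>s. max 0 (norm (G (r1 j) s) - K) \<partial>M) \<le> e" if "0 < e" for e
  proof -
    define \<eta> where "\<eta> = e / (D + 1)"
    have "0 < \<eta>" using \<open>0 < e\<close> \<open>0 \<le> D\<close> by (simp add: \<eta>_def)
    obtain K where "0 \<le> K" and K: "\<And>k s. norm (G k s) \<le> \<eta> * F k s + K" using bound[OF \<open>0 < \<eta>\<close>] by blast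
    have "(\<integral>s. max 0 (norm (G k s) - K) \<partial>M) \<le> e" for k
    proof -
      have [measurable]: "G k \<in> borel_measurable M" using intM[OF G_abs] by auto
      have "integrable M (\<lambda>s. max 0 (norm (G k s) - K))"
        by (rule Bochner_Integration.integrable_bound[OF integrable_norm[OF intM[OF G_abs[of k]]]]) (use \<open>0 \<le> K\<close> in auto)
      then have "(\<integral>s. max 0 (norm (G k s) - K) \<partial>M) \<le> (\<integral>s. \<eta> * F k s \<partial>M)"
      proof (rule integral_mono)
        show "integrable M (\<lambda>s. \<eta> * F k s)" by (intro integrable_mult_right intM F_abs)
        show "max 0 (norm (G k s) - K) \<le> \<eta> * F k s" for s
          using K[of k s] F_nonneg[of k s] \<open>0 < \<eta>\<close> by simp
      qed
      also have "\<dots> = \<eta> * C k" using eqM[OF intM[OF F_abs[of k]]] integral_unique[OF F_int[of k]] by simp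
      also have "\<dots> \<le> \<eta> * (D + 1)" using C_le[of k] \<open>0 < \<eta>\<close> by (intro mult_left_mono) auto
      also have "\<dots> = e" using \<open>0 \<le> D\<close> by (simp add: \<eta>_def)
      finally show ?thesis .
    qed
    then show ?thesis by blast
  qed
  obtain c n h where w: "\<And>k. tail_weights k (n k) (c k)" and hI: "integrable M h"
    and L1: "(\<lambda>k. \<integral>s. norm ((\<Sum>j<n k. c k j *\<^sub>R G (r1 j) s) - h s) \<partial>M) \<longlonglongrightarrow> 0"
    and AE: "AE s in M. (\<lambda>k. \<Sum>j<n k. c k j *\<^sub>R G (r1 j) s) \<longlonglongrightarrow> h s"
  proof (rule tail_combinations_L1_convergent[OF fin, where F = "\<lambda>j. G (r1 j)"])
    show "integrable M (G (r1 j))" for j by (rule intM[OF G_abs])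
  qed (use UI in auto)
  let ?comb = "\<lambda>k s. \<Sum>j<n k. c k j *\<^sub>R G (r1 j) s"
  define y' where "y' s = x + integral {0..s} h" for s
  have h_abs: "h absolutely_integrable_on {0..B}" by (rule absM[OF hI])
  have h_int: "h integrable_on {0..s}" if "s \<in> {0..B}" for s
    by (rule integrable_subinterval_real[of h 0 B]) (use h_abs that in \<open>auto simp: absolutely_integrable_on_def\<close>)
  have y'_AC: "AC_on 0 B y' h"
    unfolding AC_on_def using h_abs h_int by (auto simp: y'_def has_integral_iff)
  have Y_lim: "(\<lambda>j. Y (r1 j) s) \<longlonglongrightarrow> Yl s" if "s \<in> {0..B}" for s
    by (rule LIMSEQ_I) (use unif that in blast)
  \<comment> \<open>Both are limits of the same combinations of the paths: \<open>Yl\<close> because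
    tail averages of a convergent sequence converge, \<open>y'\<close> by integrating the combined
    velocities.\<close>
  have Yl_eq: "Yl s = y' s" if s: "s \<in> {0..B}" for s
  proof (rule LIMSEQ_unique)
    show "(\<lambda>k. \<Sum>j<n k. c k j *\<^sub>R Y (r1 j) s) \<longlonglongrightarrow> Yl s"
      by (rule tail_weights_tendsto[OF w Y_lim[OF s]])
    have G_int: "(G k has_integral (Y k s - y k 0)) {0..s}" for k
      using AC_on_increment[OF Y_AC, of 0 s k] s T(1)[of k] by (simp add: Y_def)
    have comb_int: "(?comb k has_integral (\<Sum>j<n k. c k j *\<^sub>R (Y (r1 j) s - y (r1 j) 0))) {0..s}" for k
      by (intro has_integral_sum has_integral_cmul G_int) simp
    have eq: "(\<Sum>j<n k. c k j *\<^sub>R Y (r1 j) s) = (\<Sum>j<n k. c k j *\<^sub>R y (r1 j) 0) + integral {0..s} (?comb k)" for k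
      using integral_unique[OF comb_int[of k]] by (simp add: scaleR_diff_right sum_subtractf)
    have "(\<lambda>k. integral {0..s} (?comb k) - integral {0..s} h) \<longlonglongrightarrow> 0"
    proof (rule Lim_null_comparison[OF _ L1], intro always_eventually allI)
      fix k
      have d: "integrable M (\<lambda>s. ?comb k s - h s)"
        by (intro Bochner_Integration.integrable_diff Bochner_Integration.integrable_sum integrable_scaleR_right
            intM G_abs hI)
      then have da: "(\<lambda>s. norm (?comb k s - h s)) integrable_on {0..B}"
        using absM by (auto simp: absolutely_integrable_on_def)
      have ds: "(\<lambda>s. norm (?comb k s - h s)) integrable_on {0..s}"
        by (rule integrable_subinterval_real[OF da]) (use s in auto)
      have dh: "(\<lambda>s. ?comb k s - h s) integrable_on {0..s}"
        using has_integral_integrable[OF comb_int] h_int[OF s] by (rule Henstock_Kurzweil_Integration.integrable_diff)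
      have "norm (integral {0..s} (?comb k) - integral {0..s} h) = norm (integral {0..s} (\<lambda>s. ?comb k s - h s))"
        using Henstock_Kurzweil_Integration.integral_diff[OF has_integral_integrable[OF comb_int] h_int[OF s]] by simp
      also have "\<dots> \<le> integral {0..s} (\<lambda>s. norm (?comb k s - h s))"
        by (intro integral_norm_bound_integral dh ds) simp
      also have "\<dots> \<le> integral {0..B} (\<lambda>s. norm (?comb k s - h s))"
        using s by (intro integral_subset_le ds da) auto
      also have "\<dots> = (\<integral>s. norm (?comb k s - h s) \<partial>M)"
        using eqM[OF integrable_norm[OF d]] by simp
      finally show "norm (integral {0..s} (?comb k) - integral {0..s} h) \<le> (\<integral>s. norm (?comb k s - h s) \<partial>M)" .
    qed
    then have "(\<lambda>k. integral {0..s} (?comb k)) \<longlonglongrightarrow> integral {0..s} h" by (simp add: LIM_zero_iff)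
    moreover have "(\<lambda>k. \<Sum>j<n k. c k j *\<^sub>R y (r1 j) 0) \<longlonglongrightarrow> x"
      using tail_weights_tendsto[OF w LIMSEQ_subseq_LIMSEQ[OF start r1]] by (simp add: o_def)
    ultimately show "(\<lambda>k. \<Sum>j<n k. c k j *\<^sub>R Y (r1 j) s) \<longlonglongrightarrow> y' s"
      unfolding eq y'_def by (intro tendsto_add)
  qed
  have y'_meas: "y' \<in> borel_measurable M"
    unfolding M_def by (rule continuous_imp_measurable_on_sets_lebesgue[OF AC_on_continuous[OF y'_AC]]) simp
  define R where "R s = relaxation L \<epsilon>0 (y' s) (h s)" for s
  have R_meas[measurable]: "R \<in> borel_measurable M"
    unfolding R_def using \<epsilon>0 y'_meas hI by (intro relaxation_measurable) auto
  have R_nonneg: "0 \<le> R s" for s by (simp add: R_def relaxation_nonneg \<epsilon>0)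
  \<comment> \<open>For \<open>s < t\<close> eventually \<open>s < T k\<close>, so the extension by
    rest is not felt; at \<open>s = t\<close> the trajectories may all have ended already. The end
    points do not affect the integral.\<close>
  define \<psi> where "\<psi> s = (if s \<in> {0<..<t} then R s else 0)" for s
  have [measurable]: "{0<..<t} \<in> sets M"
    unfolding M_def using \<open>t \<le> B\<close> by (simp add: sets_restrict_space_iff subset_iff)
  have \<psi>_meas[measurable]: "\<psi> \<in> borel_measurable M"
    unfolding \<psi>_def by measurable
  have \<psi>_nonneg: "0 \<le> \<psi> s" for s by (simp add: \<psi>_def R_nonneg)
  define H where "H k s = (\<Sum>j<n k. c k j * F (r1 j) s)" for k s
  have H_nonneg: "0 \<le> H k s" for k s
    unfolding H_def using w[of k] F_nonneg by (intro sum_nonneg mult_nonneg_nonneg) (auto simp: tail_weights_def)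
  have HI: "integrable M (H k)" for k
    unfolding H_def by (intro Bochner_Integration.integrable_sum integrable_mult_right intM F_abs)
  have H_int: "(\<integral>s. H k s \<partial>M) = (\<Sum>j<n k. c k j *\<^sub>R C (r1 j))" for k
    unfolding H_def using eqM[OF intM[OF F_abs]] integral_unique[OF F_int]
    by (subst Bochner_Integration.integral_sum) (auto intro!: integrable_mult_right intM F_abs)
  have "AE s in M. ennreal (\<psi> s) \<le> liminf (\<lambda>k. ennreal (H k s))"
    using AE AE_space
  proof eventually_elim
    case (elim s)
    show ?case
    proof (cases "s \<in> {0<..<t}")
      case False
      then show ?thesis by (simp only: \<psi>_def if_False) simp
    next
      case True
      then have sB: "s \<in> {0..B}" using elim(2) by (simp add: M_def)
      have "(\<lambda>j. T (r1 j)) \<longlonglongrightarrow> t" using LIMSEQ_subseq_LIMSEQ[OF T(2) r1] by (simp add: o_def)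
      then have "\<forall>\<^sub>F j in sequentially. s < T (r1 j)" using True by (intro order_tendstoD(1)) auto
      then obtain J0 where J0: "\<And>j. j \<ge> J0 \<Longrightarrow> s < T (r1 j)" by (auto simp: eventually_sequentially)
      show ?thesis unfolding le_Liminf_iff
      proof (intro allI impI)
        fix d assume d: "d < ennreal (\<psi> s)"
        then obtain d' where d': "d = ennreal d'" "0 \<le> d'"
          by (cases d) auto
        have "d' < R s" using d True \<psi>_nonneg[of s] by (simp add: d' ennreal_less_iff \<psi>_def)
        have "\<forall>\<^sub>F k in sequentially. d' < (\<Sum>j<n k. c k j * F (r1 j) s)"
        proof (rule relaxation_liminf[OF w])
          show "(\<lambda>j. Y (r1 j) s) \<longlonglongrightarrow> y' s" using Y_lim[OF sB] Yl_eq[OF sB] by simp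
          show "(\<lambda>j. \<epsilon> (r1 j)) \<longlonglongrightarrow> \<epsilon>0" using LIMSEQ_subseq_LIMSEQ[OF \<epsilon>(2) r1] by (simp add: o_def)
          show "d' < relaxation L \<epsilon>0 (y' s) (h s)" using \<open>d' < R s\<close> by (simp add: R_def)
          show "F (r1 j) s = relaxation L (\<epsilon> (r1 j)) (Y (r1 j) s) (G (r1 j) s)" if "j \<ge> J0" for j
            using J0[OF that] sB by (simp add: F_def Y_def G_def min_def)
        qed (use \<epsilon> elim(1) in auto)
        then show "\<forall>\<^sub>F k in sequentially. d < ennreal (H k s)"
          by eventually_elim (use d' in \<open>simp add: H_def ennreal_less_iff\<close>)
      qed
    qed
  qed
  then have "(\<integral>\<^sup>+s. ennreal (\<psi> s) \<partial>M) \<le> (\<integral>\<^sup>+s. liminf (\<lambda>k. ennreal (H k s)) \<partial>M)"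
    by (rule nn_integral_mono_AE)
  also have "\<dots> \<le> liminf (\<lambda>k. \<integral>\<^sup>+s. ennreal (H k s) \<partial>M)"
    using HI by (intro nn_integral_liminf) auto
  also have "\<dots> = liminf (\<lambda>k. ennreal (\<Sum>j<n k. c k j *\<^sub>R C (r1 j)))"
    using H_nonneg by (simp add: nn_integral_eq_integral[OF HI] H_int)
  also have "\<dots> = ennreal C0"
  proof -
    have "(\<lambda>k. \<Sum>j<n k. c k j *\<^sub>R C (r1 j)) \<longlonglongrightarrow> C0"
      using tail_weights_tendsto[OF w LIMSEQ_subseq_LIMSEQ[OF C r1]] by (simp add: o_def)
    then show ?thesis by (intro lim_imp_Liminf tendsto_ennrealI) auto
  qed
  finally have le: "(\<integral>\<^sup>+s. ennreal (\<psi> s) \<partial>M) \<le> ennreal C0" .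
  have \<psi>I: "integrable M \<psi>"
    by (rule integrableI_nonneg) (use le \<psi>_nonneg in \<open>auto intro: le_less_trans\<close>)
  have "0 \<le> C0"
    using C has_integral_nonneg[OF F_int] F_nonneg by (intro LIMSEQ_le_const) auto
  have "(\<integral>s. \<psi> s \<partial>M) \<le> C0"
    using le \<psi>_nonneg \<open>0 \<le> C0\<close> by (simp add: nn_integral_eq_integral[OF \<psi>I])
  then have "integral {0..B} \<psi> \<le> C0" using eqM[OF \<psi>I] by simp
  moreover have "(\<psi> has_integral integral {0..B} \<psi>) {0..B}"
    using absM[OF \<psi>I] by (auto simp: absolutely_integrable_on_def)
  then have "(R has_integral integral {0..B} \<psi>) {0<..<t}"
    unfolding \<psi>_def using \<open>t \<le> B\<close> by (subst (asm) has_integral_restrict) (auto simp: subset_iff)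
  then have "(R has_integral integral {0..B} \<psi>) {0..t}" by (simp add: has_integral_Icc_iff_Ioo)
  moreover have "AC_on 0 t y' h"
    using y'_AC \<open>t \<le> B\<close> unfolding AC_on_def by (auto intro: set_integrable_subset)
  ultimately have "traj (relaxation L \<epsilon>0) 0 t y' h (integral {0..B} \<psi>)" "integral {0..B} \<psi> \<le> C0"
    unfolding traj_def R_def[symmetric] by auto
  moreover have "y' 0 = x" by (simp add: y'_def)
  moreover have "(\<lambda>k. y (r1 k) (T (r1 k))) \<longlonglongrightarrow> y' t"
  proof -
    have tB: "t \<in> {0..B}" "T k \<in> {0..B}" for k using \<open>0 \<le> t\<close> \<open>t \<le> B\<close> T(1) T_le by auto
    have "(\<lambda>k. Yl (T (r1 k))) \<longlonglongrightarrow> Yl t"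
      by (rule continuous_on_tendsto_compose[OF Yl LIMSEQ_subseq_LIMSEQ[OF T(2) r1, unfolded o_def] tB(1)])
        (intro always_eventually allI tB(2))
    \<comment> \<open>The final times move with \<open>k\<close>, which is where convergence has to
      be uniform.\<close>
    moreover have "(\<lambda>k. Y (r1 k) (T (r1 k)) - Yl (T (r1 k))) \<longlonglongrightarrow> 0"
    proof (rule LIMSEQ_I)
      fix e :: real assume "0 < e"
      then obtain N where "\<And>n s. n \<ge> N \<Longrightarrow> s \<in> {0..B} \<Longrightarrow> norm (Y (r1 n) s - Yl s) < e" using unif by blast
      then show "\<exists>no. \<forall>n\<ge>no. norm (Y (r1 n) (T (r1 n)) - Yl (T (r1 n)) - 0) < e"
        using tB(2) unfolding diff_zero by blast
    qed
    ultimately have "(\<lambda>k. Y (r1 k) (T (r1 k))) \<longlonglongrightarrow> Yl t" by (rule Lim_transform)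
    then show ?thesis using Yl_eq[OF tB(1)] by (simp add: Y_def)
  qed
  ultimately show thesis using that r1 by blast
qed

end

subsection \<open>Steering\<close>

lemma traj_shift:
  assumes "traj \<Lambda> a b y g C"
  shows "traj \<Lambda> (a + d) (b + d) (\<lambda>s. y (s - d)) (\<lambda>s. g (s - d)) C"
proof -
  have shift: "((\<lambda>s. f (s - d)) has_integral I) {p + d..q + d} \<longleftrightarrow> (f has_integral I) {p..q}"
    for f :: "real \<Rightarrow> 'z::banach" and I p q
    using has_integral_shift_Icc_real[of "\<lambda>s. f (s - d)" d I p q] by (simp add: o_def)
  have int: "(\<lambda>s. f (s - d)) integrable_on {p + d..q + d} \<longleftrightarrow> f integrable_on {p..q}"
    for f :: "real \<Rightarrow> 'z::banach" and p q
    unfolding integrable_on_def shift[of f] ..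
  have g: "g absolutely_integrable_on {a..b}" "\<And>s. s \<in> {a..b} \<Longrightarrow> (g has_integral (y s - y a)) {a..s}"
    and L: "((\<lambda>s. \<Lambda> (y s) (g s)) has_integral C) {a..b}"
    using assms by (auto simp: traj_def AC_on_def)
  have "(\<lambda>s. g (s - d)) absolutely_integrable_on {a + d..b + d}"
    using g(1) int[of g a b] int[of "\<lambda>s. norm (g s)" a b] by (simp add: absolutely_integrable_on_def)
  moreover have "((\<lambda>s. g (s - d)) has_integral (y (s - d) - y (a + d - d))) {a + d..s}"
    if "s \<in> {a + d..b + d}" for s
    using shift[of g "y (s - d) - y a" a "s - d"] g(2)[of "s - d"] that by simp
  moreover have "((\<lambda>s. \<Lambda> (y (s - d)) (g (s - d))) has_integral C) {a + d..b + d}"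
    using shift[of "\<lambda>s. \<Lambda> (y s) (g s)"] L by simp
  ultimately show ?thesis by (simp add: traj_def AC_on_def)
qed

lemma AC_on_subinterval:
  assumes A: "AC_on a b y g" and "a \<le> a'" "b' \<le> b"
  shows "AC_on a' b' y g"
  unfolding AC_on_def
proof (intro conjI ballI)
  show "g absolutely_integrable_on {a'..b'}"
    using A assms(2,3) by (auto simp: AC_on_def intro: set_integrable_subset)
  fix s assume "s \<in> {a'..b'}"
  then show "(g has_integral y s - y a') {a'..s}"
    using assms by (intro AC_on_increment[OF A]) auto
qed

lemma traj_split:
  assumes "traj \<Lambda> a b y g C" "a \<le> m" "m \<le> b"
  obtains C1 C2 where "traj \<Lambda> a m y g C1" "traj \<Lambda> m b y g C2" "C = C1 + C2"
proof -
  have A: "AC_on a b y g" and L: "((\<lambda>s. \<Lambda> (y s) (g s)) has_integral C) {a..b}"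
    using assms by (auto simp: traj_def)
  have i: "(\<lambda>s. \<Lambda> (y s) (g s)) integrable_on {a..m}" "(\<lambda>s. \<Lambda> (y s) (g s)) integrable_on {m..b}"
    by (rule integrable_subinterval_real[OF has_integral_integrable[OF L]]; use assms in simp)+
  show thesis
  proof (rule that)
    show "traj \<Lambda> a m y g (integral {a..m} (\<lambda>s. \<Lambda> (y s) (g s)))"
      using AC_on_subinterval[OF A] i(1) assms by (simp add: traj_def integrable_integral)
    show "traj \<Lambda> m b y g (integral {m..b} (\<lambda>s. \<Lambda> (y s) (g s)))"
      using AC_on_subinterval[OF A] i(2) assms by (simp add: traj_def integrable_integral)
    show "C = integral {a..m} (\<lambda>s. \<Lambda> (y s) (g s)) + integral {m..b} (\<lambda>s. \<Lambda> (y s) (g s))"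
      using Henstock_Kurzweil_Integration.integral_combine[OF assms(2,3) has_integral_integrable[OF L]]
        integral_unique[OF L] by simp
  qed
qed

lemma has_integral_join:
  fixes f1 :: "real \<Rightarrow> 'z::banach"
  assumes "(f1 has_integral I1) {a..m}" "(f2 has_integral I2) {m..b}" "a \<le> m" "m \<le> b"
  shows "((\<lambda>s. if s \<le> m then f1 s else f2 s) has_integral (I1 + I2)) {a..b}"
proof (rule has_integral_combine[OF assms(3,4)])
  show "((\<lambda>s. if s \<le> m then f1 s else f2 s) has_integral I1) {a..m}"
    by (rule has_integral_eq[OF _ assms(1)]) auto
  show "((\<lambda>s. if s \<le> m then f1 s else f2 s) has_integral I2) {m..b}"
    by (rule has_integral_spike_finite[OF _ _ assms(2), of "{m}"]) auto
qed

lemma traj_join: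
  assumes "traj \<Lambda> a m y1 g1 C1" "traj \<Lambda> m b y2 g2 C2" "y1 m = y2 m" "a \<le> m" "m \<le> b"
  shows "traj \<Lambda> a b (\<lambda>s. if s \<le> m then y1 s else y2 s) (\<lambda>s. if s \<le> m then g1 s else g2 s) (C1 + C2)"
proof -
  let ?y = "\<lambda>s. if s \<le> m then y1 s else y2 s" and ?g = "\<lambda>s. if s \<le> m then g1 s else g2 s"
  have A1: "AC_on a m y1 g1" and A2: "AC_on m b y2 g2" using assms by (auto simp: traj_def)
  have "?g integrable_on {a..b}"
    using A1 A2 has_integral_join[of g1 _ a m g2 _ b] assms
    unfolding AC_on_def absolutely_integrable_on_def integrable_on_def by metis
  moreover have "(\<lambda>s. if s \<le> m then norm (g1 s) else norm (g2 s)) integrable_on {a..b}"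
    using A1 A2 has_integral_join[of "\<lambda>s. norm (g1 s)" _ a m "\<lambda>s. norm (g2 s)" _ b] assms
    unfolding AC_on_def absolutely_integrable_on_def integrable_on_def by metis
  moreover have "(\<lambda>s. norm (?g s)) = (\<lambda>s. if s \<le> m then norm (g1 s) else norm (g2 s))" by auto
  ultimately have "?g absolutely_integrable_on {a..b}" by (simp add: absolutely_integrable_on_def)
  moreover have "(?g has_integral (?y s - ?y a)) {a..s}" if s: "s \<in> {a..b}" for s
  proof (cases "s \<le> m")
    case True
    then have "(g1 has_integral (y1 s - y1 a)) {a..s}" using A1 s by (auto simp: AC_on_def)
    then have "(?g has_integral (y1 s - y1 a)) {a..s}"
      by (rule has_integral_eq[rotated]) (use True in auto)
    then show ?thesis using True \<open>a \<le> m\<close> by simp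
  next
    case False
    have "(g1 has_integral (y1 m - y1 a)) {a..m}" using A1 \<open>a \<le> m\<close> by (auto simp: AC_on_def)
    moreover have "(g2 has_integral (y2 s - y2 m)) {m..s}" using A2 s False by (auto simp: AC_on_def)
    ultimately have "(?g has_integral (y1 m - y1 a + (y2 s - y2 m))) {a..s}"
      using False \<open>a \<le> m\<close> by (intro has_integral_join) auto
    then show ?thesis using False \<open>a \<le> m\<close> assms(3) by simp
  qed
  moreover have "((\<lambda>s. \<Lambda> (?y s) (?g s)) has_integral (C1 + C2)) {a..b}"
  proof -
    have "(\<lambda>s. \<Lambda> (?y s) (?g s)) = (\<lambda>s. if s \<le> m then \<Lambda> (y1 s) (g1 s) else \<Lambda> (y2 s) (g2 s))" by auto
    moreover have "((\<lambda>s. if s \<le> m then \<Lambda> (y1 s) (g1 s) else \<Lambda> (y2 s) (g2 s)) has_integral (C1 + C2)) {a..b}"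
      using assms by (intro has_integral_join) (auto simp: traj_def)
    ultimately show ?thesis by simp
  qed
  ultimately show ?thesis by (simp add: traj_def AC_on_def)
qed

text \<open>The inequality \<open>C \<le> c\<close> lets costs be rounded up when pieces are
  concatenated, and hiding the path keeps the estimates free of reparametrisations.\<close>

definition steer :: "('a::euclidean_space \<Rightarrow> 'a \<Rightarrow> real) \<Rightarrow> real \<Rightarrow> 'a \<Rightarrow> 'a \<Rightarrow> real \<Rightarrow> bool" where
  "steer \<Lambda> \<tau> x x' c \<longleftrightarrow> 0 \<le> \<tau> \<and> (\<exists>y g C. traj \<Lambda> 0 \<tau> y g C \<and> y 0 = x \<and> y \<tau> = x' \<and> C \<le> c)"

lemma steerI:
  "0 \<le> \<tau> \<Longrightarrow> traj \<Lambda> 0 \<tau> y g C \<Longrightarrow> y 0 = x \<Longrightarrow> y \<tau> = x' \<Longrightarrow> C \<le> c \<Longrightarrow> steer \<Lambda> \<tau> x x' c"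
  unfolding steer_def by blast

lemma traj_imp_steer:
  assumes "traj \<Lambda> a b y g C" "a \<le> b" "C \<le> c"
  shows "steer \<Lambda> (b - a) (y a) (y b) c"
proof -
  have "traj \<Lambda> 0 (b - a) (\<lambda>s. y (s - - a)) (\<lambda>s. g (s - - a)) C"
    using traj_shift[OF assms(1), of "- a"] by simp
  then show ?thesis by (rule steerI[rotated]) (use assms in auto)
qed

lemma steer_mono:
  assumes "steer \<Lambda> \<tau> x x' c" "c \<le> c'" shows "steer \<Lambda> \<tau> x x' c'"
proof -
  obtain y g C where "traj \<Lambda> 0 \<tau> y g C" "y 0 = x" "y \<tau> = x'" "C \<le> c" "0 \<le> \<tau>"
    using assms(1) unfolding steer_def by blast
  then show ?thesis using assms(2) by (intro steerI[of \<tau> \<Lambda> y g C]) auto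
qed

lemma steer_trans:
  assumes "steer \<Lambda> \<tau>1 x y c1" "steer \<Lambda> \<tau>2 y z c2"
  shows "steer \<Lambda> (\<tau>1 + \<tau>2) x z (c1 + c2)"
proof -
  obtain y1 g1 C1 where 1: "traj \<Lambda> 0 \<tau>1 y1 g1 C1" "y1 0 = x" "y1 \<tau>1 = y" "C1 \<le> c1" and "0 \<le> \<tau>1"
    using assms(1) unfolding steer_def by blast
  obtain y2 g2 C2 where 2: "traj \<Lambda> 0 \<tau>2 y2 g2 C2" "y2 0 = y" "y2 \<tau>2 = z" "C2 \<le> c2" and "0 \<le> \<tau>2"
    using assms(2) unfolding steer_def by blast
  have "traj \<Lambda> \<tau>1 (\<tau>1 + \<tau>2) (\<lambda>s. y2 (s - \<tau>1)) (\<lambda>s. g2 (s - \<tau>1)) C2"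
    using traj_shift[OF 2(1), of \<tau>1] by (simp add: add.commute)
  from traj_join[OF 1(1) this] have j: "traj \<Lambda> 0 (\<tau>1 + \<tau>2) (\<lambda>s. if s \<le> \<tau>1 then y1 s else y2 (s - \<tau>1))
      (\<lambda>s. if s \<le> \<tau>1 then g1 s else g2 (s - \<tau>1)) (C1 + C2)"
    using 1 2 \<open>0 \<le> \<tau>1\<close> \<open>0 \<le> \<tau>2\<close> by simp
  show ?thesis
    by (rule steerI[OF _ j]) (use 1 2 \<open>0 \<le> \<tau>1\<close> \<open>0 \<le> \<tau>2\<close> in auto)
qed

lemma steer_refl: "steer \<Lambda> 0 x x 0"
proof -
  have "traj \<Lambda> 0 0 (\<lambda>_. x) (\<lambda>_. 0) 0"
    by (auto simp: traj_def AC_on_def has_integral_null)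
  then show ?thesis by (rule steerI[rotated]) auto
qed

context lagrangian
begin

text \<open>An upper bound along the segment is all that is required: measurability from
  semicontinuity, with boundedness, makes the running cost integrable.\<close>

lemma steer_segment:
  assumes "0 \<le> \<epsilon>" "0 \<le> \<tau>" "\<And>s. s \<in> {0..\<tau>} \<Longrightarrow> relaxation L \<epsilon> (x + s *\<^sub>R u) u \<le> M"
  shows "steer (relaxation L \<epsilon>) \<tau> x (x + \<tau> *\<^sub>R u) (M * \<tau>)"
proof -
  let ?f = "\<lambda>s. relaxation L \<epsilon> (x + s *\<^sub>R u) u"
  have "(\<lambda>s. x + s *\<^sub>R u) \<in> borel_measurable (lebesgue_on {0..\<tau>})"
    by (intro continuous_imp_measurable_on_sets_lebesgue continuous_intros) simp
  then have "?f \<in> borel_measurable (lebesgue_on {0..\<tau>})"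
    using \<open>0 \<le> \<epsilon>\<close> by (intro relaxation_measurable) auto
  moreover have "norm (?f s) \<le> M" if "s \<in> {0..\<tau>}" for s
    using assms(3)[OF that] relaxation_nonneg[OF \<open>0 \<le> \<epsilon>\<close>] by simp
  ultimately have "?f absolutely_integrable_on {0..\<tau>}"
    by (intro measurable_bounded_by_integrable_imp_absolutely_integrable[where g = "\<lambda>_. M"]) auto
  then have i: "?f integrable_on {0..\<tau>}" by (simp add: absolutely_integrable_on_def)
  have c: "((\<lambda>_. u) has_integral (s *\<^sub>R u)) {0..s}" if "0 \<le> s" for s
    using has_integral_const_real[of u 0 s] that by simp
  have "AC_on 0 \<tau> (\<lambda>s. x + s *\<^sub>R u) (\<lambda>_. u)"
    unfolding AC_on_def using c by (auto intro: absolutely_integrable_continuous_real)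
  then have "traj (relaxation L \<epsilon>) 0 \<tau> (\<lambda>s. x + s *\<^sub>R u) (\<lambda>_. u) (integral {0..\<tau>} ?f)"
    using i by (simp add: traj_def integrable_integral)
  moreover have "integral {0..\<tau>} ?f \<le> integral {0..\<tau>} (\<lambda>_. M)"
    using assms(3) by (intro integral_le i) auto
  ultimately show ?thesis
    using \<open>0 \<le> \<tau>\<close> by (intro steerI) (auto simp: mult.commute)
qed

section \<open>Actions with values in the extended reals and trajectories of finite cost\<close>

lemma traj_nonneg: "traj L a b y g C \<Longrightarrow> 0 \<le> C"
  unfolding traj_def using has_integral_nonneg nonneg by blast

lemma traj_action:
  assumes "traj L a b y g C"
  shows "action L a b y g = ereal C"
proof -
  have "((\<lambda>s. L (y s) (g s)) has_integral C) {a..b}" using assms by (simp add: traj_def)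
  then have "(\<integral>\<^sup>+s\<in>{a..b}. ennreal (L (y s) (g s)) \<partial>lebesgue) = ennreal C"
    unfolding nn_integral_completion by (intro nn_integral_has_integral_lebesgue' nonneg)
  then show ?thesis
    using traj_nonneg[OF assms] by (simp add: action_def enn2ereal_ennreal)
qed

text \<open>The running cost is measurable and nonnegative, so a finite nonnegative integral makes
  it integrable in the gauge sense as well.\<close>

lemma finite_action_imp_traj:
  assumes A: "AC_on a b y g" and fin: "action L a b y g < \<infinity>"
  obtains C where "traj L a b y g C" "action L a b y g = ereal C"
proof -
  define M where "M = lebesgue_on {a..b}"
  have y: "y \<in> borel_measurable M"
    unfolding M_def by (intro continuous_imp_measurable_on_sets_lebesgue AC_on_continuous[OF A]) simp
  have "g absolutely_integrable_on {a..b}" using A by (simp add: AC_on_def)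
  then have "integrable M g" unfolding M_def by (intro absolutely_integrable_imp_integrable) auto
  then have [measurable]: "(\<lambda>s. L (y s) (g s)) \<in> borel_measurable M"
    using relaxation_measurable[of 0 y M g] y by (simp add: relaxation_0)
  have "(\<integral>\<^sup>+s. ennreal (L (y s) (g s)) \<partial>M) = (\<integral>\<^sup>+s\<in>{a..b}. ennreal (L (y s) (g s)) \<partial>lebesgue)"
    unfolding M_def by (subst nn_integral_restrict_space) auto
  also have "\<dots> < \<infinity>"
    using fin unfolding action_def by (metis enn2ereal_top ennreal_less_zero_iff infinity_ennreal_def less_top linorder_not_less not_less_iff_gr_or_eq order_less_irrefl)
  finally have "integrable M (\<lambda>s. L (y s) (g s))"
    by (intro integrableI_nonneg) (auto simp: nonneg)
  then have "(\<lambda>s. L (y s) (g s)) integrable_on {a..b}"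
    unfolding M_def by (intro integrable_on_lebesgue_on) auto
  then have "traj L a b y g (integral {a..b} (\<lambda>s. L (y s) (g s)))"
    using A by (simp add: traj_def integrable_integral)
  then show thesis using that traj_action by blast
qed

end

subsection \<open>The value function\<close>

lemma ereal_quotient_less_iff:
  "0 < h \<Longrightarrow> (X - ereal w) / ereal h < ereal c \<longleftrightarrow> X < ereal (w + h * c)"
  by (cases X) (auto simp: field_simps)

lemma ereal_quotient_le_iff:
  "0 < h \<Longrightarrow> (X - ereal w) / ereal h \<le> ereal c \<longleftrightarrow> X \<le> ereal (w + h * c)"
  by (cases X) (auto simp: field_simps)

lemma ereal_dense_real: "(a::ereal) < b \<Longrightarrow> \<exists>c. a < ereal c \<and> ereal c < b"
  using ereal_dense2 by blast

lemma ereal_le_if_real_greater: "(\<And>c. b < ereal c \<Longrightarrow> a \<le> ereal c) \<Longrightarrow> (a::ereal) \<le> b"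
  by (rule dense_ge) (meson ereal_dense_real less_imp_le order_le_less_trans order_trans)

lemma at_right_directionI:
  assumes "\<forall>\<^sub>F h in at_right (0::real). A h" "\<forall>\<^sub>F d' in nhds d. B d'"
    "\<And>h d'. 0 < h \<Longrightarrow> A h \<Longrightarrow> B d' \<Longrightarrow> P h d'"
  shows "\<forall>\<^sub>F (h, d') in at_right 0 \<times>\<^sub>F nhds d. P h d'"
proof -
  have "\<forall>\<^sub>F h in at_right (0::real). 0 < h \<and> A h"
    using assms(1) eventually_at_right_less[of "0::real"] by eventually_elim simp
  from eventually_prodI[OF this assms(2)] show ?thesis
    by eventually_elim (use assms(3) in auto)
qed

lemma eventually_at_right_direction_pos:
  "\<forall>\<^sub>F (h, d') in at_right (0::real) \<times>\<^sub>F nhds d. 0 < h"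
  by (rule at_right_directionI[where A = "\<lambda>_. True" and B = "\<lambda>_. True"]) auto

lemma eventually_at_right_0_less: "0 < (c::real) \<Longrightarrow> \<forall>\<^sub>F h in at_right 0. h < c"
  unfolding eventually_at_right_field by (rule exI[of _ c]) auto

lemma at_right_scale:
  "0 < (c::real) \<Longrightarrow> filterlim (\<lambda>h. c * h) (at_right 0) (at_right 0)"
proof (rule tendsto_imp_filterlim_at_right)
  show "((\<lambda>h. c * h) \<longlongrightarrow> 0) (at_right 0)" by (auto intro!: tendsto_eq_intros)
  show "0 < c \<Longrightarrow> \<forall>\<^sub>F h in at_right 0. 0 < c * h"
    using eventually_at_right_less[of "0::real"] by eventually_elim simp
qed

lemma D_down_lessD:
  assumes "D_down W p d < ereal c" "W p = ereal w"
  shows "\<forall>\<^sub>F (h, d') in at_right 0 \<times>\<^sub>F nhds d. W (p + h *\<^sub>R d') < ereal (w + h * c)"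
  using Limsup_lessD[OF assms(1)[unfolded D_down_def]] eventually_at_right_direction_pos[of d]
  by eventually_elim (auto simp: assms(2) ereal_quotient_less_iff)

lemma D_down_along:
  assumes "D_down W p d < ereal c" "W p = ereal w" "(dd \<longlongrightarrow> d) (at_right 0)"
  shows "\<forall>\<^sub>F h in at_right 0. W (p + h *\<^sub>R dd h) < ereal (w + h * c)"
  using eventually_compose_filterlim[OF D_down_lessD[OF assms(1,2)] filterlim_Pair[OF filterlim_ident assms(3)]]
  by simp

lemma D_down_leI:
  assumes "W p = ereal w" "\<forall>\<^sub>F (h, d') in at_right 0 \<times>\<^sub>F nhds d. W (p + h *\<^sub>R d') \<le> ereal (w + h * c)"
  shows "D_down W p d \<le> ereal c"
  unfolding D_down_def
proof (rule Limsup_bounded)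
  show "\<forall>\<^sub>F q in at_right 0 \<times>\<^sub>F nhds d. (case q of (h, d') \<Rightarrow> (W (p + h *\<^sub>R d') - W p) / ereal h) \<le> ereal c"
    using assms(2) eventually_at_right_direction_pos[of d]
    by eventually_elim (auto simp: assms(1) ereal_quotient_le_iff)
qed

text \<open>A small lower limit only yields some step, but the step can be chosen to satisfy in
  addition any property \<open>P\<close> that holds eventually.\<close>

lemma D_up_lessD:
  assumes "D_up W p d < ereal c" "W p = ereal w"
    and "\<forall>\<^sub>F (h, d') in at_right 0 \<times>\<^sub>F nhds d. P h d'"
  obtains h d' where "0 < h" "P h d'" "W (p + h *\<^sub>R d') < ereal (w + h * c)"
proof (rule ccontr)
  assume "\<not> thesis"
  then have no: "0 < h \<Longrightarrow> P h d' \<Longrightarrow> \<not> W (p + h *\<^sub>R d') < ereal (w + h * c)" for h d'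
    using that by blast
  have "\<forall>\<^sub>F q in at_right 0 \<times>\<^sub>F nhds d. ereal c \<le> (case q of (h, d') \<Rightarrow> (W (p + h *\<^sub>R d') - W p) / ereal h)"
    using assms(3) eventually_at_right_direction_pos[of d]
  proof eventually_elim
    case (elim q)
    then show ?case
      using no[of "fst q" "snd q"] by (cases q) (auto simp: assms(2) ereal_quotient_less_iff[symmetric] not_less)
  qed
  then have "ereal c \<le> D_up W p d" unfolding D_up_def by (rule Liminf_bounded)
  with assms(1) show False by simp
qed

lemma D_up_leI:
  fixes d :: "'a::real_normed_vector"
  assumes "W p = ereal w" and h: "\<And>k. 0 < h k" "h \<longlonglongrightarrow> 0" and d: "d' \<longlonglongrightarrow> d"
    and le: "\<forall>\<^sub>F k in sequentially. W (p + h k *\<^sub>R d' k) \<le> ereal (w + h k * c)"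
  shows "D_up W p d \<le> ereal c"
proof (rule ccontr)
  assume "\<not> ?thesis"
  then have "ereal c < D_up W p d" by simp
  from less_LiminfD[OF this[unfolded D_up_def]]
  have ev: "\<forall>\<^sub>F q in at_right 0 \<times>\<^sub>F nhds d. ereal c < (case q of (h, d') \<Rightarrow> (W (p + h *\<^sub>R d') - W p) / ereal h)" .
  have "filterlim h (at_right 0) sequentially"
    using h by (intro tendsto_imp_filterlim_at_right) auto
  then have "filterlim (\<lambda>k. (h k, d' k)) (at_right 0 \<times>\<^sub>F nhds d) sequentially"
    using d by (rule filterlim_Pair)
  from eventually_compose_filterlim[OF ev this] le have "\<forall>\<^sub>F k in sequentially. False"
    by eventually_elim (use h(1) in \<open>auto simp: assms(1) not_le[symmetric] ereal_quotient_le_iff\<close>)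
  then show False by simp
qed

lemma lsc_on_limit_le:
  fixes f :: "'a::topological_space \<Rightarrow> ereal"
  assumes "lsc_on S f" "x \<in> S" "\<And>k. X k \<in> S" "X \<longlonglongrightarrow> x" "\<And>k. f (X k) \<le> ereal (c k)" "c \<longlonglongrightarrow> c0"
  shows "f x \<le> ereal c0"
proof (rule ccontr)
  assume "\<not> ?thesis"
  then obtain c' where c': "c0 < c'" "ereal c' < f x"
    using ereal_dense_real[of "ereal c0" "f x"] by (auto simp: not_le)
  have "\<forall>\<^sub>F k in sequentially. ereal c' < f (X k)"
    by (rule lsc_on_sequentially[OF assms(1-4) c'(2)])
  moreover have "\<forall>\<^sub>F k in sequentially. c k < c'"
    by (rule order_tendstoD(2)[OF assms(6) c'(1)])
  ultimately have "\<forall>\<^sub>F k in sequentially. False"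
  proof eventually_elim
    case (elim k)
    then have "ereal c' < ereal (c k)" using assms(5)[of k] by (rule_tac less_le_trans)
    with elim(2) show False by simp
  qed
  then show False by simp
qed

lemma locally_bounded_on_compact:
  fixes f :: "'a::metric_space \<Rightarrow> real"
  assumes "locally_bounded f" "compact K"
  obtains M where "0 \<le> M" "\<And>p. p \<in> K \<Longrightarrow> f p \<le> M"
proof -
  have "\<exists>M::nat. \<forall>p\<in>K. f p \<le> real M"
  proof (rule ccontr)
    assume "\<not> ?thesis"
    then have "\<forall>k::nat. \<exists>p. p \<in> K \<and> real k < f p" by (auto simp: not_le)
    then obtain p where p: "\<And>k. p k \<in> K" "\<And>k. real k < f (p k)" by metis
    obtain l r where r: "strict_mono r" "(p \<circ> r) \<longlonglongrightarrow> l"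
      using seq_compactE[OF compact_imp_seq_compact[OF assms(2)], of p] p(1) by blast
    obtain U where "open U" "l \<in> U" "bounded (f ` U)" using assms(1) by (auto simp: locally_bounded_def)
    then obtain b where b: "\<And>q. q \<in> U \<Longrightarrow> \<bar>f q\<bar> \<le> b" by (auto simp: bounded_iff)
    have "\<forall>\<^sub>F k in sequentially. (p \<circ> r) k \<in> U"
      using topological_tendstoD[OF r(2) \<open>open U\<close> \<open>l \<in> U\<close>] .
    moreover have "\<forall>\<^sub>F k in sequentially. b \<le> real k"
      using filterlim_real_sequentially by (auto simp: filterlim_at_top)
    ultimately have "\<forall>\<^sub>F k in sequentially. False"
    proof eventually_elim
      case (elim k)
      have "real k \<le> real (r k)" using seq_suble[OF r(1)] by simp
      with elim b[of "p (r k)"] p(2)[of "r k"] show False by simp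
    qed
    then show False by simp
  qed
  then show thesis using that of_nat_0_le_iff by blast
qed

locale bolza = lagrangian L for L :: "real ^ 'n \<Rightarrow> real ^ 'n \<Rightarrow> real" +
  fixes \<phi> :: "real ^ 'n \<Rightarrow> ereal"
  assumes L_bounded: "locally_bounded (\<lambda>(x, u). L x u)"
    and phi_nonneg: "0 \<le> \<phi> x"
    and phi_lsc: "lsc_on UNIV \<phi>"
begin

lemma L_bound:
  obtains M where "0 \<le> M" "\<And>x u. norm x \<le> R \<Longrightarrow> norm u \<le> R \<Longrightarrow> L x u \<le> M"
proof -
  have "compact (cball (0 :: real ^ 'n) R \<times> cball (0 :: real ^ 'n) R)"
    by (intro compact_Times compact_cball)
  from locally_bounded_on_compact[OF L_bounded this] obtain M where "0 \<le> M"
    "\<And>p. p \<in> cball 0 R \<times> cball 0 R \<Longrightarrow> (case p of (x, u) \<Rightarrow> L x u) \<le> M" by blast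
  then show thesis using that[of M] by force
qed

text \<open>The straight segment stays in the ball by convexity; \<open>R\<close> bounds positions
  and speed at once, so a single \<open>M\<close> serves for the whole segment.\<close>

lemma steer_between:
  assumes M: "\<And>x u. norm x \<le> R \<Longrightarrow> norm u \<le> R \<Longrightarrow> L x u \<le> M"
    and "0 < \<tau>" "norm x \<le> R" "norm x' \<le> R" "norm (x' - x) \<le> R * \<tau>"
  shows "steer L \<tau> x x' (M * \<tau>)"
proof -
  define u where "u = (x' - x) /\<^sub>R \<tau>"
  have x': "x' = x + \<tau> *\<^sub>R u" using \<open>0 < \<tau>\<close> by (simp add: u_def)
  have "norm u = norm (x' - x) / \<tau>" using \<open>0 < \<tau>\<close> by (simp add: u_def divide_inverse mult.commute)
  then have u: "norm u \<le> R" using assms(2,5) by (simp add: pos_divide_le_eq)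
  have "L (x + s *\<^sub>R u) u \<le> M" if s: "s \<in> {0..\<tau>}" for s
  proof (rule M[OF _ u])
    have eq: "x + s *\<^sub>R u = (1 - s / \<tau>) *\<^sub>R x + (s / \<tau>) *\<^sub>R x'"
      using \<open>0 < \<tau>\<close> by (simp add: x' algebra_simps)
    have "x + s *\<^sub>R u \<in> cball 0 R"
      unfolding eq using assms s by (intro convexD_alt[OF convex_cball]) (auto simp: field_simps)
    then show "norm (x + s *\<^sub>R u) \<le> R" by simp
  qed
  then show ?thesis
    using steer_segment[of 0 \<tau> x u M] \<open>0 < \<tau>\<close> by (simp add: relaxation_0 x')
qed

lemma value_le:
  assumes "steer L t x x' c"
  shows "value_fun L \<phi> (t, x) \<le> ereal c + \<phi> x'"
proof -
  obtain y g C where tr: "traj L 0 t y g C" "y 0 = x" "y t = x'" "C \<le> c" and "0 \<le> t"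
    using assms unfolding steer_def by blast
  then have "W11 0 t y g" by (simp add: W11_iff_AC_on traj_def)
  then have "value_fun L \<phi> (t, x) \<le> action L 0 t y g + \<phi> (y t)"
    unfolding value_fun_def using tr by (auto intro!: Inf_lower)
  also have "\<dots> = ereal C + \<phi> x'" using traj_action[OF tr(1)] tr by simp
  also have "\<dots> \<le> ereal c + \<phi> x'" using tr by (intro add_right_mono) simp
  finally show ?thesis .
qed

lemma value_lessE:
  assumes "value_fun L \<phi> (t, x) < c" "0 \<le> t"
  obtains y g C where "traj L 0 t y g C" "y 0 = x" "ereal C + \<phi> (y t) < c"
proof -
  obtain y g where W: "W11 0 t y g" "y 0 = x" and lt: "action L 0 t y g + \<phi> (y t) < c"
    using assms(1) unfolding value_fun_def by (auto simp: Inf_less_iff)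
  have "action L 0 t y g < \<infinity>"
    using lt phi_nonneg[of "y t"] by (cases "action L 0 t y g"; cases "\<phi> (y t)") auto
  then obtain C where "traj L 0 t y g C" "action L 0 t y g = ereal C"
    using finite_action_imp_traj W \<open>0 \<le> t\<close> W11_iff_AC_on by blast
  then show thesis using that[of y g C] W lt by simp
qed

lemma value_nonneg: "0 \<le> value_fun L \<phi> (t, x)"
  unfolding value_fun_def
  by (auto intro!: Inf_greatest add_nonneg_nonneg phi_nonneg simp: action_def)

lemma value_0: "value_fun L \<phi> (0, x) = \<phi> x"
proof (rule antisym)
  show "value_fun L \<phi> (0, x) \<le> \<phi> x" using value_le[OF steer_refl, of x] by simp
  show "\<phi> x \<le> value_fun L \<phi> (0, x)"
  proof (rule dense_ge)
    fix c assume "value_fun L \<phi> (0, x) < c"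
    then obtain y g C where "traj L 0 0 y g C" "y 0 = x" "ereal C + \<phi> (y 0) < c"
      by (rule value_lessE) auto
    moreover from this have "0 \<le> C" by (rule_tac traj_nonneg)
    then have "0 + \<phi> x \<le> ereal C + \<phi> x" by (intro add_right_mono) simp
    ultimately show "\<phi> x \<le> c" by auto
  qed
qed

text \<open>The easy half of dynamic programming: a path into \<open>x\<close> is prolonged by a
  near-minimiser from there.\<close>

lemma value_steer_le:
  assumes "steer L \<tau> z x c" "0 \<le> t"
  shows "value_fun L \<phi> (\<tau> + t, z) \<le> ereal c + value_fun L \<phi> (t, x)"
proof (rule ereal_le_if_real_greater)
  fix d assume "ereal c + value_fun L \<phi> (t, x) < ereal d"
  then have "value_fun L \<phi> (t, x) < ereal (d - c)"
    by (cases "value_fun L \<phi> (t, x)") auto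
  then obtain y g C where tr: "traj L 0 t y g C" "y 0 = x" and lt: "ereal C + \<phi> (y t) < ereal (d - c)"
    using value_lessE \<open>0 \<le> t\<close> by blast
  have "steer L t x (y t) C" using traj_imp_steer[OF tr(1) \<open>0 \<le> t\<close> order_refl] tr(2) by simp
  from value_le[OF steer_trans[OF assms(1) this]]
  have "value_fun L \<phi> (\<tau> + t, z) \<le> ereal (c + C) + \<phi> (y t)" .
  also have "\<dots> \<le> ereal d" using lt by (cases "\<phi> (y t)") auto
  finally show "value_fun L \<phi> (\<tau> + t, z) \<le> ereal d" .
qed

section \<open>The function \<open>Lplus\<close> in terms of steering into a point\<close>

lemma Lplus_lessD:
  assumes "Lplus L x u < ereal c"
  shows "\<forall>\<^sub>F h in at_right 0. steer L h (x - h *\<^sub>R u) x (h * c)"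
  using Limsup_lessD[OF assms[unfolded Lplus_def]] eventually_at_right_less[of "0::real"]
proof eventually_elim
  case (elim h)
  let ?I = "Inf {action L (- h) 0 y g |y g. W11 (- h) 0 y g \<and> y (- h) = x - h *\<^sub>R u \<and> y 0 = x}"
  have "?I < ereal (h * c)"
  proof (rule ccontr)
    assume "\<not> ?thesis"
    then have "ereal (1 / h) * ereal (h * c) \<le> ereal (1 / h) * ?I"
      using elim by (intro ereal_mult_left_mono) auto
    then show False using elim by simp
  qed
  then obtain y g where W: "W11 (- h) 0 y g" "y (- h) = x - h *\<^sub>R u" "y 0 = x" and lt: "action L (- h) 0 y g < ereal (h * c)"
    by (auto simp: Inf_less_iff)
  obtain C where tr: "traj L (- h) 0 y g C" and C: "action L (- h) 0 y g = ereal C"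
  proof (rule finite_action_imp_traj)
    show "AC_on (- h) 0 y g" using W(1) elim(2) W11_iff_AC_on[of "- h" 0 y g] by simp
    show "action L (- h) 0 y g < \<infinity>" by (rule less_trans[OF lt]) simp
  qed
  show ?case using traj_imp_steer[OF tr, of "h * c"] W lt C elim(2) by simp
qed

lemma Lplus_leI:
  assumes "\<forall>\<^sub>F h in at_right 0. steer L h (x - h *\<^sub>R u) x (h * c)"
  shows "Lplus L x u \<le> ereal c"
  unfolding Lplus_def
proof (rule Limsup_bounded)
  show "\<forall>\<^sub>F h in at_right 0. ereal (1 / h) * Inf {action L (- h) 0 y g |y g.
      W11 (- h) 0 y g \<and> y (- h) = x - h *\<^sub>R u \<and> y 0 = x} \<le> ereal c"
    using assms eventually_at_right_less[of "0::real"]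
  proof eventually_elim
    case (elim h)
    let ?I = "Inf {action L (- h) 0 y g |y g. W11 (- h) 0 y g \<and> y (- h) = x - h *\<^sub>R u \<and> y 0 = x}"
    obtain y g C where tr: "traj L 0 h y g C" "y 0 = x - h *\<^sub>R u" "y h = x" "C \<le> h * c"
      using elim(1) unfolding steer_def by blast
    have tr': "traj L (- h) 0 (\<lambda>s. y (s - - h)) (\<lambda>s. g (s - - h)) C"
      using traj_shift[OF tr(1), of "- h"] by simp
    then have W: "W11 (- h) 0 (\<lambda>s. y (s - - h)) (\<lambda>s. g (s - - h))"
      using elim(2) by (simp add: W11_iff_AC_on traj_def)
    have "?I \<le> action L (- h) 0 (\<lambda>s. y (s - - h)) (\<lambda>s. g (s - - h))"
      by (rule Inf_lower, rule CollectI, intro exI[of _ "\<lambda>s. y (s - - h)"] exI[of _ "\<lambda>s. g (s - - h)"])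
        (use W tr in simp)
    also have "\<dots> = ereal C" by (rule traj_action[OF tr'])
    also have "\<dots> \<le> ereal (h * c)" using tr by simp
    finally have "ereal (1 / h) * ?I \<le> ereal (1 / h) * ereal (h * c)"
      using elim(2) by (intro ereal_mult_left_mono) auto
    then show ?case using elim(2) by simp
  qed
qed

text \<open>A path that ends at \<open>x\<close> with velocity \<open>u\<close> may start at any nearby point and take a slightly
  different time: a fraction \<open>\<delta>\<close> of the time is spent on joining the path at moderate speed.\<close>

lemma steer_perturbed_start:
  assumes q: "((\<lambda>h. (x - q h) /\<^sub>R h) \<longlongrightarrow> u) (at_right 0)"
    and st: "\<forall>\<^sub>F h in at_right 0. steer L h (q h) x (h * c)" and "c < c'"
  shows "\<forall>\<^sub>F (h, d) in at_right 0 \<times>\<^sub>F nhds (1, - u). steer L (h * fst d) (x + h *\<^sub>R snd d) x (h * c')"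
proof -
  define R where "R = norm x + norm u + 1"
  obtain M where "0 \<le> M" and M: "\<And>x u. norm x \<le> R \<Longrightarrow> norm u \<le> R \<Longrightarrow> L x u \<le> M" using L_bound[of R] by blast
  \<comment> \<open>Joining for a fraction \<open>\<delta>\<close> of the time costs at most
    \<open>M\<close> per unit of time, the given path costs \<open>c\<close>. For small
    \<open>\<delta>\<close> the average stays below \<open>c'\<close>.\<close>
  have "((\<lambda>\<delta>. M * \<delta> + (1 - \<delta>) * c) \<longlongrightarrow> M * 0 + (1 - 0) * c) (at_right (0::real))"
    by (intro tendsto_intros tendsto_ident_at)
  then have "\<forall>\<^sub>F \<delta> in at_right 0. M * \<delta> + (1 - \<delta>) * c < c'"
    using \<open>c < c'\<close> by (intro order_tendstoD(2)) auto
  moreover have "\<forall>\<^sub>F \<delta> in at_right (0::real). \<delta> < 1" by (rule eventually_at_right_0_less) simp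
  ultimately have "\<forall>\<^sub>F \<delta> in at_right 0. M * \<delta> + (1 - \<delta>) * c < c' \<and> \<delta> < 1 \<and> 0 < \<delta>"
    using eventually_at_right_less[of "0::real"] by eventually_elim auto
  then obtain \<delta> where budget: "M * \<delta> + (1 - \<delta>) * c < c'" and \<delta>: "\<delta> < 1" "0 < \<delta>"
    using eventually_happens trivial_limit_at_right_real by (metis (no_types, lifting))
  let ?P = "at_right (0::real) \<times>\<^sub>F nhds (1::real, - u)"
  define k where "k p = (1 - \<delta>) * fst p" for p :: "real \<times> real \<times> (real ^ 'n)"
  define v where "v p = (x - q (k p)) /\<^sub>R k p" for p
  \<comment> \<open>The total duration is \<open>h * fst d\<close>, of which the given path takes
    \<open>(1 - \<delta>) * h\<close>; the time \<open>h * \<beta>\<close> is left for joining. As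
    \<open>fst d\<close> tends to 1, \<open>\<beta>\<close> tends to \<open>\<delta>\<close> and is
    eventually positive.\<close>
  define \<beta> where "\<beta> p = fst (snd p) - (1 - \<delta>)" for p :: "real \<times> real \<times> (real ^ 'n)"
  define vel where "vel p = (- ((1 - \<delta>) *\<^sub>R v p) - snd (snd p)) /\<^sub>R \<beta> p" for p
  have h: "filterlim fst (at_right 0) ?P" by (rule filterlim_fst)
  have h0: "(fst \<longlongrightarrow> 0) ?P" by (rule filterlim_compose[OF tendsto_ident_at h])
  have d: "((\<lambda>p. snd p) \<longlongrightarrow> (1, - u)) ?P" by (rule filterlim_snd)
  have \<alpha>: "((\<lambda>p. fst (snd p)) \<longlongrightarrow> 1) ?P" and w: "((\<lambda>p. snd (snd p)) \<longlongrightarrow> - u) ?P"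
    using tendsto_fst[OF d] tendsto_snd[OF d] by simp_all
  have k: "filterlim k (at_right 0) ?P"
    unfolding k_def using \<delta> by (intro filterlim_compose[OF at_right_scale h]) simp
  have v: "(v \<longlongrightarrow> u) ?P" unfolding v_def by (rule filterlim_compose[OF q k])
  have k0: "(k \<longlongrightarrow> 0) ?P" by (rule filterlim_compose[OF tendsto_ident_at k])
  have \<beta>: "(\<beta> \<longlongrightarrow> 1 - (1 - \<delta>)) ?P" unfolding \<beta>_def by (intro tendsto_intros \<alpha>)
  \<comment> \<open>To first order the new start is \<open>x - h *\<^sub>R u\<close> and the
    junction is \<open>x - ((1 - \<delta>) * h) *\<^sub>R u\<close>. The displacement
    \<open>(\<delta> * h) *\<^sub>R u\<close> is covered in time about \<open>\<delta> * h\<close>,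
    so the joining velocity tends to \<open>u\<close> and stays below \<open>R\<close>.\<close>
  have "(vel \<longlongrightarrow> (- ((1 - \<delta>) *\<^sub>R u) - - u) /\<^sub>R (1 - (1 - \<delta>))) ?P"
    unfolding vel_def using \<delta> by (intro tendsto_intros v w \<beta>) simp
  moreover have "(- ((1 - \<delta>) *\<^sub>R u) - - u) /\<^sub>R (1 - (1 - \<delta>)) = u" using \<delta> by (simp add: scaleR_diff_left)
  ultimately have vel: "(vel \<longlongrightarrow> u) ?P" by simp
  have start: "((\<lambda>p. x + fst p *\<^sub>R snd (snd p)) \<longlongrightarrow> x + 0 *\<^sub>R - u) ?P" by (intro tendsto_intros h0 w)
  have join: "((\<lambda>p. x - k p *\<^sub>R v p) \<longlongrightarrow> x - 0 *\<^sub>R u) ?P" by (intro tendsto_intros k0 v)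
  have cost: "((\<lambda>p. M * \<beta> p + (1 - \<delta>) * c) \<longlongrightarrow> M * (1 - (1 - \<delta>)) + (1 - \<delta>) * c) ?P" by (intro tendsto_intros \<beta>)
  have evR: "\<forall>\<^sub>F p in ?P. norm (f p) < R" if "(f \<longlongrightarrow> y) ?P" "norm y < R" for f and y :: "real ^ 'n"
    by (rule order_tendstoD(2)[OF tendsto_norm[OF that(1)] that(2)])
  have xR: "norm x < R" "norm u < R" by (simp_all add: R_def add_nonneg_pos add_pos_nonneg)
  have "\<forall>\<^sub>F p in ?P. norm (vel p) < R \<and> norm (x + fst p *\<^sub>R snd (snd p)) < R \<and> norm (x - k p *\<^sub>R v p) < R \<and>
      M * \<beta> p + (1 - \<delta>) * c < c' \<and> 0 < \<beta> p \<and> steer L (k p) (q (k p)) x (k p * c) \<and> 0 < fst p"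
    using xR budget \<delta>
    by (intro eventually_conj evR[OF vel] evR[OF start] evR[OF join] order_tendstoD(2)[OF cost] order_tendstoD(1)[OF \<beta>]
        eventually_compose_filterlim[OF st k] eventually_compose_filterlim[OF eventually_at_right_less h]) simp_all
  then have "\<forall>\<^sub>F p in ?P. steer L (fst p * fst (snd p)) (x + fst p *\<^sub>R snd (snd p)) x (fst p * c')"
  proof (eventually_elim, elim conjE)
    fix p :: "real \<times> real \<times> (real ^ 'n)"
    let ?h = "fst p" and ?w = "snd (snd p)"
    assume lt: "norm (vel p) < R" "norm (x + ?h *\<^sub>R ?w) < R" "norm (x - k p *\<^sub>R v p) < R"
      and cost: "M * \<beta> p + (1 - \<delta>) * c < c'" and pos: "0 < \<beta> p" "0 < ?h" and st: "steer L (k p) (q (k p)) x (k p * c)"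
    have "0 < k p" using pos \<delta> by (simp add: k_def)
    then have kv: "k p *\<^sub>R v p = x - q (k p)" by (simp add: v_def)
    have "0 < ?h * \<beta> p" using pos by simp
    have "(?h * \<beta> p) *\<^sub>R vel p = ?h *\<^sub>R (- ((1 - \<delta>) *\<^sub>R v p) - ?w)" using pos by (simp add: vel_def)
    also have "\<dots> = - (k p *\<^sub>R v p) - ?h *\<^sub>R ?w"
      by (simp add: k_def scaleR_diff_right mult.commute)
    finally have disp: "q (k p) - (x + ?h *\<^sub>R ?w) = (?h * \<beta> p) *\<^sub>R vel p" by (simp add: kv)
    have "steer L (?h * \<beta> p) (x + ?h *\<^sub>R ?w) (q (k p)) (M * (?h * \<beta> p))"
    proof (rule steer_between[OF M \<open>0 < ?h * \<beta> p\<close>])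
      have "norm (vel p) * (?h * \<beta> p) \<le> R * (?h * \<beta> p)"
        using lt(1) \<open>0 < ?h * \<beta> p\<close> by (intro mult_right_mono) auto
      then show "norm (q (k p) - (x + ?h *\<^sub>R ?w)) \<le> R * (?h * \<beta> p)"
        unfolding disp norm_scaleR abs_of_pos[OF \<open>0 < ?h * \<beta> p\<close>] by (simp only: mult.commute)
    qed (use lt(2,3) in \<open>simp_all add: kv\<close>)
    from steer_trans[OF this st]
    have "steer L (?h * fst (snd p)) (x + ?h *\<^sub>R ?w) x (?h * (M * \<beta> p + (1 - \<delta>) * c))"
      by (simp add: \<beta>_def k_def algebra_simps)
    moreover have "?h * (M * \<beta> p + (1 - \<delta>) * c) \<le> ?h * c'" using cost pos by (intro mult_left_mono) auto
    ultimately show "steer L (?h * fst (snd p)) (x + ?h *\<^sub>R ?w) x (?h * c')" by (rule steer_mono)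
  qed
  then show ?thesis unfolding case_prod_beta' .
qed

text \<open>\<open>Lplus\<close> prescribes the start \<open>x - h *\<^sub>R u\<close> exactly,
  whereas a given path approaches \<open>x\<close> with velocity \<open>u\<close> only in the limit.
  The discrepancy is one of the perturbations of the start already dealt with.\<close>

lemma Lplus_le_of_approach:
  assumes q: "((\<lambda>h. (x - q h) /\<^sub>R h) \<longlongrightarrow> u) (at_right 0)"
    and st: "\<forall>\<^sub>F h in at_right 0. steer L h (q h) x (h * c)"
  shows "Lplus L x u \<le> ereal c"
proof (rule ereal_le_if_real_greater)
  fix c' assume "ereal c < ereal c'"
  then have "c < c'" by simp
  from eventually_compose_filterlim[OF steer_perturbed_start[OF q st this] filterlim_Pair[OF filterlim_ident tendsto_const]]
  show "Lplus L x u \<le> ereal c'" by (intro Lplus_leI) simp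
qed

lemma value_D_down_le:
  assumes "0 \<le> t" and fin: "value_fun L \<phi> (t, x) < \<infinity>"
  shows "D_down (value_fun L \<phi>) (t, x) (1, - u) \<le> Lplus L x u"
proof (rule ereal_le_if_real_greater)
  fix c assume "Lplus L x u < ereal c"
  then obtain c1 where c1: "Lplus L x u < ereal c1" "c1 < c" using ereal_dense_real by fastforce
  obtain w where w: "value_fun L \<phi> (t, x) = ereal w"
    using fin value_nonneg[of t x] by (cases "value_fun L \<phi> (t, x)") auto
  have "((\<lambda>h. (x - (x - h *\<^sub>R u)) /\<^sub>R h) \<longlongrightarrow> u) (at_right 0)"
    by (rule tendsto_eventually, rule eventually_mono[OF eventually_at_right_less[of "0::real"]]) simp
  from steer_perturbed_start[OF this Lplus_lessD[OF c1(1)] c1(2)]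
  have "\<forall>\<^sub>F (h, d) in at_right 0 \<times>\<^sub>F nhds (1, - u). value_fun L \<phi> ((t, x) + h *\<^sub>R d) \<le> ereal (w + h * c)"
  proof eventually_elim
    case (elim p)
    define h where "h = fst p"
    define d where "d = snd p"
    have "steer L (h * fst d) (x + h *\<^sub>R snd d) x (h * c)" using elim by (simp add: h_def d_def case_prod_beta)
    from value_steer_le[OF this \<open>0 \<le> t\<close>]
    have "value_fun L \<phi> (h * fst d + t, x + h *\<^sub>R snd d) \<le> ereal (h * c + w)" by (simp add: w)
    moreover have "(h * fst d + t, x + h *\<^sub>R snd d) = (t, x) + h *\<^sub>R d" by (simp add: prod_eq_iff)
    ultimately show ?case by (simp add: h_def d_def case_prod_beta add.commute)
  qed
  then show "D_down (value_fun L \<phi>) (t, x) (1, - u) \<le> ereal c"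
    by (rule D_down_leI[where W = "value_fun L \<phi>" and p = "(t, x)", OF w])
qed

end

subsection \<open>Lower semicontinuity and supersolutions\<close>

text \<open>Induction on a real interval: the supremum of the good parameters is good by closedness,
  and a good parameter below \<open>b\<close> is not the supremum.\<close>

lemma interval_induct_closed:
  fixes P :: "real \<Rightarrow> bool"
  assumes "a \<le> b" "P a"
    and lim: "\<And>s l. \<lbrakk>\<And>n. s n \<in> {a..b}; \<And>n. P (s n); s \<longlonglongrightarrow> l; l \<in> {a..b}\<rbrakk> \<Longrightarrow> P l"
    and step: "\<And>m. \<lbrakk>a \<le> m; m < b; P m\<rbrakk> \<Longrightarrow> \<exists>m'. m < m' \<and> m' \<le> b \<and> P m'"
  shows "P b"
proof -
  define S where "S = {s \<in> {a..b}. P s}"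
  have "a \<in> S" using assms(1,2) by (simp add: S_def)
  have bdd: "bdd_above S" by (auto simp: S_def)
  have "closed S"
  proof (subst closed_sequential_limits, intro allI impI, elim conjE)
    fix s l assume s: "\<forall>n. s n \<in> S" and lim': "s \<longlonglongrightarrow> l"
    have sP: "s n \<in> {a..b}" "P (s n)" for n using s by (auto simp: S_def)
    have "l \<in> {a..b}" by (rule closed_sequentially[OF closed_atLeastAtMost sP(1) lim'])
    then show "l \<in> S" using lim[OF sP lim'] by (simp add: S_def)
  qed
  have "Sup S \<in> S" using \<open>a \<in> S\<close> bdd \<open>closed S\<close> by (intro closed_contains_Sup) auto
  moreover have "\<not> Sup S < b"
  proof
    assume "Sup S < b"
    then obtain m' where "Sup S < m'" "m' \<in> S" using step[of "Sup S"] \<open>Sup S \<in> S\<close> by (force simp: S_def)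
    then show False using cSup_upper[OF _ bdd] by force
  qed
  ultimately show ?thesis by (auto simp: S_def order.order_iff_strict)
qed

context lagrangian
begin

lemma traj_relaxation_nonneg: "0 \<le> \<epsilon> \<Longrightarrow> traj (relaxation L \<epsilon>) a b y g C \<Longrightarrow> 0 \<le> C"
  unfolding traj_def using has_integral_nonneg relaxation_nonneg by blast

text \<open>The bound \<open>c - C\<close> couples the value that remains at the end point with the
  cost already spent. Since \<open>\<Phi>\<close> is nonnegative, it bounds the costs, so a
  subsequence of them converges although no convergence of \<open>C\<close> is assumed.\<close>

lemma steer_closure:
  fixes \<Phi> :: "real \<times> 'a \<Rightarrow> ereal"
  assumes \<Phi>: "lsc_on ({0..} \<times> UNIV) \<Phi>" "\<And>s z. 0 \<le> s \<Longrightarrow> 0 \<le> \<Phi> (s, z)"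
    and st: "\<And>k. steer (relaxation L (\<epsilon> k)) (T k) (x k) (z k) (C k)"
    and le: "\<And>k. \<Phi> (S k, z k) \<le> ereal (c k - C k)"
    and T: "T \<longlonglongrightarrow> t" and \<epsilon>: "\<And>k. 0 \<le> \<epsilon> k" "\<epsilon> \<longlonglongrightarrow> \<epsilon>0"
    and S: "\<And>k. 0 \<le> S k" "S \<longlonglongrightarrow> s" and x: "x \<longlonglongrightarrow> x0" and c: "c \<longlonglongrightarrow> c0"
  shows "\<exists>z' C'. steer (relaxation L \<epsilon>0) t x0 z' C' \<and> \<Phi> (s, z') \<le> ereal (c0 - C')"
proof -
  have "\<forall>k. \<exists>y g C'. traj (relaxation L (\<epsilon> k)) 0 (T k) y g C' \<and> y 0 = x k \<and> y (T k) = z k \<and> C' \<le> C k"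
    and T0: "\<And>k. 0 \<le> T k"
    using st unfolding steer_def by blast+
  then obtain y g D where tr: "\<And>k. traj (relaxation L (\<epsilon> k)) 0 (T k) (y k) (g k) (D k)"
    and ends: "\<And>k. y k 0 = x k" "\<And>k. y k (T k) = z k" and DC: "\<And>k. D k \<le> C k" by metis
  have D0: "0 \<le> D k" for k using traj_relaxation_nonneg[OF \<epsilon>(1) tr] .
  obtain B where B: "\<And>k. \<bar>c k\<bar> \<le> B"
    using convergent_imp_bounded[OF c] by (auto simp: bounded_iff)
  have "D k \<in> {0..B}" for k
  proof -
    have "0 \<le> ereal (c k - C k)" using \<Phi>(2)[OF S(1)] le by (rule order_trans)
    then show ?thesis using B[of k] DC[of k] D0[of k] by simp
  qed
  then obtain C0 r1 where r1: "strict_mono r1" and C0: "(D \<circ> r1) \<longlonglongrightarrow> C0"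
    using seq_compactE[OF compact_imp_seq_compact[OF compact_Icc], of D 0 B] by blast
  note sub = LIMSEQ_subseq_LIMSEQ[OF _ r1, unfolded o_def]
  obtain r y' g' C' where r: "strict_mono r" and tr': "traj (relaxation L \<epsilon>0) 0 t y' g' C'" "C' \<le> C0" "y' 0 = x0"
    and lim: "(\<lambda>k. y (r1 (r k)) (T (r1 (r k)))) \<longlonglongrightarrow> y' t"
    by (rule traj_closure[of "\<lambda>k. \<epsilon> (r1 k)" "\<lambda>k. T (r1 k)" "\<lambda>k. y (r1 k)" "\<lambda>k. g (r1 k)" "\<lambda>k. D (r1 k)" t \<epsilon>0 x0 C0])
      (use tr T0 sub[OF T] \<epsilon>(1) sub[OF \<epsilon>(2)] sub[OF x] C0 in \<open>simp_all add: ends o_def\<close>)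
  note sub2 = LIMSEQ_subseq_LIMSEQ[OF sub r, unfolded o_def]
  have "0 \<le> t" using T T0 by (intro LIMSEQ_le_const) auto
  have "0 \<le> s" using S by (intro LIMSEQ_le_const) auto
  have "\<Phi> (s, y' t) \<le> ereal (c0 - C0)"
  proof (rule lsc_on_limit_le[OF \<Phi>(1), where X = "\<lambda>k. (S (r1 (r k)), z (r1 (r k)))"])
    show "(\<lambda>k. (S (r1 (r k)), z (r1 (r k)))) \<longlonglongrightarrow> (s, y' t)"
      using lim by (intro tendsto_Pair sub2[OF S(2)]) (simp add: ends)
    show "\<Phi> (S (r1 (r k)), z (r1 (r k))) \<le> ereal (c (r1 (r k)) - D (r1 (r k)))" for k
      by (rule order_trans[OF le]) (use DC in simp)
    show "(\<lambda>k. c (r1 (r k)) - D (r1 (r k))) \<longlonglongrightarrow> c0 - C0"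
      by (intro tendsto_diff sub2[OF c] LIMSEQ_subseq_LIMSEQ[OF C0 r, unfolded o_def])
  qed (use S(1) \<open>0 \<le> s\<close> in auto)
  also have "\<dots> \<le> ereal (c0 - C')" using tr'(2) by simp
  finally have "\<Phi> (s, y' t) \<le> ereal (c0 - C')" .
  moreover have "steer (relaxation L \<epsilon>0) t x0 (y' t) C'"
    using tr' \<open>0 \<le> t\<close> by (intro steerI) auto
  ultimately show ?thesis by blast
qed

end

context bolza
begin

text \<open>The dummy time variable makes \<open>steer_closure\<close> applicable to the terminal
  cost.\<close>

lemma phi_lsc_product: "lsc_on ({0..} \<times> UNIV) (\<lambda>(s :: real, x). \<phi> x)"
  unfolding lsc_on_def
proof clarsimp
  fix s :: real and x c assume "0 \<le> s" "c < \<phi> x"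
  show "\<forall>\<^sub>F q in at (s, x) within {0..} \<times> UNIV. c < (case q of (s, x) \<Rightarrow> \<phi> x)"
  proof (rule sequentially_imp_eventually_within, intro allI impI, elim conjE)
    fix q :: "nat \<Rightarrow> real \<times> _" assume "q \<longlonglongrightarrow> (s, x)"
    from tendsto_snd[OF this] have "\<forall>\<^sub>F n in sequentially. c < \<phi> (snd (q n))"
      by (intro lsc_on_sequentially[OF phi_lsc _ _ _ \<open>c < \<phi> x\<close>]) simp_all
    then show "\<forall>\<^sub>F n in sequentially. c < (case q n of (s, x) \<Rightarrow> \<phi> x)"
      by (simp only: case_prod_beta)
  qed
qed

text \<open>If the values stay at or below \<open>c\<close> along a sequence, near-minimisers, of
  varying duration, accumulate at a trajectory that shows the value at the limit to be at most
  \<open>c\<close>.\<close>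

lemma value_lsc: "lsc_on ({0..} \<times> UNIV) (value_fun L \<phi>)"
  unfolding lsc_on_def
proof (intro ballI allI impI)
  fix p c assume p: "p \<in> {0..} \<times> UNIV" and c: "c < value_fun L \<phi> p"
  obtain t x where px: "p = (t, x)" by force
  show "\<forall>\<^sub>F q in at p within {0..} \<times> UNIV. c < value_fun L \<phi> q"
  proof (rule sequentially_imp_eventually_within, intro allI impI, elim conjE)
    fix q assume q: "\<forall>n. q n \<in> {0..} \<times> UNIV \<and> q n \<noteq> p" and lim: "q \<longlonglongrightarrow> p"
    show "\<forall>\<^sub>F n in sequentially. c < value_fun L \<phi> (q n)"
    proof (rule ccontr)
      assume "\<not> ?thesis"
      from not_eventually_sequentiallyD[OF this]
      obtain r :: "nat \<Rightarrow> nat" where r: "strict_mono r" and "\<forall>n. \<not> c < value_fun L \<phi> (q (r n))" by blast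
      then have le: "value_fun L \<phi> (q (r n)) \<le> c" for n by (simp add: not_less)
      have "0 \<le> value_fun L \<phi> (q (r 0))"
        using value_nonneg[of "fst (q (r 0))" "snd (q (r 0))"] by simp
      then have "0 \<le> c" using le[of 0] by (rule order_trans)
      with c obtain c' where c': "c = ereal c'" by (cases c) auto
      define T where "T n = fst (q (r n))" for n
      define X where "X n = snd (q (r n))" for n
      have lim': "(\<lambda>n. q (r n)) \<longlonglongrightarrow> (t, x)" using LIMSEQ_subseq_LIMSEQ[OF lim r] by (simp add: px o_def)
      have T: "T \<longlonglongrightarrow> t" "\<And>n. 0 \<le> T n" and X: "X \<longlonglongrightarrow> x"
        using tendsto_fst[OF lim'] tendsto_snd[OF lim'] q unfolding T_def X_def
        by (auto simp: mem_Times_iff)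
      have "\<exists>z C. steer L (T n) (X n) z C \<and> \<phi> z \<le> ereal (c' + 1 / Suc n - C)" for n
      proof -
        have "value_fun L \<phi> (T n, X n) \<le> ereal c'" using le[of n] by (simp add: T_def X_def c')
        also have "\<dots> < ereal (c' + 1 / Suc n)" by simp
        finally obtain y g C where tr: "traj L 0 (T n) y g C" "y 0 = X n"
          and lt: "ereal C + \<phi> (y (T n)) < ereal (c' + 1 / Suc n)"
          using value_lessE T(2) by blast
        have "steer L (T n) (X n) (y (T n)) C" using tr T(2) by (intro steerI) auto
        moreover have "\<phi> (y (T n)) \<le> ereal (c' + 1 / Suc n - C)" using lt by (cases "\<phi> (y (T n))") auto
        ultimately show ?thesis by blast
      qed
      then obtain z C where st: "\<And>n. steer L (T n) (X n) (z n) (C n)"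
        and phi: "\<And>n. \<phi> (z n) \<le> ereal (c' + 1 / Suc n - C n)" by metis
      have "(\<lambda>n. c' + 1 / Suc n) \<longlonglongrightarrow> c' + 0"
        by (intro tendsto_intros LIMSEQ_Suc[OF lim_1_over_n])
      then have "\<exists>z' C'. steer (relaxation L 0) t x z' C' \<and> (\<lambda>(s :: real, x). \<phi> x) (0, z') \<le> ereal (c' + 0 - C')"
        using T(1) X phi st
        by (intro steer_closure[where \<epsilon> = "\<lambda>_. 0" and S = "\<lambda>_. 0" and T = T and x = X and z = z and C = C]
            phi_lsc_product) (auto simp: relaxation_0 phi_nonneg)
      then obtain z' C' where "steer L t x z' C'" and z': "\<phi> z' \<le> ereal (c' - C')" by (auto simp: relaxation_0)
      from value_le[OF this(1)] have "value_fun L \<phi> (t, x) \<le> ereal C' + \<phi> z'" .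
      also have "\<dots> \<le> ereal c'" using z' by (cases "\<phi> z'") auto
      finally show False using c by (simp add: px c')
    qed
  qed
qed

text \<open>The derivative provides a direction close to \<open>(- 1, u)\<close>. Dividing by its
  time component gives a step at unit time rate with velocity \<open>v\<close>. The bound on
  \<open>h * norm v\<close> keeps the step within the radius of the relaxation.\<close>

lemma descent_step:
  assumes a: "D_up W (T, z) (- 1, u) \<le> - ereal (L z u)" and "0 < T" and w: "W (T, z) = ereal w" and "0 < \<epsilon>"
  obtains h v where "0 < h" "h \<le> T" "h * norm v \<le> \<epsilon>" "W (T - h, z + h *\<^sub>R v) \<le> ereal (w - h * (L z v - \<epsilon>))"
proof -
  have lt: "D_up W (T, z) (- 1, u) < ereal (- L z u + \<epsilon> / 2)"
    by (rule le_less_trans[OF a]) (use \<open>0 < \<epsilon>\<close> in simp)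
  have id: "((\<lambda>d. d) \<longlongrightarrow> (- 1, u)) (nhds (- 1 :: real, u))" by (rule filterlim_ident)
  have fst_lim: "((\<lambda>d. - fst d) \<longlongrightarrow> 1) (nhds (- 1 :: real, u))" and snd_lim: "(snd \<longlongrightarrow> u) (nhds (- 1 :: real, u))"
    using tendsto_minus[OF tendsto_fst[OF id]] tendsto_snd[OF id] by auto
  \<comment> \<open>Continuity of the finite convex function \<open>L z\<close> allows the actual
    velocity \<open>v\<close> to replace \<open>u\<close> at the price of
    \<open>\<epsilon> / 2\<close>.\<close>
  have cont: "isCont (L z) u"
    using convex_on_continuous[OF open_UNIV convex] by (simp add: continuous_on_eq_continuous_at)
  have vel_lim: "((\<lambda>d. snd d /\<^sub>R (- fst d)) \<longlongrightarrow> u) (nhds (- 1 :: real, u))"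
    using tendsto_scaleR[OF tendsto_inverse[OF fst_lim] snd_lim] by simp
  have "((\<lambda>d. (- fst d) * (L z (snd d /\<^sub>R (- fst d)) - \<epsilon>)) \<longlongrightarrow> 1 * (L z u - \<epsilon>)) (nhds (- 1, u))"
    by (intro tendsto_mult fst_lim tendsto_diff tendsto_const isCont_tendsto_compose[OF cont vel_lim])
  then have "\<forall>\<^sub>F d in nhds (- 1 :: real, u). (- fst d) * (L z (snd d /\<^sub>R (- fst d)) - \<epsilon>) < L z u - \<epsilon> / 2"
    using \<open>0 < \<epsilon>\<close> by (intro order_tendstoD(2)) auto
  moreover have "\<forall>\<^sub>F d in nhds (- 1 :: real, u). 0 < - fst d" "\<forall>\<^sub>F d in nhds (- 1 :: real, u). - fst d < 2"
    by (intro order_tendstoD[OF fst_lim]; simp)+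
  moreover have "\<forall>\<^sub>F d in nhds (- 1 :: real, u). norm (snd d) < norm u + 1"
    by (intro order_tendstoD(2)[OF tendsto_norm[OF snd_lim]]) simp
  ultimately have evd: "\<forall>\<^sub>F d in nhds (- 1 :: real, u). (- fst d) * (L z (snd d /\<^sub>R (- fst d)) - \<epsilon>) < L z u - \<epsilon> / 2
      \<and> 0 < - fst d \<and> - fst d < 2 \<and> norm (snd d) < norm u + 1"
    by eventually_elim auto
  \<comment> \<open>The time component is below 2 in absolute value, so \<open>T / 2\<close> keeps
    the normalised step below \<open>T\<close>; the space component is below
    \<open>norm u + 1\<close>, whence the second bound.\<close>
  define h0 where "h0 = min (T / 2) (\<epsilon> / (norm u + 1))"
  have "0 < h0" using \<open>0 < T\<close> \<open>0 < \<epsilon>\<close> by (simp add: h0_def add_nonneg_pos)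
  have evh: "\<forall>\<^sub>F h in at_right 0. h < h0"
    using \<open>0 < h0\<close> by (auto simp: eventually_at_right[of 0 h0])
  have ev: "\<forall>\<^sub>F (h, d) in at_right 0 \<times>\<^sub>F nhds (- 1 :: real, u). h < h0 \<and>
      (- fst d) * (L z (snd d /\<^sub>R (- fst d)) - \<epsilon>) < L z u - \<epsilon> / 2 \<and> 0 < - fst d \<and> - fst d < 2 \<and> norm (snd d) < norm u + 1"
    by (rule at_right_directionI[OF evh evd]) simp
  from D_up_lessD[where W = W and p = "(T, z)", OF lt w ev] obtain h d where h: "0 < h" "h < h0"
    and d1: "(- fst d) * (L z (snd d /\<^sub>R (- fst d)) - \<epsilon>) < L z u - \<epsilon> / 2"
    and d2: "0 < - fst d" "- fst d < 2" "norm (snd d) < norm u + 1"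
    and W: "W ((T, z) + h *\<^sub>R d) < ereal (w + h * (- L z u + \<epsilon> / 2))"
    by blast
  define \<beta> where "\<beta> = - fst d"
  define v where "v = snd d /\<^sub>R \<beta>"
  have \<beta>: "0 < \<beta>" "\<beta> < 2" using d2 by (auto simp: \<beta>_def)
  have snd: "snd d = \<beta> *\<^sub>R v" using \<beta> by (simp add: v_def)
  show thesis
  proof (rule that[of "h * \<beta>" v])
    show "0 < h * \<beta>" using h \<beta> by simp
    have "h * \<beta> \<le> (T / 2) * 2" using h \<beta> by (intro mult_mono) (auto simp: h0_def)
    then show "h * \<beta> \<le> T" by simp
    have "h * \<beta> * norm v = h * norm (snd d)" using \<beta> by (simp add: snd)
    also have "\<dots> \<le> \<epsilon> / (norm u + 1) * (norm u + 1)"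
      using h d2(3) by (intro mult_mono) (auto simp: h0_def)
    also have "\<dots> = \<epsilon>" by (simp add: add_nonneg_eq_0_iff)
    finally show "h * \<beta> * norm v \<le> \<epsilon>" .
    have "(T, z) + h *\<^sub>R d = (T - h * \<beta>, z + (h * \<beta>) *\<^sub>R v)"
      by (simp add: prod_eq_iff snd) (simp add: \<beta>_def)
    then have "W (T - h * \<beta>, z + (h * \<beta>) *\<^sub>R v) \<le> ereal (w + h * (- L z u + \<epsilon> / 2))"
      using W by simp
    also have "\<dots> \<le> ereal (w - h * \<beta> * (L z v - \<epsilon>))"
    proof -
      have "\<beta> * (L z v - \<epsilon>) \<le> L z u - \<epsilon> / 2" using d1 by (simp add: \<beta>_def v_def)
      then have "h * (\<beta> * (L z v - \<epsilon>)) \<le> h * (L z u - \<epsilon> / 2)" using h by (intro mult_left_mono) auto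
      then show ?thesis by (simp add: algebra_simps)
    qed
    finally show "W (T - h * \<beta>, z + (h * \<beta>) *\<^sub>R v) \<le> ereal (w - h * \<beta> * (L z v - \<epsilon>))" .
  qed
qed

text \<open>The steps may shrink and accumulate before time \<open>t\<close>. As the radius
  \<open>\<epsilon>\<close> is kept fixed, the limit of the concatenated paths is a trajectory for
  the same relaxation, and the induction continues from there.\<close>

lemma relaxed_descent:
  assumes W: "nonneg_lsc_with_initial \<phi> W" and a: "cond_a L W"
    and "0 \<le> t" and w: "W (t, x) = ereal w" and "0 < \<epsilon>"
  shows "\<exists>z c. steer (relaxation L \<epsilon>) t x z c \<and> W (0, z) \<le> ereal (w + \<epsilon> * t - c)"
proof -
  have lsc: "lsc_on ({0..} \<times> UNIV) W" and nn: "\<And>s z. 0 \<le> s \<Longrightarrow> 0 \<le> W (s, z)"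
    using W by (auto simp: nonneg_lsc_with_initial_def)
  show ?thesis
  proof (rule interval_induct_closed[where P = "\<lambda>s. \<exists>z c. steer (relaxation L \<epsilon>) s x z c \<and> W (t - s, z) \<le> ereal (w + \<epsilon> * s - c)",
        of 0 t, simplified diff_self])
    show "\<exists>z c. steer (relaxation L \<epsilon>) 0 x z c \<and> W (t - 0, z) \<le> ereal (w + \<epsilon> * 0 - c)"
      using w by (intro exI[of _ x] exI[of _ 0]) (simp add: steer_refl)
  next
    fix s l assume st: "\<And>n. s n \<in> {0..t}" and lim: "s \<longlonglongrightarrow> l"
      and "\<And>n. \<exists>z c. steer (relaxation L \<epsilon>) (s n) x z c \<and> W (t - s n, z) \<le> ereal (w + \<epsilon> * s n - c)"
    then obtain z c where zc: "\<And>n. steer (relaxation L \<epsilon>) (s n) x (z n) (c n)"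
      "\<And>n. W (t - s n, z n) \<le> ereal (w + \<epsilon> * s n - c n)" by metis
    show "\<exists>z c. steer (relaxation L \<epsilon>) l x z c \<and> W (t - l, z) \<le> ereal (w + \<epsilon> * l - c)"
    proof (rule steer_closure[where \<epsilon> = "\<lambda>_. \<epsilon>" and S = "\<lambda>n. t - s n" and T = s and x = "\<lambda>_. x" and z = z
          and C = c and c = "\<lambda>n. w + \<epsilon> * s n"])
      show "(\<lambda>n. t - s n) \<longlonglongrightarrow> t - l" "(\<lambda>n. w + \<epsilon> * s n) \<longlonglongrightarrow> w + \<epsilon> * l"
        by (intro tendsto_intros lim)+
    qed (use lsc nn zc st lim \<open>0 < \<epsilon>\<close> in auto)
  next
    fix m assume "0 \<le> m" "m < t"
      and "\<exists>z c. steer (relaxation L \<epsilon>) m x z c \<and> W (t - m, z) \<le> ereal (w + \<epsilon> * m - c)"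
    then obtain z c where st: "steer (relaxation L \<epsilon>) m x z c" and le: "W (t - m, z) \<le> ereal (w + \<epsilon> * m - c)"
      and T: "0 < t - m" by auto
    have "W (t - m, z) < \<infinity>" using le by (rule le_less_trans) simp
    moreover have "0 \<le> W (t - m, z)" using nn T by simp
    ultimately obtain w' where w': "W (t - m, z) = ereal w'" by (cases "W (t - m, z)") auto
    obtain u where u: "D_up W (t - m, z) (- 1, u) \<le> - ereal (L z u)"
      using a T w' unfolding cond_a_def by (metis ereal_less(4) less_ereal.simps(4))
    obtain h v where h: "0 < h" "h \<le> t - m" "h * norm v \<le> \<epsilon>"
      and W': "W (t - m - h, z + h *\<^sub>R v) \<le> ereal (w' - h * (L z v - \<epsilon>))"
      using descent_step[where W = W, OF u T w' \<open>0 < \<epsilon>\<close>] by blast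
    have "steer (relaxation L \<epsilon>) h z (z + h *\<^sub>R v) (L z v * h)"
    proof (rule steer_segment)
      fix s assume s: "s \<in> {0..h}"
      have "s * norm v \<le> h * norm v" using s by (intro mult_right_mono) auto
      then show "relaxation L \<epsilon> (z + s *\<^sub>R v) v \<le> L z v"
        using h s by (intro relaxation_le) (simp add: dist_norm)
    qed (use h \<open>0 < \<epsilon>\<close> in auto)
    from steer_trans[OF st this] have "steer (relaxation L \<epsilon>) (m + h) x (z + h *\<^sub>R v) (c + L z v * h)" .
    moreover have "W (t - (m + h), z + h *\<^sub>R v) \<le> ereal (w + \<epsilon> * (m + h) - (c + L z v * h))"
    proof -
      have "w' \<le> w + \<epsilon> * m - c" using le w' by simp
      then have "w' - h * (L z v - \<epsilon>) \<le> w + \<epsilon> * (m + h) - (c + L z v * h)"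
        by (simp add: algebra_simps)
      with W' show ?thesis by (auto simp: diff_diff_eq elim: order_trans)
    qed
    ultimately show "\<exists>m'>m. m' \<le> t \<and> (\<exists>z c. steer (relaxation L \<epsilon>) m' x z c \<and> W (t - m', z) \<le> ereal (w + \<epsilon> * m' - c))"
      using h by (intro exI[of _ "m + h"]) auto
  qed (use \<open>0 \<le> t\<close> in auto)
qed

theorem value_le_of_cond_a:
  assumes W: "nonneg_lsc_with_initial \<phi> W" and a: "cond_a L W" and "0 \<le> t"
  shows "value_fun L \<phi> (t, x) \<le> W (t, x)"
proof (cases "W (t, x) = \<infinity>")
  case False
  have lsc: "lsc_on ({0..} \<times> UNIV) W" and nn: "\<And>s z. 0 \<le> s \<Longrightarrow> 0 \<le> W (s, z)" and init: "\<And>z. W (0, z) = \<phi> z"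
    using W by (auto simp: nonneg_lsc_with_initial_def)
  obtain w where w: "W (t, x) = ereal w" using False nn[OF \<open>0 \<le> t\<close>, of x] by (cases "W (t, x)") auto
  define \<epsilon> where "\<epsilon> k = 1 / real (Suc k)" for k
  have \<epsilon>: "\<epsilon> \<longlonglongrightarrow> 0" "\<And>k. 0 < \<epsilon> k" unfolding \<epsilon>_def by (intro LIMSEQ_Suc[OF lim_1_over_n], simp)
  have "\<forall>k. \<exists>z c. steer (relaxation L (\<epsilon> k)) t x z c \<and> W (0, z) \<le> ereal (w + \<epsilon> k * t - c)"
    using relaxed_descent[OF W a \<open>0 \<le> t\<close> w \<epsilon>(2)] by blast
  then obtain z c where zc: "\<And>k. steer (relaxation L (\<epsilon> k)) t x (z k) (c k)" "\<And>k. W (0, z k) \<le> ereal (w + \<epsilon> k * t - c k)"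
    by metis
  have "\<exists>z' C'. steer (relaxation L 0) t x z' C' \<and> W (0, z') \<le> ereal (w + 0 * t - C')"
  proof (rule steer_closure[where \<epsilon> = \<epsilon> and S = "\<lambda>n. 0" and T = "\<lambda>_. t" and x = "\<lambda>_. x" and z = z
          and C = c and c = "\<lambda>n. w + \<epsilon> n * t"])
    show "(\<lambda>n. w + \<epsilon> n * t) \<longlonglongrightarrow> w + 0 * t" by (intro tendsto_intros \<epsilon>)
  qed (use lsc nn zc \<epsilon> in \<open>auto intro: less_imp_le\<close>)
  then obtain z' C' where st: "steer L t x z' C'" and z': "\<phi> z' \<le> ereal (w - C')"
    by (auto simp: relaxation_0 init)
  from value_le[OF st] have "value_fun L \<phi> (t, x) \<le> ereal C' + \<phi> z'" .
  also have "\<dots> \<le> ereal w" using z' by (cases "\<phi> z'") auto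
  finally show ?thesis by (simp add: w)
qed simp

end

subsection \<open>Speed of near-optimal trajectories\<close>

context lagrangian
begin

lemma traj_length_le:
  assumes tr: "traj L a b y g C" and "a \<le> b" "0 \<le> \<eta>" and K: "\<And>x u. norm u \<le> \<eta> * L x u + K"
  shows "integral {a..b} (\<lambda>s. norm (g s)) \<le> \<eta> * C + K * (b - a)"
proof -
  have A: "AC_on a b y g" and L: "((\<lambda>s. L (y s) (g s)) has_integral C) {a..b}" using tr by (auto simp: traj_def)
  have i1: "((\<lambda>s. \<eta> * L (y s) (g s) + K) has_integral (\<eta> * C + K * (b - a))) {a..b}"
    using has_integral_add[OF has_integral_mult_right[OF L, of \<eta>] has_integral_const_real[of K a b]] \<open>a \<le> b\<close>
    by (simp add: mult.commute)
  have i2: "((\<lambda>s. norm (g s)) has_integral (integral {a..b} (\<lambda>s. norm (g s)))) {a..b}"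
    by (intro integrable_integral AC_on_norm_integrable[OF A]) auto
  show ?thesis by (rule has_integral_le[OF i2 i1]) (rule K)
qed

lemma traj_displacement_le:
  assumes tr: "traj L a b y g C" and "a \<le> s" "s \<le> s'" "s' \<le> b" "0 \<le> \<eta>" and K: "\<And>x u. norm u \<le> \<eta> * L x u + K"
    and "0 \<le> K"
  shows "norm (y s' - y s) \<le> \<eta> * C + K * (b - a)"
proof -
  have A: "AC_on a b y g" using tr by (simp add: traj_def)
  have "norm (y s' - y s) \<le> integral {s..s'} (\<lambda>s. norm (g s))" using assms by (intro AC_on_increment_le[OF A])
  also have "\<dots> \<le> integral {a..b} (\<lambda>s. norm (g s))"
    using assms by (intro integral_subset_le AC_on_norm_integrable[OF A]) auto
  also have "\<dots> \<le> \<eta> * C + K * (b - a)" using assms by (intro traj_length_le[OF tr]) auto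
  finally show ?thesis .
qed

text \<open>An affine cost depends on duration and displacement only; this takes the place of
  Jensen's inequality.\<close>

lemma traj_affine_lower_bound:
  assumes tr: "traj L a b y g C" and "a \<le> b" and m: "\<And>s w. s \<in> {a..b} \<Longrightarrow> c + p \<bullet> w \<le> L (y s) w"
  shows "(b - a) * c + p \<bullet> (y b - y a) \<le> C"
proof -
  have A: "AC_on a b y g" and L: "((\<lambda>s. L (y s) (g s)) has_integral C) {a..b}" using tr by (auto simp: traj_def)
  have "((\<lambda>s. p \<bullet> g s) has_integral (p \<bullet> (y b - y a))) {a..b}"
    using has_integral_linear[OF AC_on_increment[OF A order_refl \<open>a \<le> b\<close> order_refl] bounded_linear_inner_right[of p]]
    by (simp add: o_def)
  then have "((\<lambda>s. c + p \<bullet> g s) has_integral ((b - a) * c + p \<bullet> (y b - y a))) {a..b}"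
    using has_integral_add[OF has_integral_const_real[of c a b]] \<open>a \<le> b\<close> by simp
  then show ?thesis using L by (rule has_integral_le) (rule m)
qed

end

section \<open>Near-optimal starts and condition (a) for the value function\<close>

context bolza
begin

text \<open>Disjoint stretches of length \<open>2 * \<tau>\<close> fit into \<open>{0..S}\<close> at
  least \<open>S / (4 * \<tau>)\<close> times. If each were displaced by more than
  \<open>4 * B / S * \<tau>\<close>, the path would be longer than \<open>B\<close>.\<close>

lemma exists_slow_interval:
  assumes A: "AC_on 0 S y g" and B: "integral {0..S} (\<lambda>s. norm (g s)) \<le> B"
    and \<tau>: "0 < \<tau>" "\<tau> \<le> S / 4"
  obtains s where "0 \<le> s" "s + 2 * \<tau> \<le> S" "norm (y (s + 2 * \<tau>) - y s) \<le> 4 * B / S * \<tau>"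
proof (rule ccontr)
  assume "\<not> thesis"
  then have no: "\<not> (0 \<le> s \<and> s + 2 * \<tau> \<le> S \<and> norm (y (s + 2 * \<tau>) - y s) \<le> 4 * B / S * \<tau>)" for s
    using that by blast
  define q where "q = 4 * B / S * \<tau>"
  have gt: "q < norm (y (s + 2 * \<tau>) - y s)" if "0 \<le> s" "s + 2 * \<tau> \<le> S" for s
    using no[of s] that by (auto simp: q_def not_le[symmetric])
  have "0 < S" using \<tau> by simp
  define N where "N s = integral {0..s} (\<lambda>s. norm (g s))" for s
  have ni: "(\<lambda>s. norm (g s)) integrable_on {p..q}" if "0 \<le> p" "q \<le> S" for p q
    using AC_on_norm_integrable[OF A that] .
  have N: "q < N (s + 2 * \<tau>) - N s" if s: "0 \<le> s" "s + 2 * \<tau> \<le> S" for s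
  proof -
    have "norm (y (s + 2 * \<tau>) - y s) \<le> integral {s..s + 2 * \<tau>} (\<lambda>s. norm (g s))"
      using s \<tau> by (intro AC_on_increment_le[OF A]) auto
    also have "\<dots> = N (s + 2 * \<tau>) - N s"
      unfolding N_def using Henstock_Kurzweil_Integration.integral_combine[of 0 s "s + 2 * \<tau>" "\<lambda>s. norm (g s)"] s \<tau> ni
      by (simp add: algebra_simps)
    finally show ?thesis using gt[OF s] by simp
  qed
  have iter: "real i * q \<le> N (real i * (2 * \<tau>))" if "real i * (2 * \<tau>) \<le> S" for i
    using that
  proof (induction i)
    case (Suc i)
    have e: "real (Suc i) * (2 * \<tau>) = real i * (2 * \<tau>) + 2 * \<tau>" by (simp add: algebra_simps)
    show ?case using Suc N[of "real i * (2 * \<tau>)"] \<tau> unfolding e by (simp add: algebra_simps)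
  qed (simp add: N_def)
  define n where "n = nat \<lfloor>S / (2 * \<tau>)\<rfloor>"
  have fl: "0 \<le> S / (2 * \<tau>)" "2 \<le> S / (2 * \<tau>)" using \<tau> \<open>0 < S\<close> by (simp_all add: field_simps)
  have n: "real n \<le> S / (2 * \<tau>)" "S / (2 * \<tau>) < real n + 1"
    using fl unfolding n_def by (simp_all add: of_nat_nat)
  \<comment> \<open>One stretch is split off: \<open>iter\<close> yields only a weak inequality, and
    the last stretch makes the total strict.\<close>
  have "1 \<le> n" using n fl by linarith
  then obtain m where m: "n = Suc m" by (cases n) auto
  have nS: "real n * (2 * \<tau>) \<le> S" using n(1) \<tau> by (simp add: field_simps)
  have e: "real n * (2 * \<tau>) = real m * (2 * \<tau>) + 2 * \<tau>" by (simp add: m algebra_simps)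
  have "0 \<le> N S" unfolding N_def using ni by (intro Henstock_Kurzweil_Integration.integral_nonneg) auto
  then have "0 \<le> B" using B by (simp add: N_def)
  have "B \<le> real n * q"
  proof -
    have "S / (2 * \<tau>) \<le> 2 * real n" using n(2) fl(2) by linarith
    then have "S \<le> 4 * (real n * \<tau>)" using \<tau> by (simp add: field_simps)
    then have "B * S \<le> B * (4 * (real n * \<tau>))" using \<open>0 \<le> B\<close> by (rule mult_left_mono)
    then show ?thesis using \<open>0 < S\<close> by (simp add: q_def field_simps)
  qed
  also have "\<dots> < N (real n * (2 * \<tau>))"
    using iter[of m] N[of "real m * (2 * \<tau>)"] nS \<tau> unfolding e by (simp add: m algebra_simps)
  also have "\<dots> \<le> N S"
    unfolding N_def using nS \<tau> by (intro integral_subset_le ni) auto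
  also have "\<dots> \<le> B" using B by (simp add: N_def)
  finally show False by simp
qed

text \<open>A stretch of length \<open>2 * \<tau>\<close> on which the average speed is moderate is replaced by a straight line
  run through in time \<open>\<tau>\<close>; its cost is proportional to the time saved, although \<open>L\<close> has no upper
  growth bound.\<close>

lemma steer_save_time:
  assumes tr: "traj L 0 S y g C" and B: "integral {0..S} (\<lambda>s. norm (g s)) \<le> B"
    and \<tau>: "0 < \<tau>" "\<tau> \<le> S / 4"
    and R: "\<And>s. s \<in> {0..S} \<Longrightarrow> norm (y s) \<le> R" "4 * B / S \<le> R"
    and M: "\<And>x u. norm x \<le> R \<Longrightarrow> norm u \<le> R \<Longrightarrow> L x u \<le> M"
  shows "steer L (S - \<tau>) (y 0) (y S) (C + M * \<tau>)"
proof -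
  have A: "AC_on 0 S y g" using tr by (simp add: traj_def)
  obtain s where s: "0 \<le> s" "s + 2 * \<tau> \<le> S" and slow: "norm (y (s + 2 * \<tau>) - y s) \<le> 4 * B / S * \<tau>"
    using exists_slow_interval[OF A B \<tau>] by blast
  obtain C1 C2 where 1: "traj L 0 s y g C1" and "traj L s S y g C2" "C = C1 + C2"
    using traj_split[OF tr s(1)] s(2) \<tau> by auto
  moreover obtain C3 C4 where 3: "traj L s (s + 2 * \<tau>) y g C3" and 4: "traj L (s + 2 * \<tau>) S y g C4" and "C2 = C3 + C4"
    using traj_split[OF \<open>traj L s S y g C2\<close>, of "s + 2 * \<tau>"] s(2) \<tau> by auto
  ultimately have C: "C = C1 + C3 + C4" by simp
  have "steer L \<tau> (y s) (y (s + 2 * \<tau>)) (M * \<tau>)"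
    by (rule steer_between[OF M \<tau>(1)])
      (use R s \<tau> order_trans[OF slow mult_right_mono[OF R(2)]] in auto)
  from steer_trans[OF steer_trans[OF traj_imp_steer[OF 1 s(1) order_refl] this] traj_imp_steer[OF 4 s(2) order_refl]]
  have "steer L (s - 0 + \<tau> + (S - (s + 2 * \<tau>))) (y 0) (y S) (C1 + M * \<tau> + C4)" .
  moreover have "s - 0 + \<tau> + (S - (s + 2 * \<tau>)) = S - \<tau>" by simp
  ultimately show ?thesis
    using traj_nonneg[OF 3] C by (auto elim: steer_mono)
qed

text \<open>Let \<open>\<Delta>\<close> be the displacement in time \<open>h\<close>. If
  \<open>\<Delta> > h\<close>, reaching \<open>y h\<close> at unit speed and recovering the delay
  later costs at most \<open>2 * M * \<Delta>\<close> beyond the cost \<open>c2\<close> of the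
  remainder, whereas by growth the original start costs at least
  \<open>(2 * M + 1) * \<Delta>\<close> up to a multiple of \<open>h\<close>. Near-optimality up to
  \<open>h\<^sup>2\<close> therefore gives a displacement of order \<open>h\<close>.\<close>

lemma near_optimal_start:
  assumes "0 < t" and w: "value_fun L \<phi> (t, x) = ereal w"
  obtains h1 K D where "0 < h1" "h1 \<le> t"
    "\<And>h. 0 < h \<Longrightarrow> h < h1 \<Longrightarrow> \<exists>y g C v. traj L 0 h y g C \<and> y 0 = x \<and> y h = x + h *\<^sub>R v \<and> norm v \<le> K \<and> C \<le> D \<and>
       value_fun L \<phi> (t - h, x + h *\<^sub>R v) \<le> ereal (w + h\<^sup>2 - C)"
proof -
  have "0 \<le> w" using value_nonneg[of t x] by (simp add: w)
  define D where "D = w + 1"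
  have "1 \<le> D" using \<open>0 \<le> w\<close> by (simp add: D_def)
  obtain K1 where "0 \<le> K1" and K1: "\<And>x u. norm u \<le> 1 * L x u + K1" using growth_bound[of 1] by auto
  define B where "B = D + K1 * t"
  have "0 \<le> B" using \<open>1 \<le> D\<close> \<open>0 \<le> K1\<close> \<open>0 < t\<close> by (simp add: B_def)
  \<comment> \<open>The summands cover the positions on the path, the average speed
    \<open>4 * B / (t - h)\<close> on the stretch to be shortened, where
    \<open>h \<le> t / 2\<close>, and unit speed at the start.\<close>
  define R where "R = norm x + B + 8 * B / t + 1"
  have R: "norm x + B \<le> R" "8 * B / t \<le> R" "1 \<le> R"
    using \<open>0 \<le> B\<close> \<open>0 < t\<close> by (simp_all add: R_def)
  obtain M where "0 \<le> M" and M: "\<And>x u. norm x \<le> R \<Longrightarrow> norm u \<le> R \<Longrightarrow> L x u \<le> M" using L_bound[of R] by blast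
  define \<omega> where "\<omega> = 2 * M + 1"
  have "0 < \<omega>" using \<open>0 \<le> M\<close> by (simp add: \<omega>_def)
  obtain K2 where "0 \<le> K2" and K2: "\<And>x u. norm u \<le> (1 / \<omega>) * L x u + K2" using growth_bound[of "1 / \<omega>"] \<open>0 < \<omega>\<close> by auto
  \<comment> \<open>This rate and the last bound in \<open>h1\<close> contribute
    \<open>t / 16\<close> each, so \<open>\<Delta> \<le> t / 8 \<le> (t - h) / 4\<close> and the
    delay is short enough to be recovered.\<close>
  define \<eta> where "\<eta> = t / (16 * D)"
  have "0 < \<eta>" using \<open>0 < t\<close> \<open>1 \<le> D\<close> by (simp add: \<eta>_def)
  obtain K3 where "0 \<le> K3" and K3: "\<And>x u. norm u \<le> \<eta> * L x u + K3" using growth_bound[OF \<open>0 < \<eta>\<close>] by blast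
  define h1 where "h1 = min 1 (min (t / 2) (t / (16 * (K3 + 1))))"
  have "0 < t / (16 * (K3 + 1))" using \<open>0 < t\<close> \<open>0 \<le> K3\<close> by simp
  then have "0 < h1" using \<open>0 < t\<close> by (simp add: h1_def)
  moreover have "h1 \<le> t / 2" unfolding h1_def by (rule min.coboundedI2, rule min.cobounded1)
  moreover have "h1 \<le> 1" "h1 \<le> t / (16 * (K3 + 1))" unfolding h1_def by simp_all
  ultimately have h1: "0 < h1" "h1 \<le> 1" "h1 \<le> t / 2" "h1 \<le> t / (16 * (K3 + 1))" by auto
  show thesis
  proof (rule that[of h1 "\<omega> * K2 + 1" D])
    show "0 < h1" "h1 \<le> t" using h1 \<open>0 < t\<close> by auto
    fix h assume h: "0 < h" "h < h1"
    have "h\<^sup>2 \<le> h * 1" unfolding power2_eq_square using h h1 by (intro mult_left_mono) auto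
    have "value_fun L \<phi> (t, x) < ereal (w + h\<^sup>2)" using h by (simp add: w)
    then obtain y g C where tr: "traj L 0 t y g C" and y0: "y 0 = x" and lt: "ereal C + \<phi> (y t) < ereal (w + h\<^sup>2)"
      using value_lessE[of t x] \<open>0 < t\<close> by (metis less_imp_le)
    obtain f where f: "\<phi> (y t) = ereal f" using lt phi_nonneg[of "y t"] by (cases "\<phi> (y t)") auto
    have "0 \<le> f" using phi_nonneg[of "y t"] by (simp add: f)
    obtain c1 c2 where t1: "traj L 0 h y g c1" and t2: "traj L h t y g c2" and C: "C = c1 + c2"
      using traj_split[OF tr, of h] h h1 \<open>0 < t\<close> by auto
    have c: "0 \<le> c1" "0 \<le> c2" using traj_nonneg t1 t2 by auto
    have lt': "c1 + c2 + f < w + h\<^sup>2" using lt by (simp add: f C)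
    have "c1 + c2 \<le> D" using lt' \<open>0 \<le> f\<close> \<open>h\<^sup>2 \<le> h * 1\<close> h h1 unfolding D_def by linarith
    have disp: "norm (y s - x) \<le> B" if "s \<in> {0..t}" for s
      using traj_displacement_le[OF tr _ _ _ _ K1, of 0 s] that \<open>0 \<le> K1\<close> \<open>c1 + c2 \<le> D\<close> by (auto simp: y0 B_def C)
    have pos: "norm (y s) \<le> R" if "s \<in> {0..t}" for s
      using disp[OF that] norm_triangle_sub[of "y s" x] R(1) by linarith
    define \<Delta> where "\<Delta> = norm (y h - x)"
    have \<Delta>_small: "\<Delta> \<le> t / 8"
    proof -
      have "\<Delta> \<le> \<eta> * c1 + K3 * (h - 0)"
        unfolding \<Delta>_def y0[symmetric] using h \<open>0 < \<eta>\<close> \<open>0 \<le> K3\<close> by (intro traj_displacement_le[OF t1 _ _ _ _ K3]) auto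
      also have "\<eta> * c1 \<le> \<eta> * D" using \<open>c1 + c2 \<le> D\<close> c \<open>0 < \<eta>\<close> by (intro mult_left_mono) auto
      also have "\<eta> * D = t / 16" using \<open>1 \<le> D\<close> by (simp add: \<eta>_def)
      also have "K3 * (h - 0) \<le> (K3 + 1) * (t / (16 * (K3 + 1)))" using h h1 \<open>0 \<le> K3\<close> by (intro mult_mono) auto
      also have "\<dots> = t / 16" using \<open>0 \<le> K3\<close> by (simp add: field_simps)
      finally show ?thesis by simp
    qed
    have c1_ge: "\<omega> * \<Delta> - \<omega> * K2 * h \<le> c1"
    proof -
      have "\<Delta> \<le> (1 / \<omega>) * c1 + K2 * (h - 0)"
        unfolding \<Delta>_def y0[symmetric] using h \<open>0 < \<omega>\<close> \<open>0 \<le> K2\<close> by (intro traj_displacement_le[OF t1 _ _ _ _ K2]) auto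
      then have "\<omega> * \<Delta> \<le> \<omega> * ((1 / \<omega>) * c1 + K2 * (h - 0))" using \<open>0 < \<omega>\<close> by (intro mult_left_mono) auto
      then show ?thesis using \<open>0 < \<omega>\<close> by (simp add: distrib_left)
    qed
    have \<Delta>_le: "\<Delta> \<le> (\<omega> * K2 + 1) * h"
    proof (cases "\<Delta> \<le> h")
      case True
      then show ?thesis using h \<open>0 \<le> K2\<close> \<open>0 < \<omega>\<close> by (simp add: distrib_right add_increasing)
    next
      case False
      define \<tau> where "\<tau> = \<Delta> - h"
      have \<tau>: "0 < \<tau>" "\<tau> \<le> (t - h) / 4" using False \<Delta>_small h h1 by (auto simp: \<tau>_def)
      have t2': "traj L 0 (t - h) (\<lambda>s. y (s + h)) (\<lambda>s. g (s + h)) c2"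
        using traj_shift[OF t2, of "- h"] by simp
      have "steer L (t - h - \<tau>) (y (0 + h)) (y (t - h + h)) (c2 + M * \<tau>)"
      proof (rule steer_save_time[OF t2' _ \<tau> _ _ M])
        have "integral {0..t - h} (\<lambda>s. norm (g (s + h))) \<le> 1 * c2 + K1 * (t - h - 0)"
          using h h1 by (intro traj_length_le[OF t2' _ _ K1]) auto
        also have "\<dots> \<le> B" using \<open>c1 + c2 \<le> D\<close> c \<open>0 \<le> K1\<close> h unfolding B_def by (intro add_mono mult_left_mono) auto
        finally show "integral {0..t - h} (\<lambda>s. norm (g (s + h))) \<le> B" .
        show "norm (y (s + h)) \<le> R" if "s \<in> {0..t - h}" for s using that h by (intro pos) auto
        have "4 * B / (t - h) \<le> 4 * B / (t / 2)"
          using h h1 \<open>0 \<le> B\<close> \<open>0 < t\<close> by (intro divide_left_mono) auto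
        then show "4 * B / (t - h) \<le> R" using R(2) by simp
      qed
      then have s2: "steer L (t - h - \<tau>) (y h) (y t) (c2 + M * \<tau>)" by simp
      have s1: "steer L \<Delta> x (y h) (M * \<Delta>)"
      proof (rule steer_between[OF M])
        show "norm x \<le> R" "norm (y h) \<le> R" using pos[of 0] pos[of h] h h1 \<open>0 < t\<close> by (auto simp: y0)
        have "1 * \<Delta> \<le> R * \<Delta>" using R(3) by (intro mult_right_mono) (auto simp: \<Delta>_def)
        then show "norm (y h - x) \<le> R * \<Delta>" by (simp add: \<Delta>_def)
        show "0 < \<Delta>" using False h by simp
      qed
      have "value_fun L \<phi> (t, x) \<le> ereal (M * \<Delta> + (c2 + M * \<tau>)) + \<phi> (y t)"
        using value_le[OF steer_trans[OF s1 s2]] by (simp add: \<tau>_def)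
      then have "w \<le> M * \<Delta> + (c2 + M * \<tau>) + f" by (simp add: w f)
      moreover have "M * \<tau> \<le> M * \<Delta>" using \<open>0 \<le> M\<close> h by (intro mult_left_mono) (auto simp: \<tau>_def)
      ultimately have "c1 < 2 * M * \<Delta> + h\<^sup>2" using lt' by linarith
      then have "\<Delta> \<le> \<omega> * K2 * h + h\<^sup>2" using c1_ge by (simp add: \<omega>_def algebra_simps)
      then show ?thesis using \<open>h\<^sup>2 \<le> h * 1\<close> by (simp add: distrib_right)
    qed
    define v where "v = (y h - x) /\<^sub>R h"
    have yh: "y h = x + h *\<^sub>R v" using h by (simp add: v_def)
    have "norm v = \<Delta> / h" using h by (simp add: v_def \<Delta>_def divide_inverse mult.commute)
    then have "norm v \<le> \<omega> * K2 + 1" using \<Delta>_le h by (simp add: pos_divide_le_eq)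
    moreover have "value_fun L \<phi> (t - h, x + h *\<^sub>R v) \<le> ereal (w + h\<^sup>2 - c1)"
    proof -
      have "h \<le> t" using h h1 \<open>0 < t\<close> by linarith
      from value_le[OF traj_imp_steer[OF t2 this order_refl]]
      have "value_fun L \<phi> (t - h, x + h *\<^sub>R v) \<le> ereal (c2 + f)" by (simp add: yh f)
      also have "\<dots> \<le> ereal (w + h\<^sup>2 - c1)" using lt' by simp
      finally show ?thesis .
    qed
    ultimately show "\<exists>y g C v. traj L 0 h y g C \<and> y 0 = x \<and> y h = x + h *\<^sub>R v \<and> norm v \<le> \<omega> * K2 + 1 \<and> C \<le> D \<and>
       value_fun L \<phi> (t - h, x + h *\<^sub>R v) \<le> ereal (w + h\<^sup>2 - C)"
      using t1 y0 yh c \<open>c1 + c2 \<le> D\<close> by (intro exI[of _ y] exI[of _ g] exI[of _ c1] exI[of _ v]) simp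
  qed
qed

text \<open>The direction \<open>u\<close> is an accumulation point of average velocities and is
  fixed before the level \<open>c\<close>. For each \<open>c\<close>, an affine minorant of
  \<open>L x\<close>, nearly valid around \<open>x\<close>, bounds the cost of the short initial
  pieces from below through their displacement alone.\<close>

lemma value_D_up_le:
  assumes "0 < t" and fin: "value_fun L \<phi> (t, x) < \<infinity>"
  shows "\<exists>u. D_up (value_fun L \<phi>) (t, x) (- 1, u) \<le> - ereal (L x u)"
proof -
  obtain w where w: "value_fun L \<phi> (t, x) = ereal w"
    using fin value_nonneg[of t x] by (cases "value_fun L \<phi> (t, x)") auto
  obtain h1 K D where h1: "0 < h1" "h1 \<le> t" and near: "\<And>h. 0 < h \<Longrightarrow> h < h1 \<Longrightarrow>
      \<exists>y g C v. traj L 0 h y g C \<and> y 0 = x \<and> y h = x + h *\<^sub>R v \<and> norm v \<le> K \<and> C \<le> D \<and>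
       value_fun L \<phi> (t - h, x + h *\<^sub>R v) \<le> ereal (w + h\<^sup>2 - C)"
    by (rule near_optimal_start[OF \<open>0 < t\<close> w]) (rule that)
  \<comment> \<open>The offset 2 makes \<open>h 0\<close> strictly smaller than
    \<open>h1\<close>.\<close>
  define h where "h k = h1 / real (k + 2)" for k :: nat
  have h: "0 < h k" "h k < h1" for k
    using h1 divide_strict_left_mono[of 1 "real (k + 2)" h1] unfolding h_def by auto
  have h_lim: "h \<longlonglongrightarrow> 0"
    unfolding h_def by (rule LIMSEQ_ignore_initial_segment[OF lim_const_over_n])
  obtain y g C v where tr: "\<And>k. traj L 0 (h k) (y k) (g k) (C k)" and y0: "\<And>k. y k 0 = x"
    and yh: "\<And>k. y k (h k) = x + h k *\<^sub>R v k" and v: "\<And>k. norm (v k) \<le> K" and C: "\<And>k. C k \<le> D"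
    and val: "\<And>k. value_fun L \<phi> (t - h k, x + h k *\<^sub>R v k) \<le> ereal (w + (h k)\<^sup>2 - C k)"
    using near[OF h] by metis
  obtain u r where r: "strict_mono r" and u: "(v \<circ> r) \<longlonglongrightarrow> u"
    using seq_compactE[OF compact_imp_seq_compact[OF compact_cball[of 0 K]], of v] v
    by (metis mem_cball_0)
  have hr: "(\<lambda>k. h (r k)) \<longlonglongrightarrow> 0" using LIMSEQ_subseq_LIMSEQ[OF h_lim r] by (simp add: o_def)
  have vr: "(\<lambda>k. v (r k)) \<longlonglongrightarrow> u" using u by (simp add: o_def)
  have "D_up (value_fun L \<phi>) (t, x) (- 1, u) \<le> - ereal (L x u)"
  proof (rule ereal_le_if_real_greater)
    fix c assume "- ereal (L x u) < ereal c"
    then have "- c < L x u" by simp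
    then obtain a p where m: "\<And>w. a + p \<bullet> w \<le> L x w" and ap: "- c < a + p \<bullet> u"
      using convex_on_affine_minorant[OF convex] by blast
    define \<eta> where "\<eta> = (a + p \<bullet> u + c) / 2"
    have "0 < \<eta>" using ap by (simp add: \<eta>_def)
    have "affine_minorant L 0 x a p" using m by (simp add: affine_minorant_def)
    from affine_minorant_enlarge[OF this \<open>0 < \<eta>\<close> order_refl]
    obtain \<delta> where "0 < \<delta>" and \<delta>: "affine_minorant L \<delta> x (a - \<eta>) p" by auto
    \<comment> \<open>The cost accounts for at most \<open>\<delta> / 2\<close> of the displacement;
      the other half is left for the part proportional to elapsed time.\<close>
    define \<rho> where "\<rho> = \<delta> / (2 * (\<bar>D\<bar> + 1))"
    have "0 < \<rho>" using \<open>0 < \<delta>\<close> by (simp add: \<rho>_def)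
    obtain K3 where "0 \<le> K3" and K3: "\<And>x u. norm u \<le> \<rho> * L x u + K3" using growth_bound[OF \<open>0 < \<rho>\<close>] by blast
    have "(\<lambda>k. K3 * h (r k)) \<longlonglongrightarrow> K3 * 0" by (intro tendsto_intros hr)
    then have ev1: "\<forall>\<^sub>F k in sequentially. K3 * h (r k) < \<delta> / 2"
      using \<open>0 < \<delta>\<close> by (intro order_tendstoD(2)) auto
    have "(\<lambda>k. h (r k) - (a - \<eta> + p \<bullet> v (r k))) \<longlonglongrightarrow> 0 - (a - \<eta> + p \<bullet> u)" by (intro tendsto_intros hr vr)
    moreover have "0 - (a - \<eta> + p \<bullet> u) < c" using ap by (simp add: \<eta>_def field_simps)
    ultimately have ev2: "\<forall>\<^sub>F k in sequentially. h (r k) - (a - \<eta> + p \<bullet> v (r k)) < c" by (rule order_tendstoD(2))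
    show "D_up (value_fun L \<phi>) (t, x) (- 1, u) \<le> ereal c"
    proof (rule D_up_leI[where W = "value_fun L \<phi>" and p = "(t, x)", OF w h(1) hr tendsto_Pair[OF tendsto_const vr]])
      show "\<forall>\<^sub>F k in sequentially. value_fun L \<phi> ((t, x) + h (r k) *\<^sub>R (- 1, v (r k))) \<le> ereal (w + h (r k) * c)"
        using ev1 ev2
      proof eventually_elim
        case (elim k)
        let ?h = "h (r k)"
        have near_x: "y (r k) s \<in> cball x \<delta>" if s: "s \<in> {0..?h}" for s
        proof -
          have "norm (y (r k) s - y (r k) 0) \<le> \<rho> * C (r k) + K3 * (?h - 0)"
            using s \<open>0 < \<rho>\<close> \<open>0 \<le> K3\<close> by (intro traj_displacement_le[OF tr _ _ _ _ K3]) auto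
          also have "\<rho> * C (r k) \<le> \<rho> * (\<bar>D\<bar> + 1)" using C[of "r k"] \<open>0 < \<rho>\<close> by (intro mult_left_mono) auto
          also have "\<dots> = \<delta> / 2"
          proof -
            have "\<delta> / (2 * d) * d = \<delta> / 2" if "0 < d" for d using that by simp
            from this[of "\<bar>D\<bar> + 1"] show ?thesis by (simp add: \<rho>_def)
          qed
          finally show ?thesis using elim(1) by (simp add: y0 dist_norm norm_minus_commute)
        qed
        have "(?h - 0) * (a - \<eta>) + p \<bullet> (y (r k) ?h - y (r k) 0) \<le> C (r k)"
          using h(1)[of "r k"] near_x \<delta> by (intro traj_affine_lower_bound[OF tr]) (auto simp: affine_minorant_def)
        then have Cge: "?h * (a - \<eta> + p \<bullet> v (r k)) \<le> C (r k)" by (simp add: y0 yh algebra_simps)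
        have "value_fun L \<phi> ((t, x) + ?h *\<^sub>R (- 1, v (r k))) \<le> ereal (w + ?h\<^sup>2 - C (r k))"
          using val[of "r k"] by simp
        also have "\<dots> \<le> ereal (w + ?h * c)"
        proof -
          have "?h * (?h - (a - \<eta> + p \<bullet> v (r k))) \<le> ?h * c" using elim(2) h(1)[of "r k"] by (intro mult_left_mono) auto
          then show ?thesis using Cge by (simp add: power2_eq_square algebra_simps)
        qed
        finally show ?case .
      qed
    qed
  qed
  then show ?thesis by blast
qed

end

subsection \<open>Subsolutions\<close>

text \<open>Absolute continuity of the integral by truncation: the part of \<open>f\<close> above a
  high level \<open>k\<close> has a small integral, and the part below contributes at most
  \<open>k\<close> times the measure of \<open>U\<close> in the interval, which outer regularity
  makes small.\<close>

lemma negligible_open_cover_small_integral: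
  fixes f :: "real \<Rightarrow> real"
  assumes f: "f integrable_on {a..b}" "\<And>s. s \<in> {a..b} \<Longrightarrow> 0 \<le> f s" and "negligible N" "0 < \<eta>"
  obtains U where "open U" "N \<subseteq> U" "(\<lambda>s. if s \<in> U then f s else 0) integrable_on {a..b}"
    "integral {a..b} (\<lambda>s. if s \<in> U then f s else 0) < \<eta>"
proof -
  have fa: "f absolutely_integrable_on {a..b}" using f by (rule nonnegative_absolutely_integrable_1)
  have restrict: "(\<lambda>s. if s \<in> U then f s else 0) integrable_on {a..b}" if "open U" for U
  proof -
    have "f absolutely_integrable_on (U \<inter> {a..b})"
      by (rule set_integrable_subset[OF fa]) (use that in auto)
    then have "f integrable_on (U \<inter> {a..b})" by (simp add: absolutely_integrable_on_def)
    then show ?thesis unfolding integrable_on_def has_integral_restrict_Int .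
  qed
  have exc: "(\<lambda>s. max 0 (f s - real k)) integrable_on {a..b}" for k
  proof -
    have "(\<lambda>s. f s - real k) absolutely_integrable_on {a..b}"
      using set_integral_diff(1)[OF fa absolutely_integrable_continuous_real[OF continuous_on_const]] .
    from absolutely_integrable_max_1[OF absolutely_integrable_zero this] show ?thesis
      by (simp add: absolutely_integrable_on_def)
  qed
  have "(\<lambda>k. integral {a..b} (\<lambda>s. max 0 (f s - real k))) \<longlonglongrightarrow> integral {a..b} (\<lambda>s. 0)"
  proof (rule dominated_convergence(2)[OF exc f(1)])
    fix s assume s: "s \<in> {a..b}"
    show "norm (max 0 (f s - real k)) \<le> f s" for k using f(2)[OF s] by simp
    have "\<forall>\<^sub>F k in sequentially. f s \<le> real k"
      using filterlim_real_sequentially by (auto simp: filterlim_at_top)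
    then have "\<forall>\<^sub>F k in sequentially. max 0 (f s - real k) = 0" by eventually_elim simp
    then show "(\<lambda>k. max 0 (f s - real k)) \<longlonglongrightarrow> 0" by (rule tendsto_eventually)
  qed
  then have "(\<lambda>k. integral {a..b} (\<lambda>s. max 0 (f s - real k))) \<longlonglongrightarrow> 0" by simp
  then have "\<forall>\<^sub>F k in sequentially. integral {a..b} (\<lambda>s. max 0 (f s - real k)) < \<eta> / 2"
    using \<open>0 < \<eta>\<close> by (intro order_tendstoD(2)) auto
  then obtain k where k: "integral {a..b} (\<lambda>s. max 0 (f s - real k)) < \<eta> / 2"
    by (auto simp: eventually_sequentially)
  define e where "e = \<eta> / (2 * (real k + 1))"
  have "0 < e" using \<open>0 < \<eta>\<close> by (simp add: e_def)
  obtain U where U: "open U" "N \<subseteq> U" "U - N \<in> lmeasurable" "emeasure lebesgue (U - N) < ennreal e"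
    using sets_lebesgue_outer_open[OF negligible_imp_sets[OF \<open>negligible N\<close>] \<open>0 < e\<close>] by blast
  define A where "A = U \<inter> {a..b}"
  have A: "A \<in> lmeasurable" unfolding A_def using U(1) by (intro bounded_set_imp_lmeasurable bounded_Int) auto
  have "measure lebesgue A \<le> measure lebesgue (U - N)"
  proof -
    have "measure lebesgue A = measure lebesgue (A - N)"
      using \<open>negligible N\<close> A by (simp add: measure_Diff_null_set negligible_iff_null_sets fmeasurableD)
    also have "\<dots> \<le> measure lebesgue (U - N)"
      using \<open>negligible N\<close> A U(3) by (intro measure_mono_fmeasurable) (auto simp: A_def negligible_imp_sets fmeasurableD sets.Diff)
    finally show ?thesis .
  qed
  also have "\<dots> < e"
    using U(3,4) \<open>0 < e\<close> by (simp add: emeasure_eq_measure2 ennreal_less_iff)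
  finally have mA: "measure lebesgue A < e" .
  have iA: "((\<lambda>s. if s \<in> U then real k else 0) has_integral (real k * measure lebesgue A)) {a..b}"
  proof -
    have "((\<lambda>s. 1) has_integral measure lebesgue A) A" using A by (simp add: lmeasure_integral integrable_on_const integrable_integral)
    from has_integral_mult_right[OF this, of "real k"] show ?thesis
      by (simp add: has_integral_restrict_Int A_def)
  qed
  show thesis
  proof (rule that[OF U(1,2) restrict[OF U(1)]])
    have "integral {a..b} (\<lambda>s. if s \<in> U then f s else 0)
      \<le> integral {a..b} (\<lambda>s. (if s \<in> U then real k else 0) + max 0 (f s - real k))"
      by (intro integral_le restrict U Henstock_Kurzweil_Integration.integrable_add exc has_integral_integrable[OF iA]) auto
    also have "\<dots> = real k * measure lebesgue A + integral {a..b} (\<lambda>s. max 0 (f s - real k))"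
      by (subst Henstock_Kurzweil_Integration.integral_add[OF has_integral_integrable[OF iA] exc])
        (simp add: integral_unique[OF iA])
    also have "\<dots> < \<eta> / 2 + \<eta> / 2"
    proof (rule add_le_less_mono[OF _ k])
      have "real k * measure lebesgue A \<le> (real k + 1) * e" using mA by (intro mult_mono) auto
      also have "\<dots> = \<eta> / 2"
      proof -
        have "d * (\<eta> / (2 * d)) = \<eta> / 2" if "0 < d" for d using that by simp
        from this[of "real k + 1"] show ?thesis by (simp add: e_def)
      qed
      finally show "real k * measure lebesgue A \<le> \<eta> / 2" .
    qed
    finally show "integral {a..b} (\<lambda>s. if s \<in> U then f s else 0) < \<eta>" by simp
  qed
qed

text \<open>A one-sided form of Lebesgue differentiation. Both the velocity and the running cost are
  treated this way, and only forward steps occur.\<close>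

lemma ae_right_derivative_integral:
  fixes f :: "real \<Rightarrow> 'a::euclidean_space"
  assumes f: "f integrable_on {a..b}"
  obtains N where "negligible N"
    "\<And>s. s \<in> {a..<b} - N \<Longrightarrow> ((\<lambda>h. integral {s..s + h} f /\<^sub>R h) \<longlongrightarrow> f s) (at_right 0)"
proof -
  define F where "F s = (if s \<in> {a..b} then f s else 0)" for s
  have "F integrable_on UNIV" using f unfolding F_def integrable_restrict_UNIV .
  then have "F integrable_on cbox p q" for p q :: real by (rule integrable_on_subcbox) auto
  then obtain N where N: "negligible N" "\<And>x e. \<lbrakk>x \<notin> N; 0 < e\<rbrakk> \<Longrightarrow>
      \<exists>d>0. \<forall>h. 0 < h \<and> h < d \<longrightarrow> norm (integral (cbox x (x + h *\<^sub>R One)) F /\<^sub>R h ^ DIM(real) - F x) < e"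
    using integrable_ccontinuous_explicit[of F] by blast
  show thesis
  proof (rule that[OF N(1)])
    fix s assume s: "s \<in> {a..<b} - N"
    show "((\<lambda>h. integral {s..s + h} f /\<^sub>R h) \<longlongrightarrow> f s) (at_right 0)"
    proof (rule tendstoI)
      fix e :: real assume "0 < e"
      obtain d where "d > 0" and d: "\<And>h. 0 < h \<Longrightarrow> h < d \<Longrightarrow> norm (integral {s..s + h} F /\<^sub>R h - F s) < e"
        using N(2)[of s e] s \<open>0 < e\<close> by auto
      have "\<forall>\<^sub>F h in at_right 0. h < min d (b - s)"
        using \<open>d > 0\<close> s by (intro eventually_at_right_0_less) simp
      then show "\<forall>\<^sub>F h in at_right 0. dist (integral {s..s + h} f /\<^sub>R h) (f s) < e"
        using eventually_at_right_less[of "0::real"]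
      proof eventually_elim
        case (elim h)
        have "integral {s..s + h} F = integral {s..s + h} f"
          by (rule integral_cong) (use s elim in \<open>auto simp: F_def\<close>)
        then show ?case using d[of h] elim s by (simp add: dist_norm F_def)
      qed
    qed
  qed
qed

lemma has_integral_reverse:
  fixes f :: "real \<Rightarrow> 'a::banach"
  shows "((\<lambda>s. f (t - s)) has_integral I) {a..b} \<longleftrightarrow> (f has_integral I) {t - b..t - a}"
proof -
  have "((\<lambda>s. f (t + - s)) has_integral I) {- (- a)..- (- b)} \<longleftrightarrow> ((\<lambda>s. f (t + s)) has_integral I) {- b..- a}"
    using has_integral_reflect_real[of "\<lambda>s. f (t + s)" I "- a" "- b"] by simp
  also have "\<dots> \<longleftrightarrow> (f has_integral I) {t - b..t - a}"
    using has_integral_shift_Icc_real[of f t I "- b" "- a"] by (simp add: o_def)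
  finally show ?thesis by simp
qed

section \<open>Comparison under condition (b)\<close>

context bolza
begin

lemma Lplus_le_bound:
  assumes M: "\<And>x u. norm x \<le> R \<Longrightarrow> norm u \<le> R \<Longrightarrow> L x u \<le> M" and "norm x + 1 \<le> R" "norm u \<le> 1"
  shows "Lplus L x u \<le> ereal M"
proof (rule Lplus_leI)
  have "\<forall>\<^sub>F h in at_right (0::real). h < 1" by (rule eventually_at_right_0_less) simp
  then show "\<forall>\<^sub>F h in at_right 0. steer L h (x - h *\<^sub>R u) x (h * M)"
    using eventually_at_right_less[of "0::real"]
  proof eventually_elim
    case (elim h)
    have "norm (x - h *\<^sub>R u) \<le> norm x + h * norm u" using norm_triangle_ineq4[of x "h *\<^sub>R u"] elim by simp
    also have "h * norm u \<le> 1 * 1" using elim assms by (intro mult_mono) auto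
    finally have "norm (x - h *\<^sub>R u) \<le> R" using assms by simp
    moreover have "norm u \<le> R" using assms norm_ge_zero[of x] by linarith
    ultimately have "steer L h (x - h *\<^sub>R u) x (M * h)"
      using assms elim by (intro steer_between[OF M]) (auto simp: mult_right_mono mult.commute)
    then show ?case by (simp add: mult.commute)
  qed
qed

text \<open>At speed at most 1 the function \<open>Lplus\<close> is bounded by \<open>M\<close>,
  whatever the direction, so \<open>W\<close> grows at a rate below any \<open>c > M\<close> along
  the segment. No regularity of the path to be followed is involved, which makes this usable at bad
  times.\<close>

lemma cond_b_segment:
  assumes W: "nonneg_lsc_with_initial \<phi> W" and b: "cond_b L W"
    and M: "\<And>x u. norm x \<le> R \<Longrightarrow> norm u \<le> R \<Longrightarrow> L x u \<le> M" and "M < c"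
    and "0 \<le> T" "0 < h" "norm z + 1 \<le> R" "norm z' + 1 \<le> R" "norm (z' - z) \<le> h"
    and le: "W (T, z) \<le> ereal w"
  shows "W (T + h, z') \<le> ereal (w + c * h)"
proof -
  have lsc: "lsc_on ({0..} \<times> UNIV) W" and nn: "\<And>s z. 0 \<le> s \<Longrightarrow> 0 \<le> W (s, z)"
    using W by (auto simp: nonneg_lsc_with_initial_def)
  define u where "u = (z' - z) /\<^sub>R h"
  have u: "norm (- u) \<le> 1" using assms(6,9) by (simp add: u_def divide_inverse[symmetric] pos_divide_le_eq mult.commute[of "inverse h"])
  have z': "z' = z + h *\<^sub>R u" using \<open>0 < h\<close> by (simp add: u_def)
  have "W (T + h, z + h *\<^sub>R u) \<le> ereal (w + c * h)"
  proof (rule interval_induct_closed[where P = "\<lambda>\<tau>. W (T + \<tau>, z + \<tau> *\<^sub>R u) \<le> ereal (w + c * \<tau>)", of 0 h])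
    fix s l assume s: "\<And>n. s n \<in> {0..h}" "\<And>n. W (T + s n, z + s n *\<^sub>R u) \<le> ereal (w + c * s n)"
      and lim: "s \<longlonglongrightarrow> l" and "l \<in> {0..h}"
    show "W (T + l, z + l *\<^sub>R u) \<le> ereal (w + c * l)"
    proof (rule lsc_on_limit_le[OF lsc, where X = "\<lambda>n. (T + s n, z + s n *\<^sub>R u)"])
      show "(\<lambda>n. (T + s n, z + s n *\<^sub>R u)) \<longlonglongrightarrow> (T + l, z + l *\<^sub>R u)" "(\<lambda>n. w + c * s n) \<longlonglongrightarrow> w + c * l"
        by (intro tendsto_intros lim)+
    qed (use s \<open>l \<in> {0..h}\<close> \<open>0 \<le> T\<close> in auto)
  next
    fix m assume m: "0 \<le> m" "m < h" and Pm: "W (T + m, z + m *\<^sub>R u) \<le> ereal (w + c * m)"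
    have Tm: "0 \<le> T + m" using m \<open>0 \<le> T\<close> by simp
    obtain w' where w': "W (T + m, z + m *\<^sub>R u) = ereal w'"
      using Pm nn[OF Tm, of "z + m *\<^sub>R u"] by (cases "W (T + m, z + m *\<^sub>R u)") auto
    have "z + m *\<^sub>R u = (1 - m / h) *\<^sub>R z + (m / h) *\<^sub>R z'" using \<open>0 < h\<close> by (simp add: z' algebra_simps)
    moreover have "\<dots> \<in> cball 0 (R - 1)"
      using assms m by (intro convexD_alt[OF convex_cball]) auto
    ultimately have pos: "norm (z + m *\<^sub>R u) + 1 \<le> R" by simp
    have "D_down W (T + m, z + m *\<^sub>R u) (1, - v) \<le> Lplus L (z + m *\<^sub>R u) v" for v
      using b Tm w' by (simp add: cond_b_def)
    from this[of "- u"] have "D_down W (T + m, z + m *\<^sub>R u) (1, u) \<le> Lplus L (z + m *\<^sub>R u) (- u)"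
      by (simp only: minus_minus)
    also have "\<dots> \<le> ereal M" by (rule Lplus_le_bound[OF M pos u])
    also have "\<dots> < ereal c" using \<open>M < c\<close> by simp
    finally have "D_down W (T + m, z + m *\<^sub>R u) (1, u) < ereal c" by simp
    from D_down_along[where W = W, OF this w' tendsto_const]
    have "\<forall>\<^sub>F k in at_right 0. W ((T + m, z + m *\<^sub>R u) + k *\<^sub>R (1, u)) < ereal (w' + k * c)" .
    moreover have "\<forall>\<^sub>F k in at_right 0. k < h - m" using m by (intro eventually_at_right_0_less) simp
    ultimately have "\<forall>\<^sub>F k in at_right 0. W ((T + m, z + m *\<^sub>R u) + k *\<^sub>R (1, u)) < ereal (w' + k * c) \<and> k < h - m \<and> 0 < k"
      using eventually_at_right_less[of "0::real"] by eventually_elim auto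
    then obtain k where k: "W ((T + m, z + m *\<^sub>R u) + k *\<^sub>R (1, u)) < ereal (w' + k * c)" "k < h - m" "0 < k"
      using eventually_happens trivial_limit_at_right_real by (metis (no_types, lifting))
    have eq: "(T + m, z + m *\<^sub>R u) + k *\<^sub>R (1, u) = (T + (m + k), z + (m + k) *\<^sub>R u)"
      by (simp add: algebra_simps)
    have "w' + k * c \<le> w + c * (m + k)" using Pm by (simp add: w' algebra_simps)
    then have "W (T + (m + k), z + (m + k) *\<^sub>R u) \<le> ereal (w + c * (m + k))"
      using k(1) unfolding eq by (meson ereal_less_eq(3) less_imp_le order_trans)
    then show "\<exists>m'>m. m' \<le> h \<and> W (T + m', z + m' *\<^sub>R u) \<le> ereal (w + c * m')"
      using k by (intro exI[of _ "m + k"]) auto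
  qed (use le \<open>0 < h\<close> in auto)
  then show ?thesis by (simp add: z')
qed

text \<open>Along the reversed trajectory \<open>z\<close> the estimate is propagated from \<open>(0, z 0)\<close>. Where \<open>z\<close> is not
  differentiable, or the running cost has no Lebesgue point, \<open>z\<close> is followed at speed at most 1, which
  takes too long; the excess is controlled by the integral of \<open>1 + norm z'\<close> over a small open set,
  and lower semicontinuity of \<open>W\<close> absorbs the resulting excess \<open>T - t\<close> in the limit.\<close>

theorem value_ge_of_cond_b:
  assumes W: "nonneg_lsc_with_initial \<phi> W" and b: "cond_b L W" and "0 \<le> t"
  shows "W (t, x) \<le> value_fun L \<phi> (t, x)"
proof (rule ereal_le_if_real_greater)
  have lsc: "lsc_on ({0..} \<times> UNIV) W" and nn: "\<And>s z. 0 \<le> s \<Longrightarrow> 0 \<le> W (s, z)" and init: "\<And>z. W (0, z) = \<phi> z"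
    using W by (auto simp: nonneg_lsc_with_initial_def)
  fix c assume "value_fun L \<phi> (t, x) < ereal c"
  then obtain y g C where tr: "traj L 0 t y g C" and y0: "y 0 = x" and lt: "ereal C + \<phi> (y t) < ereal c"
    using value_lessE \<open>0 \<le> t\<close> by blast
  obtain f where f: "\<phi> (y t) = ereal f" using lt phi_nonneg[of "y t"] by (cases "\<phi> (y t)") auto
  have A: "AC_on 0 t y g" and Li: "((\<lambda>s. L (y s) (g s)) has_integral C) {0..t}" using tr by (auto simp: traj_def)
  define z where "z s = y (t - s)" for s
  define k where "k s = - g (t - s)" for s
  \<comment> \<open>Reversal flips the velocity, and the original path moves with velocity
    \<open>- k\<close>.\<close>
  define rc where "rc s = L (z s) (- k s)" for s
  have k_int: "(k has_integral (z s' - z s)) {s..s'}" if "0 \<le> s" "s \<le> s'" "s' \<le> t" for s s'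
  proof -
    have "(g has_integral (y (t - s) - y (t - s'))) {t - s'..t - s}"
      by (rule AC_on_increment[OF A]) (use that in auto)
    then have "((\<lambda>\<sigma>. g (t - \<sigma>)) has_integral (y (t - s) - y (t - s'))) {s..s'}"
      by (simp only: has_integral_reverse)
    from has_integral_neg[OF this] show ?thesis by (simp add: k_def[abs_def] z_def)
  qed
  have rc_int: "(rc has_integral C) {0..t}"
    using Li has_integral_reverse[of "\<lambda>s. L (y s) (g s)" t C 0 t] by (simp add: rc_def[abs_def] z_def k_def)
  have sub: "F integrable_on {s..s'}" if "F integrable_on {0..t}" "0 \<le> s" "s' \<le> t" for F :: "real \<Rightarrow> 'z::banach" and s s'
    by (rule integrable_subinterval_real[OF that(1)]) (use that in auto)
  have split: "integral {0..s'} F = integral {0..s} F + integral {s..s'} F"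
    if "F integrable_on {0..t}" "0 \<le> s" "s \<le> s'" "s' \<le> t" for F :: "real \<Rightarrow> real" and s s'
    using Henstock_Kurzweil_Integration.integral_combine[OF that(2,3) sub[OF that(1)]] that by simp
  define A' where "A' s = integral {0..s} rc" for s
  have rc_i: "rc integrable_on {0..t}" using rc_int by (rule has_integral_integrable)
  have st: "steer L (s' - s) (z s') (z s) (integral {s..s'} rc)" if "0 \<le> s" "s \<le> s'" "s' \<le> t" for s s'
  proof -
    have "(rc has_integral (integral {s..s'} rc)) {s..s'}" using sub[OF rc_i] that by (simp add: integrable_integral)
    then have "((\<lambda>s. L (y s) (g s)) has_integral (integral {s..s'} rc)) {t - s'..t - s}"
      using has_integral_reverse[of "\<lambda>s. L (y s) (g s)" t _ s s'] by (simp add: rc_def[abs_def] z_def k_def)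
    then have "traj L (t - s') (t - s) y g (integral {s..s'} rc)"
      using AC_on_subinterval[OF A, of "t - s'" "t - s"] that by (simp add: traj_def)
    from traj_imp_steer[OF this _ order_refl] that show ?thesis by (simp add: z_def)
  qed
  have z_cont: "continuous_on {0..t} z"
    unfolding z_def by (rule continuous_on_compose2[OF AC_on_continuous[OF A]]) (auto intro!: continuous_intros)
  obtain R0 where "\<forall>s\<in>{0..t}. norm (z s) \<le> R0"
    using compact_imp_bounded[OF compact_continuous_image[OF z_cont compact_Icc]] unfolding bounded_iff by blast
  then have R0: "norm (z s) \<le> R0" if "s \<in> {0..t}" for s using that by blast
  define R where "R = R0 + 1"
  have R: "norm (z s) + 1 \<le> R" if "s \<in> {0..t}" for s using R0[OF that] by (simp add: R_def)
  obtain M where "0 \<le> M" and M: "\<And>x u. norm x \<le> R \<Longrightarrow> norm u \<le> R \<Longrightarrow> L x u \<le> M" using L_bound[of R] by blast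
  \<comment> \<open>The integral of \<open>F\<close> over an interval dominates both its length and
    the displacement of \<open>z\<close> on it.\<close>
  define F where "F s = 1 + norm (k s)" for s
  have F_i: "F integrable_on {0..t}"
  proof -
    have "((\<lambda>s. norm (g s)) has_integral integral {0..t} (\<lambda>s. norm (g s))) {0..t}"
      using AC_on_norm_integrable[OF A, of 0 t] by (simp add: integrable_integral)
    then have "((\<lambda>s. norm (k s)) has_integral integral {0..t} (\<lambda>s. norm (g s))) {0..t}"
      using has_integral_reverse[of "\<lambda>s. norm (g s)" t _ 0 t] by (simp add: k_def)
    from has_integral_add[OF has_integral_const_real[of 1 0 t] this] show ?thesis
      unfolding F_def by (rule has_integral_integrable)
  qed
  obtain N1 where N1: "negligible N1"
    "\<And>s. s \<in> {0..<t} - N1 \<Longrightarrow> ((\<lambda>h. integral {s..s + h} k /\<^sub>R h) \<longlongrightarrow> k s) (at_right 0)"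
    using ae_right_derivative_integral[OF has_integral_integrable[OF k_int[OF order_refl \<open>0 \<le> t\<close> order_refl]]] by blast
  obtain N2 where N2: "negligible N2"
    "\<And>s. s \<in> {0..<t} - N2 \<Longrightarrow> ((\<lambda>h. integral {s..s + h} rc /\<^sub>R h) \<longlongrightarrow> rc s) (at_right 0)"
    using ae_right_derivative_integral[OF rc_i] by blast
  have approx: "\<exists>T. t \<le> T \<and> T \<le> t + \<eta> \<and> W (T, x) \<le> ereal (f + C + \<eta> * t + (M + 1) * \<eta>)" if "0 < \<eta>" for \<eta>
  proof -
    obtain U where U: "open U" "N1 \<union> N2 \<subseteq> U" and FU_i: "(\<lambda>s. if s \<in> U then F s else 0) integrable_on {0..t}"
      and small: "integral {0..t} (\<lambda>s. if s \<in> U then F s else 0) < \<eta>"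
    proof (rule negligible_open_cover_small_integral[OF F_i])
      show "0 \<le> F s" for s by (simp add: F_def)
      show "negligible (N1 \<union> N2)" using N1 N2 by simp
    qed (use \<open>0 < \<eta>\<close> in auto)
    define FU where "FU s = (if s \<in> U then F s else 0)" for s
    have FU: "FU integrable_on {0..t}" "\<And>s. 0 \<le> FU s" "integral {0..t} FU < \<eta>"
      using FU_i small unfolding FU_def by (auto simp: F_def)
    define \<omega> where "\<omega> s = integral {0..s} FU" for s
    have \<omega>_incr: "0 \<le> integral {s..s'} FU" if "0 \<le> s" "s' \<le> t" for s s'
      using FU sub[OF FU(1) that] by (intro Henstock_Kurzweil_Integration.integral_nonneg) auto
    have \<omega>_cont: "continuous_on {0..t} \<omega>" and A'_cont: "continuous_on {0..t} A'"
      unfolding \<omega>_def A'_def by (intro indefinite_integral_continuous_1 FU(1) rc_i)+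
    have \<omega>_nonneg: "0 \<le> \<omega> s" if "s \<in> {0..t}" for s unfolding \<omega>_def using that by (intro \<omega>_incr) auto
    have \<omega>_le: "\<omega> s \<le> \<eta>" if "s \<in> {0..t}" for s
      using split[OF FU(1), of s t] \<omega>_incr[of s t] FU(3) that unfolding \<omega>_def by simp
    \<comment> \<open>The budget consists of the initial value \<open>f\<close>, the cost
      \<open>A'\<close> of the path, a rate \<open>\<eta>\<close> for errors at regular times, and
      the rate \<open>M + 1 > M\<close> for the time spent in \<open>U\<close>. The delay
      \<open>T - s\<close> itself is bounded by \<open>\<omega> s\<close>.\<close>
    let ?B = "\<lambda>s. f + A' s + \<eta> * s + (M + 1) * \<omega> s"
    have "\<exists>T. t \<le> T \<and> T \<le> t + \<omega> t \<and> W (T, z t) \<le> ereal (?B t)"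
    proof (rule interval_induct_closed[where P = "\<lambda>s. \<exists>T. s \<le> T \<and> T \<le> s + \<omega> s \<and> W (T, z s) \<le> ereal (?B s)", OF \<open>0 \<le> t\<close>])
      show "\<exists>T\<ge>0. T \<le> 0 + \<omega> 0 \<and> W (T, z 0) \<le> ereal (?B 0)"
        by (intro exI[of _ 0]) (simp add: init z_def f A'_def \<omega>_def)
    next
      fix s l assume s: "\<And>n. s n \<in> {0..t}" and P: "\<And>n. \<exists>T\<ge>s n. T \<le> s n + \<omega> (s n) \<and> W (T, z (s n)) \<le> ereal (?B (s n))"
        and lim: "s \<longlonglongrightarrow> l" and l: "l \<in> {0..t}"
      obtain T where T: "\<And>n. s n \<le> T n" "\<And>n. T n \<le> s n + \<omega> (s n)" "\<And>n. W (T n, z (s n)) \<le> ereal (?B (s n))"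
        using P by metis
      have "T n \<in> {0..t + \<eta>}" for n using T(1,2)[of n] s[of n] \<omega>_le[OF s, of n] by simp
      \<comment> \<open>The delayed times need not converge. An accumulation point will do, as the
        induction hypothesis only asks for some \<open>T\<close>.\<close>
      then obtain T' r where r: "strict_mono r" and T': "(T \<circ> r) \<longlonglongrightarrow> T'"
        using seq_compactE[OF compact_imp_seq_compact[OF compact_Icc], of T 0 "t + \<eta>"] by blast
      have sr: "(\<lambda>n. s (r n)) \<longlonglongrightarrow> l" using LIMSEQ_subseq_LIMSEQ[OF lim r] by (simp add: o_def)
      have Tr: "(\<lambda>n. T (r n)) \<longlonglongrightarrow> T'" using T' by (simp add: o_def)
      have along: "(\<lambda>n. G (s (r n))) \<longlonglongrightarrow> G l" if "continuous_on {0..t} G" for G :: "real \<Rightarrow> 'z::topological_space"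
        by (rule continuous_on_tendsto_compose[OF that sr l]) (intro always_eventually allI s)
      have "l \<le> T'" using sr Tr T(1) by (intro LIMSEQ_le[OF sr Tr]) auto
      moreover have "T' \<le> l + \<omega> l"
        using T(2) by (intro LIMSEQ_le[OF Tr tendsto_add[OF sr along[OF \<omega>_cont]]]) auto
      moreover have "W (T', z l) \<le> ereal (?B l)"
      proof (rule lsc_on_limit_le[OF lsc, where X = "\<lambda>n. (T (r n), z (s (r n)))"])
        show "(\<lambda>n. (T (r n), z (s (r n)))) \<longlonglongrightarrow> (T', z l)" by (intro tendsto_Pair Tr along[OF z_cont])
        show "(\<lambda>n. ?B (s (r n))) \<longlonglongrightarrow> ?B l" by (intro tendsto_intros sr along[OF A'_cont] along[OF \<omega>_cont])
        show "(T (r n), z (s (r n))) \<in> {0..} \<times> UNIV" for n using T(1)[of "r n"] s[of "r n"] by simp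
        show "(T', z l) \<in> {0..} \<times> UNIV" using \<open>l \<le> T'\<close> l by simp
      qed (rule T(3))
      ultimately show "\<exists>T\<ge>l. T \<le> l + \<omega> l \<and> W (T, z l) \<le> ereal (?B l)" by blast
    next
      fix s assume s: "0 \<le> s" "s < t" and "\<exists>T\<ge>s. T \<le> s + \<omega> s \<and> W (T, z s) \<le> ereal (?B s)"
      then obtain T where T: "s \<le> T" "T \<le> s + \<omega> s" and WT: "W (T, z s) \<le> ereal (?B s)" by blast
      have A'_split: "A' (s + h) = A' s + integral {s..s + h} rc"
        and \<omega>_split: "\<omega> (s + h) = \<omega> s + integral {s..s + h} FU" if "0 \<le> h" "s + h \<le> t" for h
        unfolding A'_def \<omega>_def using split[OF rc_i, of s "s + h"] split[OF FU(1), of s "s + h"] s that by auto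
      have "\<exists>h>0. s + h \<le> t \<and> (\<exists>T. s + h \<le> T \<and> T \<le> s + h + \<omega> (s + h) \<and> W (T, z (s + h)) \<le> ereal (?B (s + h)))"
      proof (cases "s \<in> U")
        case True
        then obtain d where "d > 0" and d: "ball s d \<subseteq> U" using U(1) open_contains_ball by blast
        define h where "h = min (d / 2) (t - s)"
        have h: "0 < h" "s + h \<le> t" "h < d" using \<open>d > 0\<close> s by (auto simp: h_def)
        have inU: "r \<in> U" if "r \<in> {s..s + h}" for r
          by (rule subsetD[OF d]) (use that h in \<open>auto simp: dist_real_def\<close>)
        \<comment> \<open>Taking time \<open>h'\<close> instead of \<open>h\<close> brings the speed
          down to at most 1 and lets the delay grow by no more than the increment of
          \<open>\<omega>\<close>.\<close>
        define h' where "h' = integral {s..s + h} FU"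
        have ki: "k integrable_on {s..s + h}" using k_int[of s "s + h"] s h by (auto simp: has_integral_integrable)
        have ni: "(\<lambda>r. F r) integrable_on {s..s + h}" using sub[OF F_i] s h by simp
        have eqF: "h' = integral {s..s + h} F"
          unfolding h'_def by (rule integral_cong) (use inU in \<open>simp add: FU_def\<close>)
        have "norm (integral {s..s + h} k) \<le> h'"
          unfolding eqF by (rule integral_norm_bound_integral[OF ki ni]) (simp add: F_def)
        then have disp: "norm (z (s + h) - z s) \<le> h'"
          using integral_unique[OF k_int[of s "s + h"]] s h by simp
        have "integral {s..s + h} (\<lambda>_. 1) \<le> h'"
          unfolding eqF by (rule integral_le[OF _ ni]) (auto simp: F_def)
        then have "h \<le> h'" using h by simp
        have "W (T + h', z (s + h)) \<le> ereal (?B s + (M + 1) * h')"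
          by (rule cond_b_segment[OF W b M _ _ _ _ _ disp WT]) (use T s h \<open>h \<le> h'\<close> in \<open>auto intro: R\<close>)
        also have "?B s + (M + 1) * h' \<le> ?B (s + h)"
        proof -
          have "0 \<le> integral {s..s + h} rc"
            using sub[OF rc_i] s h by (intro Henstock_Kurzweil_Integration.integral_nonneg) (auto simp: rc_def nonneg)
          moreover have "0 \<le> \<eta> * h" using \<open>0 < \<eta>\<close> h by simp
          ultimately show ?thesis using A'_split \<omega>_split h by (simp add: h'_def algebra_simps)
        qed
        finally have "W (T + h', z (s + h)) \<le> ereal (?B (s + h))" by simp
        moreover have "T + h' \<le> s + h + \<omega> (s + h)" "s + h \<le> T + h'"
          using T \<omega>_split h \<open>h \<le> h'\<close> by (auto simp: h'_def)
        ultimately show ?thesis using h by blast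
      next
        case False
        then have "s \<in> {0..<t} - N1" "s \<in> {0..<t} - N2" using U(2) s by auto
        note lim_k = N1(2)[OF this(1)] and lim_rc = N2(2)[OF this(2)]
        have evt: "\<forall>\<^sub>F h in at_right 0. h < t - s" using s by (intro eventually_at_right_0_less) simp
        have vel: "((\<lambda>h. (z (s + h) - z s) /\<^sub>R h) \<longlongrightarrow> k s) (at_right 0)"
        proof (rule Lim_transform_eventually[OF lim_k])
          show "\<forall>\<^sub>F h in at_right 0. integral {s..s + h} k /\<^sub>R h = (z (s + h) - z s) /\<^sub>R h"
            using evt eventually_at_right_less[of "0::real"]
          proof eventually_elim
            case (elim h)
            then show ?case using integral_unique[OF k_int[of s "s + h"]] s by simp
          qed
        qed
        have cost: "\<forall>\<^sub>F h in at_right 0. \<bar>integral {s..s + h} rc - h * rc s\<bar> < h * e" if "0 < e" for e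
          using tendstoD[OF lim_rc \<open>0 < e\<close>] eventually_at_right_less[of "0::real"]
        proof eventually_elim
          case (elim h)
          have "integral {s..s + h} rc - h * rc s = h * (integral {s..s + h} rc /\<^sub>R h - rc s)"
            using elim by (simp add: right_diff_distrib)
          then show ?case using elim by (simp add: abs_mult dist_real_def)
        qed
        \<comment> \<open>At a regular time the original path leads from \<open>z (s + h)\<close>
          into \<open>z s\<close> with average velocity near \<open>- k s\<close> and average cost
          near \<open>rc s\<close>. Half of \<open>\<eta>\<close> is spent on the resulting
          derivative estimate, half on replacing \<open>h * rc s\<close> by the integral of
          \<open>rc\<close>.\<close>
        have Lp: "Lplus L (z s) (- k s) \<le> ereal (rc s + \<eta> / 4)"
        proof (rule Lplus_le_of_approach[where q = "\<lambda>h. z (s + h)"])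
          show "((\<lambda>h. (z s - z (s + h)) /\<^sub>R h) \<longlongrightarrow> - k s) (at_right 0)"
            using tendsto_minus[OF vel] by (simp add: scaleR_minus_right[symmetric] del: scaleR_minus_right)
          have "0 < \<eta> / 4" using \<open>0 < \<eta>\<close> by simp
          from cost[OF this] evt eventually_at_right_less[of "0::real"]
          show "\<forall>\<^sub>F h in at_right 0. steer L h (z (s + h)) (z s) (h * (rc s + \<eta> / 4))"
          proof eventually_elim
            case (elim h)
            then have "steer L h (z (s + h)) (z s) (integral {s..s + h} rc)" using st[of s "s + h"] s by simp
            then show ?case by (rule steer_mono) (use elim(1) in \<open>unfold distrib_left, linarith\<close>)
          qed
        qed
        obtain w where w: "W (T, z s) = ereal w" using WT nn[of T "z s"] T s by (cases "W (T, z s)") auto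
        have "D_down W (T, z s) (1, - v) \<le> Lplus L (z s) v" for v
          using b w T s by (simp add: cond_b_def)
        from this[of "- k s"] have "D_down W (T, z s) (1, k s) \<le> Lplus L (z s) (- k s)" by (simp only: minus_minus)
        also note Lp
        also have "ereal (rc s + \<eta> / 4) < ereal (rc s + \<eta> / 2)" using \<open>0 < \<eta>\<close> by simp
        finally have "D_down W (T, z s) (1, k s) < ereal (rc s + \<eta> / 2)" .
        from D_down_along[where W = W, OF this w tendsto_Pair[OF tendsto_const vel]]
        have evW: "\<forall>\<^sub>F h in at_right 0. W ((T, z s) + h *\<^sub>R (1, (z (s + h) - z s) /\<^sub>R h)) < ereal (w + h * (rc s + \<eta> / 2))" .
        have "0 < \<eta> / 2" using \<open>0 < \<eta>\<close> by simp
        from evW cost[OF this] evt eventually_at_right_less[of "0::real"]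
        have "\<forall>\<^sub>F h in at_right 0. W ((T, z s) + h *\<^sub>R (1, (z (s + h) - z s) /\<^sub>R h)) < ereal (w + h * (rc s + \<eta> / 2)) \<and>
          \<bar>integral {s..s + h} rc - h * rc s\<bar> < h * (\<eta> / 2) \<and> h < t - s \<and> 0 < h"
          by eventually_elim auto
        then obtain h where h: "0 < h" "h < t - s"
          and Wh: "W ((T, z s) + h *\<^sub>R (1, (z (s + h) - z s) /\<^sub>R h)) < ereal (w + h * (rc s + \<eta> / 2))"
          and ch: "\<bar>integral {s..s + h} rc - h * rc s\<bar> < h * (\<eta> / 2)"
          using eventually_happens trivial_limit_at_right_real by (metis (no_types, lifting))
        have \<omega>h: "\<omega> s \<le> \<omega> (s + h)" using \<omega>_split[of h] \<omega>_incr[of s "s + h"] h s by simp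
        have "W (T + h, z (s + h)) \<le> ereal (w + h * (rc s + \<eta> / 2))" using Wh h by simp
        also have "w + h * (rc s + \<eta> / 2) \<le> ?B (s + h)"
        proof -
          have "w \<le> ?B s" using WT w by simp
          moreover have "(M + 1) * \<omega> s \<le> (M + 1) * \<omega> (s + h)" using \<omega>h \<open>0 \<le> M\<close> by (intro mult_left_mono) auto
          moreover have "h * rc s \<le> integral {s..s + h} rc + h * (\<eta> / 2)" using ch by linarith
          ultimately show ?thesis using A'_split[of h] h by (simp add: algebra_simps)
        qed
        finally have "W (T + h, z (s + h)) \<le> ereal (?B (s + h))" by simp
        then show ?thesis using h T \<omega>h by (intro exI[of _ h] conjI exI[of _ "T + h"]) auto
      qed
      then show "\<exists>m'>s. m' \<le> t \<and> (\<exists>T\<ge>m'. T \<le> m' + \<omega> m' \<and> W (T, z m') \<le> ereal (?B m'))"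
        by (metis less_add_same_cancel1)
    qed
    then obtain T where T: "t \<le> T" "T \<le> t + \<omega> t" "W (T, z t) \<le> ereal (?B t)" by blast
    have "\<omega> t \<le> \<eta>" using \<omega>_le[of t] \<open>0 \<le> t\<close> by simp
    moreover have "(M + 1) * \<omega> t \<le> (M + 1) * \<eta>" using \<open>\<omega> t \<le> \<eta>\<close> \<open>0 \<le> M\<close> by (intro mult_left_mono) auto
    moreover have "A' t = C" unfolding A'_def by (rule integral_unique[OF rc_int])
    moreover have "z t = x" by (simp add: z_def y0)
    ultimately show ?thesis
      using T by (intro exI[of _ T]) (auto elim!: order_trans)
  qed
  define \<eta> where "\<eta> n = 1 / real (Suc n)" for n
  have \<eta>: "\<eta> \<longlonglongrightarrow> 0" "\<And>n. 0 < \<eta> n" unfolding \<eta>_def by (intro LIMSEQ_Suc[OF lim_1_over_n], simp)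
  obtain T where T: "\<And>n. t \<le> T n" "\<And>n. T n \<le> t + \<eta> n"
    "\<And>n. W (T n, x) \<le> ereal (f + C + \<eta> n * t + (M + 1) * \<eta> n)"
    using approx[OF \<eta>(2)] by metis
  have "W (t, x) \<le> ereal (f + C + 0 * t + (M + 1) * 0)"
  proof (rule lsc_on_limit_le[OF lsc, where X = "\<lambda>n. (T n, x)"])
    have "T \<longlonglongrightarrow> t"
    proof (rule tendsto_sandwich[of "\<lambda>_. t" T _ "\<lambda>n. t + \<eta> n"])
      show "(\<lambda>n. t + \<eta> n) \<longlonglongrightarrow> t" using tendsto_add[OF tendsto_const \<eta>(1), of t] by simp
    qed (use T(1,2) in \<open>auto intro: always_eventually\<close>)
    then show "(\<lambda>n. (T n, x)) \<longlonglongrightarrow> (t, x)" by (intro tendsto_intros)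
    show "(\<lambda>n. f + C + \<eta> n * t + (M + 1) * \<eta> n) \<longlonglongrightarrow> f + C + 0 * t + (M + 1) * 0" by (intro tendsto_intros \<eta>)
    show "(T n, x) \<in> {0..} \<times> UNIV" for n using T(1)[of n] \<open>0 \<le> t\<close> by simp
  qed (use T \<open>0 \<le> t\<close> in auto)
  also have "\<dots> \<le> ereal c" using lt by (simp add: f)
  finally show "W (t, x) \<le> ereal c" .
qed

end

theorem theorem5p1:
  fixes L :: "real ^ 'n \<Rightarrow> real ^ 'n \<Rightarrow> real"
    and \<phi> :: "real ^ 'n \<Rightarrow> ereal"
  assumes L_nonneg: "\<And>x u. 0 \<le> L x u"
    and L_lsc: "lsc_on UNIV (\<lambda>(x, u). L x u)"
    and L_convex: "\<And>x. convex_on UNIV (L x)"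
    and L_growth: "\<exists>\<Theta> :: real ^ 'n \<Rightarrow> real. (\<forall>u. 0 \<le> \<Theta> u) \<and> convex_on UNIV \<Theta> \<and>
          filterlim (\<lambda>u. \<Theta> u / norm u) at_top at_infinity \<and> (\<forall>x u. \<Theta> u \<le> L x u)"
    and phi_nonneg: "\<And>x. 0 \<le> \<phi> x"
    and phi_lsc: "lsc_on UNIV \<phi>"
    and phi_proper: "\<exists>x. \<phi> x \<noteq> \<infinity>"
    and L_bounded: "locally_bounded (\<lambda>(x, u). L x u)"
  shows "(lsc_on ({0..} \<times> UNIV) (value_fun L \<phi>) \<and> cond_a L (value_fun L \<phi>) \<and> cond_b L (value_fun L \<phi>))
    \<and> (\<forall>W. nonneg_lsc_with_initial \<phi> W \<longrightarrow>
          (cond_a L W \<longrightarrow> (\<forall>t\<ge>0. \<forall>x. W (t, x) \<ge> value_fun L \<phi> (t, x))) \<and>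
          (cond_b L W \<longrightarrow> (\<forall>t\<ge>0. \<forall>x. W (t, x) \<le> value_fun L \<phi> (t, x))))
    \<and> (nonneg_lsc_with_initial \<phi> (value_fun L \<phi>) \<and> cond_a L (value_fun L \<phi>) \<and> cond_b L (value_fun L \<phi>) \<and>
        (\<forall>W. nonneg_lsc_with_initial \<phi> W \<and> cond_a L W \<and> cond_b L W \<longrightarrow>
          (\<forall>t\<ge>0. \<forall>x. W (t, x) = value_fun L \<phi> (t, x))))"
proof -
  interpret bolza L \<phi>
  proof
    show "0 \<le> L x u" "lsc_on UNIV (\<lambda>(x, u). L x u)" "convex_on UNIV (L x)"
      "locally_bounded (\<lambda>(x, u). L x u)" "0 \<le> \<phi> x" "lsc_on UNIV \<phi>" for x u
      by (fact L_nonneg L_lsc L_convex L_bounded phi_nonneg phi_lsc)+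
    show "\<exists>K. \<forall>x u. norm u \<le> \<eta> * L x u + K" if "0 < \<eta>" for \<eta>
      using L_growth superlinear_growth_bound[OF _ _ _ that, of _ L] by blast
  qed
  have a: "cond_a L (value_fun L \<phi>)"
    unfolding cond_a_def using value_D_up_le by blast
  have b: "cond_b L (value_fun L \<phi>)"
    unfolding cond_b_def using value_D_down_le by blast
  have init: "nonneg_lsc_with_initial \<phi> (value_fun L \<phi>)"
    unfolding nonneg_lsc_with_initial_def by (simp add: value_nonneg value_lsc value_0)
  show ?thesis
    using a b init value_lsc value_le_of_cond_a value_ge_of_cond_b by (blast intro: antisym)
qed

end
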